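(* Let $k\ge 2$ and $\ell \ge 1$ be constant integers. Assuming SETH, distinguishing between $k$-radius $\leq 2\ell$ and $k$-radius $\geq 3\ell$ cannot be done in $O(m^{k-\delta})$ time on undirected unweighted graphs with $m$ edges, for any constant $\delta>0$. As a corollary, for any constants $\varepsilon\in (0,1)$ and $\beta\ge 0$, computing a $(\frac{3}{2}-\varepsilon,\beta)$-approximation of the $k$-radius requires $m^{k-o(1)}$ time under SETH.
   Context: All graphs are undirected and unweighted, with $n$ vertices and $m\ge n-1$ edges; $d(u,v)$ is the shortest-path distance. For a positive integer $k$, the $k$-radius of $G=(V,E)$ is $R_k(G)=\min_{C\subseteq V,|C|=k}\max_{v\in V} d(v,C)$, where $d(v,C)=\min_{c\in C}d(v,c)$. "Distinguishing between $k$-radius $\le a$ and $\ge b$" means: given a graph promised to satisfy either $R_k(G)\le a$ or $R_k(G)\ge b$, decide which. An $(\alpha,\beta)$-approximation of the $k$-radius is a value $\tilde R$ with $R_k(G)\le \tilde R\le \alpha R_k(G)+\beta$. SETH: for every $\varepsilon>0$ there is an integer $q\ge 3$ such that $q$-SAT on $N$ variables cannot be solved in $O((2-\varepsilon)^N)$ time. Model: word-RAM with $O(\log n)$-bit words. *)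

theory Defs
  imports Complex_Main "HOL-Library.Extended_Nat" "HOL-Library.Extended_Real"
    "HOL-Library.Landau_Symbols"
begin

definition gdist :: "'a set set \<Rightarrow> 'a \<Rightarrow> 'a \<Rightarrow> enat" where
  "gdist E u v = (INF i \<in> {i. ((\<lambda>x y. {x, y} \<in> E) ^^ i) u v}. enat i)"

text \<open>Distances live in \<^typ>\<open>enat\<close>: the distance of vertices in different components is
  \<open>\<infinity>\<close>.\<close>

definition k_radius :: "nat \<Rightarrow> 'a set \<Rightarrow> 'a set set \<Rightarrow> enat" where
  "k_radius k V E = (INF C \<in> {C. C \<subseteq> V \<and> card C = k}. SUP v \<in> V. INF c \<in> C. gdist E v c)"

text \<open>An input graph has the vertices \<open>0, \<dots>, n - 1\<close> and is given by a list of its edges,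
  each edge listed once and in one orientation only, so that \<^term>\<open>length es\<close> is the number of
  edges.\<close>

definition edge_set :: "(nat \<times> nat) list \<Rightarrow> nat set set" where
  "edge_set es = (\<lambda>(u, v). {u, v}) ` set es"

definition input_graph :: "nat \<Rightarrow> (nat \<times> nat) list \<Rightarrow> bool" where
  "input_graph n es \<longleftrightarrow>
     (\<forall>(u, v) \<in> set es. u < n \<and> v < n \<and> u \<noteq> v) \<and>
     distinct (map (\<lambda>(u, v). {u, v}) es) \<and>
     n \<le> length es + 1"

definition encode_graph :: "nat \<Rightarrow> (nat \<times> nat) list \<Rightarrow> nat list" where
  "encode_graph n es = n # length es # concat (map (\<lambda>(u, v). [u, v]) es)"

datatype binop = Add | Sub | Mul | Div | Mod | And | Or | Xor | Shl | Shr

text \<open>\<open>Sub\<close> is truncated subtraction, so that with \<open>JumpZero\<close> it provides comparisons.\<close>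

fun apply_binop :: "binop \<Rightarrow> nat \<Rightarrow> nat \<Rightarrow> nat" where
  "apply_binop Add x y = x + y"
| "apply_binop Sub x y = x - y"
| "apply_binop Mul x y = x * y"
| "apply_binop Div x y = x div y"
| "apply_binop Mod x y = x mod y"
| "apply_binop And x y = Bit_Operations.and x y"
| "apply_binop Or x y = Bit_Operations.or x y"
| "apply_binop Xor x y = Bit_Operations.xor x y"
| "apply_binop Shl x y = push_bit y x"
| "apply_binop Shr x y = drop_bit y x"

text \<open>The \<^typ>\<open>nat\<close> arguments are register numbers, except for the constant loaded by \<open>Const\<close>
  and the jump target of \<open>JumpZero\<close>. In \<open>Load\<close> and \<open>Store\<close> the second register holds the memory
  address.\<close>

datatype instr =
    Const nat nat
  | Op binop nat nat nat
  | Load nat nat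
  | Store nat nat
  | JumpZero nat nat

type_synonym program = "instr list"

record state =
  pc :: nat
  reg :: "nat \<Rightarrow> nat"
  mem :: "nat \<Rightarrow> nat"

fun exec_instr :: "instr \<Rightarrow> state \<Rightarrow> state" where
  "exec_instr (Const r x) s = s\<lparr>pc := pc s + 1, reg := (reg s)(r := x)\<rparr>"
| "exec_instr (Op f r a b) s =
     s\<lparr>pc := pc s + 1, reg := (reg s)(r := apply_binop f (reg s a) (reg s b))\<rparr>"
| "exec_instr (Load r a) s = s\<lparr>pc := pc s + 1, reg := (reg s)(r := mem s (reg s a))\<rparr>"
| "exec_instr (Store r a) s = s\<lparr>pc := pc s + 1, mem := (mem s)(reg s a := reg s r)\<rparr>"
| "exec_instr (JumpZero r l) s = s\<lparr>pc := (if reg s r = 0 then l else pc s + 1)\<rparr>"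

text \<open>A program halts by leaving its range of instructions.\<close>

definition halted :: "program \<Rightarrow> state \<Rightarrow> bool" where
  "halted P s \<longleftrightarrow> length P \<le> pc s"

definition step :: "program \<Rightarrow> state \<Rightarrow> state" where
  "step P s = (if halted P s then s else exec_instr (P ! pc s) s)"

definition init_state :: "nat list \<Rightarrow> state" where
  "init_state xs =
     \<lparr>pc = 0, reg = (\<lambda>_. 0)(0 := length xs), mem = (\<lambda>a. if a < length xs then xs ! a else 0)\<rparr>"

definition fits :: "nat \<Rightarrow> state \<Rightarrow> bool" where
  "fits w s \<longleftrightarrow> (\<forall>r. reg s r < 2 ^ w) \<and> (\<forall>a. mem s a < 2 ^ w)"

text \<open>On input \<open>xs\<close>, with words of \<open>w\<close> bits, the program halts after at most \<open>t\<close> instructions in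
  a state satisfying \<open>Q\<close>. A program must not overflow: all words occurring in the run, and hence
  all addresses used, are below \<open>2 ^ w\<close>. As the word sizes below are only fixed up to a constant
  factor chosen along with the program, this is no restriction compared with arithmetic modulo
  \<open>2 ^ w\<close>.\<close>

definition runs :: "program \<Rightarrow> nat \<Rightarrow> nat list \<Rightarrow> nat \<Rightarrow> (state \<Rightarrow> bool) \<Rightarrow> bool" where
  "runs P w xs t Q \<longleftrightarrow>
     (\<exists>i \<le> t. halted P ((step P ^^ i) (init_state xs)) \<and>
        (\<forall>j \<le> i. fits w ((step P ^^ j) (init_state xs))) \<and>
        Q ((step P ^^ i) (init_state xs)))"

text \<open>A literal \<open>(v, b)\<close> holds under an assignment giving \<open>v\<close> the value \<open>b\<close>.\<close>

type_synonym cnf = "(nat \<times> bool) list list"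

text \<open>The clauses are distinct, so the size of a q-CNF formula on \<open>N\<close> variables is polynomial in
  \<open>N\<close>. Otherwise reading the input could not be bounded in terms of \<open>N\<close> at all and the hypothesis
  below would hold trivially.\<close>

definition is_cnf :: "nat \<Rightarrow> nat \<Rightarrow> cnf \<Rightarrow> bool" where
  "is_cnf q N F \<longleftrightarrow>
     distinct F \<and> (\<forall>C \<in> set F. length C \<le> q \<and> (\<forall>(v, b) \<in> set C. v < N))"

definition satisfiable :: "cnf \<Rightarrow> bool" where
  "satisfiable F \<longleftrightarrow> (\<exists>\<alpha> :: nat \<Rightarrow> bool. \<forall>C \<in> set F. \<exists>(v, b) \<in> set C. \<alpha> v = b)"

definition encode_cnf :: "nat \<Rightarrow> cnf \<Rightarrow> nat list" where
  "encode_cnf N F =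
     N # length F # concat (map (\<lambda>C. length C # map (\<lambda>(v, b). 2 * v + of_bool b) C) F)"

text \<open>Words have \<open>O(N)\<close> bits, that is, a number of bits logarithmic in the \<open>2 ^ O(N)\<close> memory cells
  that an exponential-time algorithm may have to address.\<close>

definition qsat_in_time :: "nat \<Rightarrow> (nat \<Rightarrow> nat) \<Rightarrow> bool" where
  "qsat_in_time q T \<longleftrightarrow>
     (\<exists>P c. \<forall>N F. is_cnf q N F \<longrightarrow>
        runs P (c * (N + 1)) (encode_cnf N F) (T N) (\<lambda>s. reg s 0 = of_bool (satisfiable F)))"

text \<open>The restriction \<open>\<epsilon> < 2\<close> keeps the base positive. It is needed since \<open>O\<close> is defined through
  absolute values.\<close>

definition SETH :: bool where
  "SETH \<longleftrightarrow>
     (\<forall>\<epsilon>::real. 0 < \<epsilon> \<and> \<epsilon> < 2 \<longrightarrow>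
        (\<exists>q \<ge> 3. \<not> (\<exists>T. qsat_in_time q T \<and> (\<lambda>N. real (T N)) \<in> O(\<lambda>N. (2 - \<epsilon>) ^ N))))"

definition word_size :: "nat \<Rightarrow> nat \<Rightarrow> nat" where
  "word_size c n = nat \<lceil>real c * log 2 (real n)\<rceil>"

text \<open>The time bound \<open>T\<close> is a function of the number of edges. Graphs with fewer than \<open>k\<close>
  vertices, for which the k-radius is undefined, are not inputs.\<close>

definition distinguishes_in_time :: "nat \<Rightarrow> nat \<Rightarrow> nat \<Rightarrow> (nat \<Rightarrow> nat) \<Rightarrow> bool" where
  "distinguishes_in_time k a b T \<longleftrightarrow>
     (\<exists>P c. \<forall>n es. input_graph n es \<and> k \<le> n \<longrightarrow>
        (k_radius k {..<n} (edge_set es) \<le> enat a \<longrightarrow>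
           runs P (word_size c n) (encode_graph n es) (T (length es)) (\<lambda>s. reg s 0 = 1)) \<and>
        (k_radius k {..<n} (edge_set es) \<ge> enat b \<longrightarrow>
           runs P (word_size c n) (encode_graph n es) (T (length es)) (\<lambda>s. reg s 0 = 0)))"

text \<open>The output is a fraction; denominator 0 stands for \<open>\<infinity>\<close>, which is the k-radius of a graph
  with more than \<open>k\<close> components.\<close>

definition output_value :: "state \<Rightarrow> ereal" where
  "output_value s = (if reg s 1 = 0 then \<infinity> else ereal (real (reg s 0) / real (reg s 1)))"

definition is_approx :: "real \<Rightarrow> real \<Rightarrow> enat \<Rightarrow> ereal \<Rightarrow> bool" where
  "is_approx \<alpha> \<beta> R x \<longleftrightarrow>
     ereal_of_enat R \<le> x \<and> x \<le> ereal \<alpha> * ereal_of_enat R + ereal \<beta>"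

definition approximates_in_time :: "nat \<Rightarrow> real \<Rightarrow> real \<Rightarrow> (nat \<Rightarrow> nat) \<Rightarrow> bool" where
  "approximates_in_time k \<alpha> \<beta> T \<longleftrightarrow>
     (\<exists>P c. \<forall>n es. input_graph n es \<and> k \<le> n \<longrightarrow>
        runs P (word_size c n) (encode_graph n es) (T (length es))
          (\<lambda>s. is_approx \<alpha> \<beta> (k_radius k {..<n} (edge_set es)) (output_value s)))"

end

theory Submission
  imports Defs "HOL-Real_Asymp.Real_Asymp"
begin

text \<open>Split the \<open>N\<close> variables of a q-CNF formula into \<open>k\<close> blocks and take as vertices the
  \<open>k * 2 ^ (N / k)\<close> partial assignments, a hub and a pin for every block, and two vertices for every
  clause. Every edge is subdivided into a path of length \<open>l\<close>. A satisfying assignment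
  gives \<open>k\<close> partial assignments within distance \<open>2 * l\<close> of everything. Conversely, the pins
  force \<open>k\<close> centres at distance less than \<open>3 * l\<close> to single out one partial assignment per block,
  and the pins of the clauses force these to satisfy the formula. As \<open>q\<close> is constant, there are
  only polynomially many clauses, so the graph has \<open>2 ^ (N / k)\<close> edges up to a polynomial factor, and no
  sparsification is needed. The reduction is carried out by an explicit program that writes
  the graph behind its input and then simulates the given algorithm on it. The statement on
  approximation follows by choosing \<open>l\<close> so large that the additive error is absorbed.\<close>

section \<open>Structured programs and simulation\<close>

text \<open>The factors 2 and 3 are distances before subdividing: a pin is at distance 2 from the
  assignments that serve it, and all vertices except these, its only neighbour and the pin itself
  are at distance at least 3. The exponent \<open>k\<close> comes from the size:
  \<open>2 ^ (N / k)\<close> raised to \<open>k - \<delta>\<close> has a base below 2 in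
  \<open>N\<close>, and the slack swallows polynomial factors.

  The obstacle in the lower bound is that centres may lie inside the subdivided paths. No exact
  distances are computed. The distance to a pin, truncated at 3, is a 1-Lipschitz potential that
  extends linearly to the paths; a centre closer than \<open>3 * l\<close> then lies on an edge with
  an end of potential below 3. No edge touches the vicinities of two blocks, so centres inside paths
  gain nothing.

  The obstacle in the reduction is the machine: overflow is forbidden, so every word needs a bound
  along with every running time, and the simulated program shares registers and memory with the
  formula. For this reason it is run with shifted registers and addresses.\<close>

definition reach :: "program \<Rightarrow> nat \<Rightarrow> nat \<Rightarrow> state \<Rightarrow> state \<Rightarrow> bool" where
  "reach P w t s s' \<longleftrightarrow> (step P ^^ t) s = s' \<and> (\<forall>j\<le>t. fits w ((step P ^^ j) s))"

lemma reach_refl: "fits w s \<Longrightarrow> reach P w 0 s s"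
  by (simp add: reach_def)

lemma reach_step: "fits w s \<Longrightarrow> fits w (step P s) \<Longrightarrow> reach P w 1 s (step P s)"
  by (auto simp: reach_def le_Suc_eq)

lemma reach_fits: "reach P w t s s' \<Longrightarrow> fits w s'"
  by (auto simp: reach_def)

lemma reach_trans:
  assumes "reach P w t1 s s'" "reach P w t2 s' s''"
  shows "reach P w (t1 + t2) s s''"
proof -
  have *: "(step P ^^ (j + t1)) s = (step P ^^ j) s'" for j
    using assms(1) by (simp add: reach_def funpow_add)
  have "fits w ((step P ^^ j) s)" if "j \<le> t1 + t2" for j
  proof (cases "j \<le> t1")
    case True
    then show ?thesis using assms(1) by (simp add: reach_def)
  next
    case False
    then have "j = (j - t1) + t1" by simp
    then have "(step P ^^ j) s = (step P ^^ (j - t1)) s'" using * by metis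
    then show ?thesis using assms(2) that by (simp add: reach_def)
  qed
  moreover have "(step P ^^ (t1 + t2)) s = s''"
    using *[of t2] assms(2) by (simp add: reach_def add.commute)
  ultimately show ?thesis by (simp add: reach_def)
qed

lemma runs_iff_reach:
  "runs P w xs t Q \<longleftrightarrow> (\<exists>i\<le>t. \<exists>s. reach P w i (init_state xs) s \<and> halted P s \<and> Q s)"
  by (auto simp: runs_def reach_def)

lemma runs_mono: "runs P w xs t Q \<Longrightarrow> t \<le> t' \<Longrightarrow> runs P w xs t' Q"
  unfolding runs_def by (meson order_trans)

section \<open>Timed total correctness of relocatable code\<close>

text \<open>Relocatable code: the list of instructions may depend on the address of the first one.\<close>

type_synonym code = "nat \<Rightarrow> instr list"

definition placed :: "program \<Rightarrow> nat \<Rightarrow> instr list \<Rightarrow> bool" where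
  "placed P b is \<longleftrightarrow> (\<exists>pre post. P = pre @ is @ post \<and> length pre = b)"

lemma placed_append:
  "placed P b (xs @ ys) \<longleftrightarrow> placed P b xs \<and> placed P (b + length xs) ys"
proof
  assume "placed P b (xs @ ys)"
  then obtain pre post where *: "P = pre @ (xs @ ys) @ post" "length pre = b"
    by (auto simp: placed_def)
  then have "P = pre @ xs @ (ys @ post)" "P = (pre @ xs) @ ys @ post" by auto
  then show "placed P b xs \<and> placed P (b + length xs) ys"
    using *(2) unfolding placed_def by (metis length_append)
next
  assume "placed P b xs \<and> placed P (b + length xs) ys"
  then obtain p1 q1 p2 q2 where *: "P = p1 @ xs @ q1" "length p1 = b"
    "P = p2 @ ys @ q2" "length p2 = b + length xs"
    unfolding placed_def by blast
  have "take (b + length xs) P = p1 @ xs" using *(1,2) by simp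
  moreover have "take (b + length xs) P = p2" unfolding *(3) using *(4) by simp
  ultimately have "P = p1 @ (xs @ ys) @ q2" using *(3) by simp
  then show "placed P b (xs @ ys)" using *(2) unfolding placed_def by blast
qed

lemma placed_Nil: "placed P b [] \<longleftrightarrow> b \<le> length P"
proof
  assume "b \<le> length P"
  then have "P = take b P @ [] @ drop b P" "length (take b P) = b" by auto
  then show "placed P b []" unfolding placed_def by blast
qed (auto simp: placed_def)

lemma placed_Cons:
  "placed P b (x # xs) \<longleftrightarrow> b < length P \<and> P ! b = x \<and> placed P (Suc b) xs"
proof -
  have "placed P b [x] \<longleftrightarrow> b < length P \<and> P ! b = x"
  proof
    assume "b < length P \<and> P ! b = x"
    then have "P = take b P @ [x] @ drop (Suc b) P" "length (take b P) = b"
      by (auto simp: id_take_nth_drop)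
    then show "placed P b [x]" unfolding placed_def by blast
  qed (auto simp: placed_def)
  then show ?thesis using placed_append[of P b "[x]" xs] by simp
qed

text \<open>Uniform in the surrounding program and the load address. Control has to leave at the end
  of the code, which makes sequencing plain concatenation. That all words fit initially is built in,
  so no triple has to carry it as an assertion.\<close>

definition wp :: "nat \<Rightarrow> code \<Rightarrow> nat \<Rightarrow> ((nat \<Rightarrow> nat) \<Rightarrow> (nat \<Rightarrow> nat) \<Rightarrow> bool) \<Rightarrow>
    (nat \<Rightarrow> nat) \<Rightarrow> (nat \<Rightarrow> nat) \<Rightarrow> bool" where
  "wp w c t Q g m \<longleftrightarrow>
     (\<forall>P b. placed P b (c b) \<and> fits w \<lparr>pc = b, reg = g, mem = m\<rparr> \<longrightarrow>
        (\<exists>t'\<le>t. \<exists>g' m'. reach P w t' \<lparr>pc = b, reg = g, mem = m\<rparr>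
             \<lparr>pc = b + length (c b), reg = g', mem = m'\<rparr> \<and> Q g' m'))"

definition blk :: "instr list \<Rightarrow> code" where
  "blk is = (\<lambda>_. is)"

definition seq :: "code \<Rightarrow> code \<Rightarrow> code" (infixr ";;" 60) where
  "c1 ;; c2 = (\<lambda>b. c1 b @ c2 (b + length (c1 b)))"

definition cond :: "nat \<Rightarrow> code \<Rightarrow> code" where
  "cond r c = (\<lambda>b. JumpZero r (b + 1 + length (c (b + 1))) # c (b + 1))"

text \<open>There is no unconditional jump, so register 2 is set to 0 and tested. Before that it
  holds the 1 for the decrement; it is thus lost in every round. The exit skips the test, the body
  and the four instructions of the tail, hence the offset 5.\<close>

definition loop :: "nat \<Rightarrow> code \<Rightarrow> code" where
  "loop r c = (\<lambda>b. JumpZero r (b + length (c (b + 1)) + 5) # c (b + 1) @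
     [Const 2 1, Op Sub r r 2, Const 2 0, JumpZero 2 b])"

lemma wp_mono:
  assumes "wp w c t Q g m" "t \<le> t'" "\<And>g' m'. Q g' m' \<Longrightarrow> Q' g' m'"
  shows "wp w c t' Q' g m"
  using assms unfolding wp_def by (meson order_trans)

lemma wp_seq:
  assumes "wp w c1 t1 (wp w c2 t2 Q) g m"
  shows "wp w (c1 ;; c2) (t1 + t2) Q g m"
  unfolding wp_def
proof (intro allI impI, elim conjE)
  fix P b
  assume pl: "placed P b ((c1 ;; c2) b)" and f: "fits w \<lparr>pc = b, reg = g, mem = m\<rparr>"
  let ?b = "b + length (c1 b)"
  have pl1: "placed P b (c1 b)" and pl2: "placed P ?b (c2 ?b)"
    using pl by (simp_all add: seq_def placed_append)
  obtain t' g' m' where 1: "t' \<le> t1" "reach P w t' \<lparr>pc = b, reg = g, mem = m\<rparr>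
      \<lparr>pc = ?b, reg = g', mem = m'\<rparr>" "wp w c2 t2 Q g' m'"
    using assms pl1 f unfolding wp_def by blast
  obtain t'' g'' m'' where 2: "t'' \<le> t2" "reach P w t'' \<lparr>pc = ?b, reg = g', mem = m'\<rparr>
      \<lparr>pc = ?b + length (c2 ?b), reg = g'', mem = m''\<rparr>" "Q g'' m''"
    using 1(3) pl2 reach_fits[OF 1(2)] unfolding wp_def by blast
  show "\<exists>t'\<le>t1 + t2. \<exists>g' m'. reach P w t' \<lparr>pc = b, reg = g, mem = m\<rparr>
      \<lparr>pc = b + length ((c1 ;; c2) b), reg = g', mem = m'\<rparr> \<and> Q g' m'"
    using reach_trans[OF 1(2) 2(2)] 1(1) 2(1,3)
    by (intro exI[of _ "t' + t''"] conjI exI[of _ g''] exI[of _ m'']) (auto simp: seq_def add.assoc)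
qed

text \<open>Only \<open>Const\<close> and \<open>Op\<close> can create new words, so only they carry
  a size condition. Blocks are straight-line code, and a jump has no valid precondition.\<close>

fun ipre :: "nat \<Rightarrow> instr \<Rightarrow> ((nat \<Rightarrow> nat) \<Rightarrow> (nat \<Rightarrow> nat) \<Rightarrow> bool) \<Rightarrow>
    (nat \<Rightarrow> nat) \<Rightarrow> (nat \<Rightarrow> nat) \<Rightarrow> bool" where
  "ipre w (Const r x) Q g m = (x < 2 ^ w \<and> Q (g(r := x)) m)"
| "ipre w (Op f r a b) Q g m =
     (apply_binop f (g a) (g b) < 2 ^ w \<and> Q (g(r := apply_binop f (g a) (g b))) m)"
| "ipre w (Load r a) Q g m = Q (g(r := m (g a))) m"
| "ipre w (Store r a) Q g m = Q g (m(g a := g r))"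
| "ipre w (JumpZero r l) Q g m = False"

primrec blkpre :: "nat \<Rightarrow> instr list \<Rightarrow> ((nat \<Rightarrow> nat) \<Rightarrow> (nat \<Rightarrow> nat) \<Rightarrow> bool) \<Rightarrow>
    (nat \<Rightarrow> nat) \<Rightarrow> (nat \<Rightarrow> nat) \<Rightarrow> bool" where
  "blkpre w [] Q = Q"
| "blkpre w (i # is) Q = ipre w i (blkpre w is Q)"

lemma blkpre_append: "blkpre w (xs @ ys) Q = blkpre w xs (blkpre w ys Q)"
  by (induction xs) auto

lemma ipre_exec:
  assumes "ipre w i Q g m" "fits w \<lparr>pc = b, reg = g, mem = m\<rparr>"
  obtains g' m' where "exec_instr i \<lparr>pc = b, reg = g, mem = m\<rparr> = \<lparr>pc = Suc b, reg = g', mem = m'\<rparr>"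
    "fits w \<lparr>pc = Suc b, reg = g', mem = m'\<rparr>" "Q g' m'"
  using assms by (cases i) (auto simp: fits_def)

lemma wp_blk: "blkpre w is Q g m \<Longrightarrow> wp w (blk is) (length is) Q g m"
proof (induction "is" arbitrary: g m)
  case Nil
  then show ?case by (auto simp: wp_def blk_def intro: reach_refl)
next
  case (Cons i "is")
  show ?case unfolding wp_def
  proof (intro allI impI, elim conjE)
    fix P b
    assume pl: "placed P b (blk (i # is) b)" and f: "fits w \<lparr>pc = b, reg = g, mem = m\<rparr>"
    obtain g' m' where e: "exec_instr i \<lparr>pc = b, reg = g, mem = m\<rparr> = \<lparr>pc = Suc b, reg = g', mem = m'\<rparr>"
      and f': "fits w \<lparr>pc = Suc b, reg = g', mem = m'\<rparr>" and pre: "blkpre w is Q g' m'"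
      using ipre_exec[of w i "blkpre w is Q" g m b] Cons.prems f by auto
    have st: "step P \<lparr>pc = b, reg = g, mem = m\<rparr> = \<lparr>pc = Suc b, reg = g', mem = m'\<rparr>"
      using pl e by (simp add: step_def halted_def placed_Cons blk_def)
    have r1: "reach P w 1 \<lparr>pc = b, reg = g, mem = m\<rparr> \<lparr>pc = Suc b, reg = g', mem = m'\<rparr>"
      using reach_step[OF f, of P] f' unfolding st by simp
    have "placed P (Suc b) (blk is (Suc b))"
      using pl by (simp add: placed_Cons blk_def)
    then obtain t'' g'' m'' where 2: "t'' \<le> length is"
        "reach P w t'' \<lparr>pc = Suc b, reg = g', mem = m'\<rparr>
          \<lparr>pc = Suc b + length is, reg = g'', mem = m''\<rparr>" "Q g'' m''"
      using Cons.IH[OF pre] f' unfolding wp_def blk_def by blast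
    show "\<exists>t'\<le>length (i # is). \<exists>g' m'. reach P w t' \<lparr>pc = b, reg = g, mem = m\<rparr>
        \<lparr>pc = b + length (blk (i # is) b), reg = g', mem = m'\<rparr> \<and> Q g' m'"
      using reach_trans[OF r1 2(2)] 2(1,3)
      by (intro exI[of _ "1 + t''"] conjI exI[of _ g''] exI[of _ m'']) (auto simp: blk_def)
  qed
qed

lemma wp_blk_seq:
  assumes "blkpre w is (wp w c t Q) g m"
  shows "wp w (blk is ;; c) (length is + t) Q g m"
  by (rule wp_seq, rule wp_blk, rule assms)

lemma reach_jump:
  assumes "b < length P" "P ! b = JumpZero r l" "fits w \<lparr>pc = b, reg = g, mem = m\<rparr>"
  shows "reach P w 1 \<lparr>pc = b, reg = g, mem = m\<rparr>
    \<lparr>pc = (if g r = 0 then l else Suc b), reg = g, mem = m\<rparr>"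
proof -
  let ?s = "\<lparr>pc = b, reg = g, mem = m\<rparr>"
  have "step P ?s = \<lparr>pc = (if g r = 0 then l else Suc b), reg = g, mem = m\<rparr>"
    using assms by (simp add: step_def halted_def)
  then show ?thesis using reach_step[of w ?s P] assms(3) by (auto simp: fits_def)
qed

lemma wp_cond:
  assumes "g r = 0 \<Longrightarrow> Q g m" "g r \<noteq> 0 \<Longrightarrow> wp w c t Q g m"
  shows "wp w (cond r c) (1 + t) Q g m"
  unfolding wp_def
proof (intro allI impI, elim conjE)
  fix P b
  assume pl: "placed P b (cond r c b)" and f: "fits w \<lparr>pc = b, reg = g, mem = m\<rparr>"
  let ?n = "length (c (Suc b))"
  have P: "b < length P" "P ! b = JumpZero r (Suc (b + ?n))" "placed P (Suc b) (c (Suc b))"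
    using pl by (simp_all add: cond_def placed_Cons)
  note j = reach_jump[OF P(1,2) f]
  show "\<exists>t'\<le>1 + t. \<exists>g' m'. reach P w t' \<lparr>pc = b, reg = g, mem = m\<rparr>
      \<lparr>pc = b + length (cond r c b), reg = g', mem = m'\<rparr> \<and> Q g' m'"
  proof (cases "g r = 0")
    case True
    then show ?thesis using j assms(1)
      by (intro exI[of _ 1] conjI exI[of _ g] exI[of _ m]) (auto simp: cond_def)
  next
    case False
    then have j': "reach P w 1 \<lparr>pc = b, reg = g, mem = m\<rparr> \<lparr>pc = Suc b, reg = g, mem = m\<rparr>"
      using j by simp
    obtain t' g' m' where "t' \<le> t" "reach P w t' \<lparr>pc = Suc b, reg = g, mem = m\<rparr>
        \<lparr>pc = Suc b + ?n, reg = g', mem = m'\<rparr>" "Q g' m'"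
      using assms(2)[OF False] P(3) reach_fits[OF j'] unfolding wp_def by blast
    then show ?thesis using reach_trans[OF j']
      by (intro exI[of _ "1 + t'"] conjI exI[of _ g'] exI[of _ m']) (auto simp: cond_def)
  qed
qed

text \<open>The index \<open>i\<close> counts completed rounds, while register \<open>r\<close>
  counts down from \<open>n\<close>. The invariant has to survive the tail of the loop, which is why
  the body establishes it for \<open>g'(r := n - Suc i, 2 := 0)\<close>. The 5 instructions per
  round are the test, the three of the tail and the jump back.\<close>

lemma wp_loop:
  fixes I :: "nat \<Rightarrow> (nat \<Rightarrow> nat) \<Rightarrow> (nat \<Rightarrow> nat) \<Rightarrow> bool"
  assumes r: "r \<noteq> 2" and w: "1 < (2::nat) ^ w"
    and start: "I 0 g m" "g r = n"
    and body: "\<And>i g m. i < n \<Longrightarrow> I i g m \<Longrightarrow> g r = n - i \<Longrightarrow>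
      wp w c t (\<lambda>g' m'. g' r = n - i \<and> I (Suc i) (g'(r := n - Suc i, 2 := 0)) m') g m"
  shows "wp w (loop r c) (n * (t + 5) + 1) (\<lambda>g' m'. I n g' m' \<and> g' r = 0) g m"
proof -
  have "wp w (loop r c) ((n - i) * (t + 5) + 1) (\<lambda>g' m'. I n g' m' \<and> g' r = 0) g m"
    if "i \<le> n" "I i g m" "g r = n - i" for i g m
    using that
  proof (induction "n - i" arbitrary: i g m)
    case 0
    show ?case unfolding wp_def
    proof (intro allI impI, elim conjE)
      fix P b
      assume pl: "placed P b (loop r c b)" and f: "fits w \<lparr>pc = b, reg = g, mem = m\<rparr>"
      have "b < length P" "P ! b = JumpZero r (b + length (c (Suc b)) + 5)"
        using pl by (simp_all add: loop_def placed_Cons)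
      note j = reach_jump[OF this f]
      have "i = n" using 0 by simp
      then show "\<exists>t'\<le>(n - i) * (t + 5) + 1. \<exists>g' m'. reach P w t' \<lparr>pc = b, reg = g, mem = m\<rparr>
          \<lparr>pc = b + length (loop r c b), reg = g', mem = m'\<rparr> \<and> I n g' m' \<and> g' r = 0"
        using j 0 by (intro exI[of _ 1] conjI exI[of _ g] exI[of _ m]) (auto simp: loop_def eval_nat_numeral)
    qed
  next
    case (Suc d)
    have i: "i < n" and d: "d = n - Suc i" using Suc by auto
    show ?case unfolding wp_def
    proof (intro allI impI, elim conjE)
      fix P b
      assume pl: "placed P b (loop r c b)" and f: "fits w \<lparr>pc = b, reg = g, mem = m\<rparr>"
      let ?n = "length (c (Suc b))" let ?e = "Suc b + length (c (Suc b))"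
      let ?tl = "[Const 2 1, Op Sub r r 2, Const 2 0]"
      have P: "b < length P" "P ! b = JumpZero r (b + ?n + 5)" "placed P (Suc b) (c (Suc b))"
        "placed P ?e (blk ?tl ?e)" "?e + 3 < length P" "P ! (?e + 3) = JumpZero 2 b"
        using pl by (simp_all add: loop_def placed_Cons placed_append placed_Nil blk_def numeral_3_eq_3)
      have j: "reach P w 1 \<lparr>pc = b, reg = g, mem = m\<rparr> \<lparr>pc = Suc b, reg = g, mem = m\<rparr>"
        using reach_jump[OF P(1,2) f] Suc i by auto
      obtain t1 g1 m1 where 1: "t1 \<le> t" "reach P w t1 \<lparr>pc = Suc b, reg = g, mem = m\<rparr>
        \<lparr>pc = ?e, reg = g1, mem = m1\<rparr>" "g1 r = n - i" "I (Suc i) (g1(r := n - Suc i, 2 := 0)) m1"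
        using body[OF i Suc.prems(2,3)] P(3) reach_fits[OF j] unfolding wp_def by blast
      let ?g2 = "g1(r := n - Suc i, 2 := 0)"
      have fe: "fits w \<lparr>pc = ?e, reg = g1, mem = m1\<rparr>" by (rule reach_fits[OF 1(2)])
      have le: "g1 r < 2 ^ w" using fe by (simp add: fits_def)
      have g2: "g1(2 := Suc 0, r := g1 r - Suc 0, 2 := 0) = ?g2"
        using 1(3) r by (auto simp: fun_eq_iff)
      have "wp w (blk ?tl) (length ?tl) (\<lambda>g' m'. g' = ?g2 \<and> m' = m1) g1 m1"
        by (rule wp_blk) (use w le r 1(3) in \<open>auto simp: g2 fun_eq_iff\<close>)
      then obtain t2 where 2: "t2 \<le> 3" "reach P w t2 \<lparr>pc = ?e, reg = g1, mem = m1\<rparr>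
          \<lparr>pc = ?e + 3, reg = ?g2, mem = m1\<rparr>"
        using P(4) fe unfolding wp_def
        by (auto simp: blk_def numeral_3_eq_3 simp del: One_nat_def)
      have 3: "reach P w 1 \<lparr>pc = ?e + 3, reg = ?g2, mem = m1\<rparr> \<lparr>pc = b, reg = ?g2, mem = m1\<rparr>"
        using reach_jump[OF P(5,6) reach_fits[OF 2(2)]] by simp
      have "wp w (loop r c) ((n - Suc i) * (t + 5) + 1) (\<lambda>g' m'. I n g' m' \<and> g' r = 0) ?g2 m1"
        using Suc.hyps(1)[OF d _ 1(4)] i r by simp
      then obtain t4 g4 m4 where 4: "t4 \<le> (n - Suc i) * (t + 5) + 1"
        "reach P w t4 \<lparr>pc = b, reg = ?g2, mem = m1\<rparr>
          \<lparr>pc = b + length (loop r c b), reg = g4, mem = m4\<rparr>" "I n g4 m4 \<and> g4 r = 0"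
        using pl reach_fits[OF 3] unfolding wp_def by blast
      have "n - i = Suc (n - Suc i)" using i by simp
      then have "1 + (t1 + (t2 + (1 + t4))) \<le> (n - i) * (t + 5) + 1"
        using 1(1) 2(1) 4(1) by simp
      moreover have "reach P w (1 + (t1 + (t2 + (1 + t4)))) \<lparr>pc = b, reg = g, mem = m\<rparr>
          \<lparr>pc = b + length (loop r c b), reg = g4, mem = m4\<rparr>"
        by (intro reach_trans[OF j] reach_trans[OF 1(2)] reach_trans[OF 2(2)] reach_trans[OF 3] 4(2))
      ultimately show "\<exists>t'\<le>(n - i) * (t + 5) + 1. \<exists>g' m'.
          reach P w t' \<lparr>pc = b, reg = g, mem = m\<rparr>
          \<lparr>pc = b + length (loop r c b), reg = g', mem = m'\<rparr> \<and> I n g' m' \<and> g' r = 0"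
        using 4(3) by blast
    qed
  qed
  from this[of 0 g m] start show ?thesis by simp
qed


section \<open>Simulation with shifted registers and memory\<close>

text \<open>The registers of the simulated program are shifted by 50 and its memory by the content of
  register 0. Register 49 is used for addresses.\<close>

fun sim_instr :: "nat \<Rightarrow> nat \<Rightarrow> instr \<Rightarrow> instr list" where
  "sim_instr b n (Const r x) = [Const (r + 50) x, Const 49 0]"
| "sim_instr b n (Op f r x y) = [Op f (r + 50) (x + 50) (y + 50), Const 49 0]"
| "sim_instr b n (Load r x) = [Op Add 49 (x + 50) 0, Load (r + 50) 49]"
| "sim_instr b n (Store r x) = [Op Add 49 (x + 50) 0, Store (r + 50) 49]"
| "sim_instr b n (JumpZero r l) = [Const 49 0, JumpZero (r + 50) (b + 2 * min l n)]"

definition simcode :: "program \<Rightarrow> code" where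
  "simcode P = (\<lambda>b. concat (map (sim_instr b (length P)) P))"

text \<open>Padding with a harmless write to register 49 gives all translations the same length, so
  a jump target \<open>l\<close> is relocated to \<open>b + 2 * l\<close>. The minimum in the
  translation sends every halting jump to the end of the code.\<close>

lemma length_sim_instr: "length (sim_instr b n i) = 2"
  by (cases i) auto

lemma length_simcode: "length (simcode P b) = 2 * length P"
proof -
  have "length (concat (map (sim_instr b n) Q)) = 2 * length Q" for n Q
    by (induction Q) (auto simp: length_sim_instr)
  then show ?thesis by (simp add: simcode_def)
qed

lemma placed_simcode:
  assumes "placed P' b (simcode P b)" "i < length P"
  shows "placed P' (b + 2 * i) (sim_instr b (length P) (P ! i))"
proof -
  let ?f = "sim_instr b (length P)"
  have len: "length (concat (map ?f Q)) = 2 * length Q" for Q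
    by (induction Q) (auto simp: length_sim_instr)
  have "P = take i P @ P ! i # drop (Suc i) P" using assms(2) by (rule id_take_nth_drop)
  then have "simcode P b = concat (map ?f (take i P @ P ! i # drop (Suc i) P))"
    by (simp add: simcode_def)
  then have "simcode P b = concat (map ?f (take i P)) @ ?f (P ! i) @ concat (map ?f (drop (Suc i) P))"
    by simp
  then show ?thesis using assms by (simp add: placed_append len min_absorb2)
qed

text \<open>A program may halt at any address beyond its range, but the simulation must continue at
  one place; hence the minimum. Registers 1 to 49 and the cells below \<open>B\<close> are left
  unconstrained.\<close>

definition sim :: "program \<Rightarrow> nat \<Rightarrow> nat \<Rightarrow> state \<Rightarrow> state \<Rightarrow> bool" where
  "sim P b B s s' \<longleftrightarrow> pc s' = b + 2 * min (pc s) (length P) \<and> reg s' 0 = B \<and>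
     (\<forall>r. reg s' (r + 50) = reg s r) \<and> (\<forall>a. mem s' (B + a) = mem s a)"

text \<open>Simulated addresses are below \<open>2 ^ w\<close> and \<open>B\<close> is added to
  them, which is what the condition on \<open>w'\<close> pays for. All other new words also occur in
  the next simulated state, so they fit because that state does.\<close>

lemma sim_step:
  assumes pl: "placed P' b (simcode P b)" and sim: "sim P b B s s'" and f': "fits w' s'"
    and nh: "\<not> halted P s" and fs: "fits w s" and f: "fits w (step P s)"
    and w: "2 ^ w + B \<le> 2 ^ w'"
  shows "\<exists>s''. reach P' w' 2 s' s'' \<and> sim P b B (step P s) s''"
proof -
  let ?i = "pc s" let ?is = "sim_instr b (length P) (P ! ?i)"
  have i: "?i < length P" using nh by (simp add: halted_def)
  have st: "step P s = exec_instr (P ! ?i) s" using nh by (simp add: step_def)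
  have pc: "pc s' = b + 2 * ?i" using sim i by (simp add: sim_def)
  have "?is = [?is ! 0, ?is ! 1]" by (cases "P ! ?i") auto
  then have "placed P' (b + 2 * ?i) [?is ! 0, ?is ! 1]" using placed_simcode[OF pl i] by simp
  then have P': "b + 2 * ?i < length P'" "P' ! (b + 2 * ?i) = ?is ! 0"
    "Suc (b + 2 * ?i) < length P'" "P' ! Suc (b + 2 * ?i) = ?is ! 1"
    by (simp_all add: placed_Cons)
  let ?s1 = "exec_instr (?is ! 0) s'" let ?s2 = "exec_instr (?is ! 1) ?s1"
  have pc1: "pc ?s1 = Suc (b + 2 * ?i)" using pc by (cases "P ! ?i") auto
  have st1: "step P' s' = ?s1" using P' pc by (simp add: step_def halted_def)
  have st2: "step P' ?s1 = ?s2" using P' pc1 by (simp add: step_def halted_def)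
  have R: "reg s' 0 = B" "\<And>r. reg s' (r + 50) = reg s r" "\<And>a. mem s' (B + a) = mem s a"
    using sim by (auto simp: sim_def)
  have lt: "x < 2 ^ w \<Longrightarrow> x < 2 ^ w'" "x < 2 ^ w \<Longrightarrow> x + B < 2 ^ w'" for x
    using w by linarith+
  have fs1: "reg s r < 2 ^ w" "mem s a < 2 ^ w" "reg s' r < 2 ^ w'" "mem s' a < 2 ^ w'"
      "reg (step P s) r < 2 ^ w" for r a
    using fs f' f by (auto simp: fits_def)
  have "fits w' ?s1"
  proof (cases "P ! ?i")
    case (Op f r x y)
    have "apply_binop f (reg s x) (reg s y) < 2 ^ w" using fs1(5)[of r] st Op by simp
    then show ?thesis using Op lt R fs1 by (auto simp: fits_def)
  next
    case (Const r x)
    have "x < 2 ^ w" using fs1(5)[of r] st Const by simp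
    then show ?thesis using Const lt fs1 by (auto simp: fits_def)
  qed (use lt R fs1 in \<open>auto simp: fits_def\<close>)
  moreover from this have "fits w' ?s2"
    using fs1 by (cases "P ! ?i") (auto simp: fits_def)
  ultimately have "reach P' w' 1 s' ?s1" "reach P' w' 1 ?s1 ?s2"
    using reach_step[of w' s' P'] reach_step[of w' ?s1 P'] f' st1 st2 by simp_all
  from reach_trans[OF this] have "reach P' w' 2 s' ?s2" by (simp add: numeral_2_eq_2)
  moreover have "sim P b B (step P s) ?s2"
    unfolding st using pc R i
    by (cases "P ! ?i") (auto simp: sim_def add.commute)
  ultimately show ?thesis by blast
qed

lemma sim_reach:
  assumes pl: "placed P' b (simcode P b)" and sim: "sim P b B s s'" and f': "fits w' s'"
    and r: "reach P w t s s1" and h: "halted P s1" and w: "2 ^ w + B \<le> 2 ^ w'"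
  shows "\<exists>t'\<le>2 * t. \<exists>s1'. reach P' w' t' s' s1' \<and> sim P b B s1 s1'"
  using sim f' r
proof (induction t arbitrary: s s')
  case 0
  then show ?case by (auto simp: reach_def)
next
  case (Suc t)
  show ?case
  proof (cases "halted P s")
    case True
    have "(step P ^^ n) s = s" for n by (induction n) (auto simp: step_def True)
    then have "s1 = s" using Suc.prems(3) by (simp only: reach_def)
    then show ?thesis using Suc.prems reach_refl[of w' s' P'] by (intro exI[of _ 0]) auto
  next
    case False
    have fits: "fits w ((step P ^^ j) s)" if "j \<le> Suc t" for j
      using Suc.prems(3) that by (simp add: reach_def)
    have sw: "(step P ^^ j) (step P s) = (step P ^^ Suc j) s" for j
      by (simp add: funpow_swap1)
    have r': "reach P w t (step P s) s1"
      unfolding reach_def sw using Suc.prems(3) fits unfolding reach_def by blast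
    obtain s'' where s'': "reach P' w' 2 s' s''" "sim P b B (step P s) s''"
      using sim_step[OF pl Suc.prems(1,2) False _ _ w] fits[of 0] fits[of 1] by auto
    obtain t' s1' where "t' \<le> 2 * t" "reach P' w' t' s'' s1'" "sim P b B s1 s1'"
      using Suc.IH[OF s''(2) reach_fits[OF s''(1)] r'] by blast
    then show ?thesis using reach_trans[OF s''(1)]
      by (intro exI[of _ "2 + t'"]) auto
  qed
qed

text \<open>\<open>pre\<close> has to present \<open>ys\<close> as an initial state of the simulated
  machine, \<open>post\<close> turns its output into the answer. The factor 2 is the length of a
  translated instruction.\<close>

lemma runs_simulation:
  assumes pre: "wp w' pre tp (\<lambda>g m. g 0 = B \<and> g 50 = length ys \<and> (\<forall>r>50. g r = 0) \<and>
      (\<forall>a. m (B + a) = (if a < length ys then ys ! a else 0)))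
      (reg (init_state xs)) (mem (init_state xs))"
    and f: "fits w' (init_state xs)"
    and run: "runs P w ys t Q"
    and w: "2 ^ w + B \<le> 2 ^ w'"
    and post: "\<And>s g m. Q s \<Longrightarrow> fits w s \<Longrightarrow> (\<And>r. g (r + 50) = reg s r) \<Longrightarrow>
      wp w' post tq (\<lambda>g m. Q' (g 0)) g m"
  shows "runs ((pre ;; simcode P ;; post) 0) w' xs (tp + 2 * t + tq) (\<lambda>s. Q' (reg s 0))"
proof -
  let ?P = "(pre ;; simcode P ;; post) 0"
  let ?b = "length (pre 0)" let ?c = "?b + 2 * length P"
  have P: "?P = pre 0 @ simcode P ?b @ post ?c"
    by (simp add: seq_def length_simcode)
  have "placed ?P 0 ?P" unfolding placed_def by (metis append_Nil append_Nil2 list.size(3))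
  then have pl: "placed ?P 0 (pre 0)" "placed ?P ?b (simcode P ?b)" "placed ?P ?c (post ?c)"
    unfolding P by (simp_all add: placed_append length_simcode)
  obtain g0 m0 where ini: "init_state xs = \<lparr>pc = 0, reg = g0, mem = m0\<rparr>"
    by (simp add: init_state_def)
  obtain t1 g1 m1 where 1: "t1 \<le> tp" "reach ?P w' t1 (init_state xs) \<lparr>pc = ?b, reg = g1, mem = m1\<rparr>"
    "g1 0 = B" "g1 50 = length ys" "\<forall>r>50. g1 r = 0"
    "\<forall>a. m1 (B + a) = (if a < length ys then ys ! a else 0)"
    using pre[unfolded wp_def, rule_format, of ?P 0] pl(1) f unfolding ini by auto
  have sim: "sim P ?b B (init_state ys) \<lparr>pc = ?b, reg = g1, mem = m1\<rparr>"
    unfolding sim_def init_state_def using 1 by auto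
  obtain i s where 2: "i \<le> t" "reach P w i (init_state ys) s" "halted P s" "Q s"
    using run unfolding runs_iff_reach by blast
  obtain t2 s2 where 3: "t2 \<le> 2 * i"
    "reach ?P w' t2 \<lparr>pc = ?b, reg = g1, mem = m1\<rparr> s2" "sim P ?b B s s2"
    using sim_reach[OF pl(2) sim reach_fits[OF 1(2)] 2(2,3) w] by blast
  obtain g2 m2 where s2: "s2 = \<lparr>pc = ?c, reg = g2, mem = m2\<rparr>"
    using 3(3) 2(3) by (cases s2) (auto simp: sim_def halted_def)
  have "wp w' post tq (\<lambda>g m. Q' (g 0)) g2 m2"
    by (rule post[OF 2(4) reach_fits[OF 2(2)]]) (use 3(3) s2 in \<open>simp add: sim_def\<close>)
  then obtain t3 g3 m3 where 4: "t3 \<le> tq"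
    "reach ?P w' t3 s2 \<lparr>pc = ?c + length (post ?c), reg = g3, mem = m3\<rparr>" "Q' (g3 0)"
    using pl(3) reach_fits[OF 3(2)] unfolding wp_def s2 by blast
  have "reach ?P w' (t1 + t2 + t3) (init_state xs) \<lparr>pc = ?c + length (post ?c), reg = g3, mem = m3\<rparr>"
    using reach_trans[OF reach_trans[OF 1(2) 3(2)] 4(2)] .
  moreover have "t1 + t2 + t3 \<le> tp + 2 * t + tq" using 1(1) 2(1) 3(1) 4(1) by linarith
  moreover have "length ?P = ?c + length (post ?c)" unfolding P by (simp add: length_simcode)
  ultimately show ?thesis unfolding runs_iff_reach using 4(3)
    by (intro exI[of _ "t1 + t2 + t3"]) (auto simp: halted_def)
qed

section \<open>Subdivided graphs\<close>

lemma gdist_le: "((\<lambda>x y. {x, y} \<in> E) ^^ i) u v \<Longrightarrow> gdist E u v \<le> enat i"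
  unfolding gdist_def by (rule INF_lower) simp

lemma gdist_less:
  assumes "gdist E u v < enat d"
  obtains i where "i < d" "((\<lambda>x y. {x, y} \<in> E) ^^ i) u v"
  using assms unfolding gdist_def INF_less_iff by auto

text \<open>The vertex at position \<open>t\<close> of the path for edge \<open>e\<close>. Each edge
  owns \<open>l - 1\<close> consecutive inner vertices, so division by \<open>l - 1\<close> recovers
  edge and position.\<close>

definition sub_pos :: "nat \<Rightarrow> nat \<Rightarrow> (nat \<times> nat) list \<Rightarrow> nat \<Rightarrow> nat \<Rightarrow> nat" where
  "sub_pos l n es e t = (if t = 0 then fst (es ! e) else if t = l then snd (es ! e)
     else n + (l - 1) * e + (t - 1))"

text \<open>Every edge is replaced by a path of length \<open>l\<close>; the inner vertices are numbered from \<open>n\<close>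
  on.\<close>

definition subdivide :: "nat \<Rightarrow> nat \<Rightarrow> (nat \<times> nat) list \<Rightarrow> (nat \<times> nat) list" where
  "subdivide l n es = concat (map (\<lambda>e. map (\<lambda>t. (sub_pos l n es e t, sub_pos l n es e (Suc t)))
     [0..<l]) [0..<length es])"

text \<open>Inner vertices are numbered in the order of the edges, so a new edge leaves earlier
  paths alone. This allows the program to write the paths one after another.\<close>

lemma subdivide_append:
  "subdivide l n (es @ [x]) = subdivide l n es @
     map (\<lambda>t. (sub_pos l n (es @ [x]) (length es) t, sub_pos l n (es @ [x]) (length es) (Suc t))) [0..<l]"
proof -
  have "sub_pos l n (es @ [x]) e t = sub_pos l n es e t" if "e < length es" for e t
    using that by (simp add: sub_pos_def nth_append)
  then have *: "map (\<lambda>e. map (\<lambda>t. (sub_pos l n (es @ [x]) e t, sub_pos l n (es @ [x]) e (Suc t))) [0..<l])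
      [0..<length es] =
    map (\<lambda>e. map (\<lambda>t. (sub_pos l n es e t, sub_pos l n es e (Suc t))) [0..<l]) [0..<length es]"
    by (intro map_cong refl) simp
  show ?thesis by (simp add: subdivide_def * del: map_eq_conv)
qed

lemma length_subdivide: "length (subdivide l n es) = l * length es"
  by (simp add: subdivide_def length_concat comp_def sum_list_triv)

text \<open>Orienting all edges upwards excludes loops and makes a distinct list of pairs a list of
  distinct undirected edges.\<close>

locale subdivision =
  fixes l n :: nat and es :: "(nat \<times> nat) list"
  assumes l: "1 \<le> l" and es: "\<And>u v. (u, v) \<in> set es \<Longrightarrow> u < v \<and> v < n" and dist: "distinct es"
begin

abbreviation "pos \<equiv> sub_pos l n es"
abbreviation "E \<equiv> edge_set (subdivide l n es)"

lemma ends: "e < length es \<Longrightarrow> fst (es ! e) < snd (es ! e) \<and> snd (es ! e) < n"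
  using es[of "fst (es ! e)" "snd (es ! e)"] by simp

lemma pos_0: "pos e 0 = fst (es ! e)" and pos_l: "pos e l = snd (es ! e)"
  using l by (auto simp: sub_pos_def)

lemma edge_iff:
  "{x, y} \<in> E \<longleftrightarrow> (\<exists>e<length es. \<exists>t<l. {x, y} = {pos e t, pos e (Suc t)})"
proof
  assume "{x, y} \<in> E"
  then show "\<exists>e<length es. \<exists>t<l. {x, y} = {pos e t, pos e (Suc t)}"
    unfolding edge_set_def subdivide_def by fastforce
next
  assume "\<exists>e<length es. \<exists>t<l. {x, y} = {pos e t, pos e (Suc t)}"
  then obtain e t where "e < length es" "t < l" and eq: "{x, y} = {pos e t, pos e (Suc t)}" by blast
  then have "(pos e t, pos e (Suc t)) \<in> set (subdivide l n es)"
    unfolding subdivide_def by fastforce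
  then show "{x, y} \<in> E" unfolding edge_set_def eq by (rule rev_image_eqI) simp
qed

lemma inner_decode:
  assumes "0 < t" "t < l"
  shows "((l - 1) * e + (t - 1)) div (l - 1) = e" "((l - 1) * e + (t - 1)) mod (l - 1) = t - 1"
proof -
  have "t - 1 < l - 1" using assms by simp
  then show "((l - 1) * e + (t - 1)) div (l - 1) = e" "((l - 1) * e + (t - 1)) mod (l - 1) = t - 1"
    by (simp_all del: One_nat_def)
qed

lemma pos_less:
  assumes "e < length es" "t \<le> l"
  shows "pos e t < n + (l - 1) * length es"
proof -
  have "(l - 1) * e + (t - 1) < (l - 1) * length es" if "0 < t" "t < l"
  proof -
    have "(l - 1) * Suc e \<le> (l - 1) * length es" using assms(1) by (intro mult_le_mono2) simp
    then show ?thesis using that by simp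
  qed
  then show ?thesis using ends[OF assms(1)] assms(2) by (auto simp: sub_pos_def)
qed

lemma pos_surj:
  assumes "n \<le> x" "x < n + (l - 1) * length es"
  obtains e t where "e < length es" "0 < t" "t < l" "x = pos e t"
proof -
  let ?e = "(x - n) div (l - 1)" let ?t = "(x - n) mod (l - 1) + 1"
  have l1: "0 < l - 1" using assms by (cases "l - 1") auto
  have "(x - n) < length es * (l - 1)" using assms by (simp add: mult.commute)
  then have "?e < length es" by (simp add: less_mult_imp_div_less)
  moreover have "?t < l" using mod_less_divisor[OF l1, of "x - n"] by linarith
  moreover from this have "x = pos ?e ?t" using assms by (simp add: sub_pos_def)
  ultimately show thesis using that[of ?e ?t] by simp
qed

lemma pos_inner_eq:
  assumes "0 < t" "t < l" "0 < t'" "t' < l" "pos e t = pos e' t'"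
  shows "e = e' \<and> t = t'"
proof -
  have eq: "(l - 1) * e + (t - 1) = (l - 1) * e' + (t' - 1)"
    using assms by (simp add: sub_pos_def)
  then have "e = e'" using inner_decode(1)[of t e] inner_decode(1)[of t' e'] assms by metis
  then show ?thesis using eq assms by simp
qed

text \<open>For \<open>l \<ge> 2\<close> the larger end of a new edge is an inner vertex, as these
  are numbered above the original ones, and an inner vertex determines its path. For
  \<open>l = 1\<close> the claim is the distinctness of the original edges.\<close>

lemma path_edge_inj:
  assumes e: "e < length es" "e' < length es" and t: "t < l" "t' < l"
    and eq: "{pos e t, pos e (Suc t)} = {pos e' t', pos e' (Suc t')}"
  shows "e = e' \<and> t = t'"
proof (cases "l = 1")
  case True
  then have "{fst (es ! e), snd (es ! e)} = {fst (es ! e'), snd (es ! e')}"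
    using eq t by (simp add: sub_pos_def)
  then have "es ! e = es ! e'" using ends[OF e(1)] ends[OF e(2)]
    by (auto simp: doubleton_eq_iff prod_eq_iff)
  then show ?thesis using e t dist True by (simp add: nth_eq_iff_index_eq)
next
  case False
  then have l2: "2 \<le> l" using l by simp
  define top where "top t = (if Suc t < l then Suc t else t)" for t
  have top: "0 < top t" "top t < l" if "t < l" for t using that l2 by (auto simp: top_def)
  have mx: "max (pos e t) (pos e (Suc t)) = pos e (top t)" if "e < length es" "t < l" for e t
  proof -
    have "fst (es ! e) < n" "snd (es ! e) < n" using ends[OF that(1)] by auto
    then show ?thesis using that(2) l2 by (auto simp: top_def sub_pos_def max_def)
  qed
  have "max (pos e t) (pos e (Suc t)) = max (pos e' t') (pos e' (Suc t'))"
    using eq by (auto simp: doubleton_eq_iff max.commute)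
  then have "pos e (top t) = pos e' (top t')" using mx e t by simp
  then have ee: "e = e'" and tt: "top t = top t'"
    using pos_inner_eq[OF top[OF t(1)] top[OF t(2)]] by auto
  have "t = t'"
  proof (rule ccontr)
    assume ne: "t \<noteq> t'"
    \<comment> \<open>The last two edges of a path have the same larger end, at position
      \<open>l - 1\<close>. Their other ends differ; for \<open>l = 2\<close> these are the two ends
      of the original edge.\<close>
    have last: False if "{pos e (l - 2), pos e (l - 1)} = {pos e (l - 1), pos e l}"
    proof -
      have "pos e (l - 2) = pos e l" using that by (auto simp: doubleton_eq_iff)
      then show False using ends[OF e(1)] l2 by (auto simp: sub_pos_def split: if_splits)
    qed
    have "(t = l - 2 \<and> t' = l - 1) \<or> (t' = l - 2 \<and> t = l - 1)"
      using tt ne t by (auto simp: top_def split: if_splits)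
    moreover have "Suc (l - 2) = l - 1" "Suc (l - 1) = l" using l2 by auto
    ultimately show False using last eq unfolding ee[symmetric] by metis
  qed
  then show ?thesis using ee by simp
qed

text \<open>Subdividing adds \<open>(l - 1) * length es\<close> to the number of vertices and to the
  number of edges alike, so the required ratio is inherited.\<close>

lemma input_graph_subdivide:
  assumes "n \<le> length es + 1"
  shows "input_graph (n + (l - 1) * length es) (subdivide l n es)"
  unfolding input_graph_def
proof (intro conjI)
  have "pos e t \<noteq> pos e (Suc t)" if "e < length es" "t < l" for e t
  proof -
    have "fst (es ! e) < snd (es ! e)" "snd (es ! e) < n" using ends[OF that(1)] by auto
    then show ?thesis using that(2) by (auto simp: sub_pos_def)
  qed
  then show "\<forall>(u, v)\<in>set (subdivide l n es). u < n + (l - 1) * length es \<and>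
      v < n + (l - 1) * length es \<and> u \<noteq> v"
    using pos_less by (auto simp: subdivide_def)
  have "map (\<lambda>(u, v). {u, v}) (subdivide l n es) =
      map (\<lambda>(e, t). {pos e t, pos e (Suc t)}) (List.product [0..<length es] [0..<l])"
    by (simp add: subdivide_def product_concat_map map_concat comp_def)
  moreover have "inj_on (\<lambda>(e, t). {pos e t, pos e (Suc t)}) (set (List.product [0..<length es] [0..<l]))"
    using path_edge_inj by (auto simp: inj_on_def)
  ultimately show "distinct (map (\<lambda>(u, v). {u, v}) (subdivide l n es))"
    by (simp add: distinct_map distinct_product)
  have "l * length es = (l - 1) * length es + length es" using l by (cases l) auto
  then show "n + (l - 1) * length es \<le> length (subdivide l n es) + 1"
    using assms by (simp add: length_subdivide)
qed

section \<open>Upper bounds on the k-radius of a subdivision\<close>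

abbreviation near :: "nat \<Rightarrow> nat \<Rightarrow> nat \<Rightarrow> bool" where
  "near d x y \<equiv> \<exists>i\<le>d. ((\<lambda>x y. {x, y} \<in> E) ^^ i) x y"

lemma near_sym:
  assumes "near d x y"
  shows "near d y x"
proof -
  have "((\<lambda>x y. {x, y} \<in> E) ^^ i) y x" if "((\<lambda>x y. {x, y} \<in> E) ^^ i) x y" for i
    using that
  proof (induction i arbitrary: y)
    case (Suc i)
    then obtain z where "((\<lambda>x y. {x, y} \<in> E) ^^ i) x z" "{z, y} \<in> E" by auto
    then have "{y, z} \<in> E" "((\<lambda>x y. {x, y} \<in> E) ^^ i) z x"
      using Suc.IH by (simp_all add: insert_commute)
    then show ?case by (rule relpowp_Suc_I2)
  qed simp
  then show ?thesis using assms by blast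
qed

lemma near_trans:
  assumes "near a x y" "near b y z"
  shows "near (a + b) x z"
proof -
  obtain i j where "i \<le> a" "((\<lambda>x y. {x, y} \<in> E) ^^ i) x y" "j \<le> b" "((\<lambda>x y. {x, y} \<in> E) ^^ j) y z"
    using assms by blast
  then show ?thesis by (intro exI[of _ "i + j"]) (auto simp: relpowp_add)
qed

lemma near_gdist: "near d x y \<Longrightarrow> gdist E x y \<le> enat d"
proof -
  assume "near d x y"
  then obtain i where "i \<le> d" "((\<lambda>x y. {x, y} \<in> E) ^^ i) x y" by blast
  then show ?thesis using gdist_le[of i E x y] by (meson enat_ord_simps(1) order_trans)
qed

lemma near_path:
  assumes "e < length es" "t \<le> t'" "t' \<le> l"
  shows "near l (pos e t) (pos e t')"
proof -
  have "((\<lambda>x y. {x, y} \<in> E) ^^ (t' - t)) (pos e t) (pos e t')"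
    using assms(2,3)
  proof (induction "t' - t" arbitrary: t')
    case (Suc d)
    then obtain u where u: "t' = Suc u" by (cases t') auto
    then have "((\<lambda>x y. {x, y} \<in> E) ^^ (u - t)) (pos e t) (pos e u)" "Suc d = Suc (u - t)"
      using Suc.hyps(1)[of u] Suc.hyps(2) Suc.prems by auto
    moreover have "{pos e u, pos e (Suc u)} \<in> E"
      unfolding edge_iff
      by (rule exI[of _ e], rule conjI[OF assms(1)], rule exI[of _ u]) (use u Suc.prems in auto)
    moreover have "Suc u - t = Suc (u - t)" using Suc.hyps(2) u by linarith
    ultimately show ?case unfolding u by (simp only: relpowp_Suc_I)
  qed simp
  then show ?thesis using assms by (intro exI[of _ "t' - t"]) auto
qed

lemma near_end:
  assumes "e < length es" "t \<le> l" "z \<in> {fst (es ! e), snd (es ! e)}"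
  shows "near l (pos e t) z"
  using assms near_path[OF assms(1), of 0 t] near_path[OF assms(1), of t l] near_sym[of l "pos e 0"]
  by (auto simp: pos_0 pos_l)

text \<open>A point on a path is within \<open>l\<close> of both ends of the original edge, and one
  of these is joined to a centre by another path of length \<open>l\<close>. The assumption
  \<open>cover\<close> puts the original vertices on paths too.\<close>

lemma k_radius_subdivide_le:
  assumes C: "C \<subseteq> {..<n}" "card C = k"
    and cover: "\<And>x. x < n \<Longrightarrow> \<exists>u v. (u, v) \<in> set es \<and> x \<in> {u, v}"
    and near: "\<And>u v. (u, v) \<in> set es \<Longrightarrow> \<exists>z\<in>{u, v}. \<exists>c\<in>C. (c, z) \<in> set es"
  shows "k_radius k {..<n + (l - 1) * length es} E \<le> enat (2 * l)"
proof -
  have "\<exists>c\<in>C. gdist E x c \<le> enat (2 * l)" if "x < n + (l - 1) * length es" for x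
  proof -
    obtain e t where e: "e < length es" "t \<le> l" "x = pos e t"
    proof (cases "x < n")
      case True
      then obtain u v where "(u, v) \<in> set es" "x \<in> {u, v}" using cover by blast
      then obtain e where "e < length es" "es ! e = (u, v)" by (auto simp: in_set_conv_nth)
      then have "x = pos e 0 \<or> x = pos e l" using \<open>x \<in> {u, v}\<close> by (auto simp: pos_0 pos_l)
      then show thesis using that \<open>e < length es\<close> by blast
    next
      case False
      then show thesis using that pos_surj[of x] \<open>x < _\<close> by (metis less_imp_le not_less)
    qed
    then obtain z c where z: "z \<in> {fst (es ! e), snd (es ! e)}" "c \<in> C" "(c, z) \<in> set es"
      using near[of "fst (es ! e)" "snd (es ! e)"] by auto
    then obtain e' where e': "e' < length es" "es ! e' = (c, z)" by (auto simp: in_set_conv_nth)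
    have "near l z c" using near_end[OF e'(1), of l c] e'(2) by (simp add: pos_l)
    with near_end[OF e(1,2) z(1)] have "near (l + l) x c" unfolding e(3) by (rule near_trans)
    then show ?thesis using near_gdist[of "2 * l"] z(2) by (auto simp: mult_2)
  qed
  then have "(SUP v\<in>{..<n + (l - 1) * length es}. INF c\<in>C. gdist E v c) \<le> enat (2 * l)"
    by (intro SUP_least) (meson INF_lower2 lessThan_iff)
  moreover have "C \<subseteq> {..<n + (l - 1) * length es}" using C(1) by auto
  ultimately show ?thesis unfolding k_radius_def using C(2) by (intro INF_lower2[of C]) auto
qed

section \<open>Lower bounds on distances by interpolated potentials\<close>

text \<open>Linear interpolation of a function on the original vertices along the paths: if it varies by
  at most 1 along every original edge, then so does the interpolation along the new ones.\<close>

definition interp :: "(nat \<Rightarrow> int) \<Rightarrow> nat \<Rightarrow> int" where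
  "interp f x = (if x < n then int l * f x else
     let e = (x - n) div (l - 1); t = (x - n) mod (l - 1) + 1
     in (int l - int t) * f (fst (es ! e)) + int t * f (snd (es ! e)))"

lemma interp_pos:
  assumes "e < length es" "t \<le> l"
  shows "interp f (pos e t) = (int l - int t) * f (fst (es ! e)) + int t * f (snd (es ! e))"
proof -
  consider "t = 0" | "t = l" | "0 < t" "t < l" using assms(2) by linarith
  then show ?thesis
  proof cases
    case 3
    then have "pos e t = n + ((l - 1) * e + (t - 1))" by (simp add: sub_pos_def)
    moreover have "n + ((l - 1) * e + (t - 1)) - n = (l - 1) * e + (t - 1)"
      "\<not> n + ((l - 1) * e + (t - 1)) < n" "t - 1 + 1 = t"
      using 3 by linarith+
    ultimately show ?thesis using inner_decode[OF 3, of e] unfolding interp_def Let_def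
      by (simp only: if_False)
  qed (use ends[OF assms(1)] in \<open>auto simp: pos_0 pos_l interp_def\<close>)
qed

text \<open>The factor \<open>l\<close> in \<open>interp\<close> keeps the values integral: each of
  the \<open>l\<close> steps along a path changes them by exactly \<open>f v - f u\<close>.\<close>

lemma interp_gdist:
  assumes lip: "\<And>u v. (u, v) \<in> set es \<Longrightarrow> \<bar>f u - f v\<bar> \<le> 1" and d: "gdist E x y < enat d"
  shows "\<bar>interp f x - interp f y\<bar> < int d"
proof -
  have edge: "\<bar>interp f x - interp f y\<bar> \<le> 1" if "{x, y} \<in> E" for x y
  proof -
    obtain e t where e: "e < length es" "t < l" "{x, y} = {pos e t, pos e (Suc t)}"
      using \<open>{x, y} \<in> E\<close> unfolding edge_iff by blast
    have "interp f (pos e (Suc t)) - interp f (pos e t) = f (snd (es ! e)) - f (fst (es ! e))"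
      using interp_pos[OF e(1), of t f] interp_pos[OF e(1), of "Suc t" f] e(2)
      by (simp add: algebra_simps)
    then show ?thesis using lip[of "fst (es ! e)" "snd (es ! e)"] e
      by (auto simp: doubleton_eq_iff)
  qed
  have walk: "\<bar>interp f x - interp f y\<bar> \<le> int i" if "((\<lambda>x y. {x, y} \<in> E) ^^ i) x y" for i
    using that
  proof (induction i arbitrary: y)
    case (Suc i)
    then obtain z where "((\<lambda>x y. {x, y} \<in> E) ^^ i) x z" "{z, y} \<in> E" by auto
    then show ?case using Suc.IH[of z] edge[of z y] by linarith
  qed simp
  obtain i where "i < d" "((\<lambda>x y. {x, y} \<in> E) ^^ i) x y" using d by (rule gdist_less)
  then show ?thesis using walk[of i] by linarith
qed

text \<open>The original vertices whose values enter \<open>interp f x\<close>. A centre inside a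
  path is not moved to one of the ends but may act for either of them, depending on the potential
  considered.\<close>

definition support :: "nat \<Rightarrow> nat set" where
  "support x = (if x < n then {x} else
     {fst (es ! ((x - n) div (l - 1))), snd (es ! ((x - n) div (l - 1)))})"

lemma support_cases:
  assumes "x < n + (l - 1) * length es"
  shows "support x = {x} \<or> (\<exists>u v. (u, v) \<in> set es \<and> support x = {u, v})"
proof (cases "x < n")
  case False
  have "x - n < length es * (l - 1)" using assms False by (simp add: mult.commute)
  then have "(x - n) div (l - 1) < length es" by (simp add: less_mult_imp_div_less)
  then show ?thesis using False by (simp add: support_def) (metis nth_mem prod.collapse)
qed (simp add: support_def)

lemma interp_less_support:
  assumes "x < n + (l - 1) * length es" "interp f x < int l * d"
  shows "\<exists>z\<in>support x. f z < d"
proof (rule ccontr)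
  assume neg: "\<not> ?thesis"
  have "int l * d \<le> interp f x"
  proof (cases "x < n")
    case True
    then show ?thesis using neg by (simp add: interp_def support_def not_less mult_left_mono)
  next
    case False
    let ?e = "(x - n) div (l - 1)" let ?t = "(x - n) mod (l - 1) + 1"
    have l1: "0 < l - 1" using assms False by (cases "l - 1") auto
    have t: "?t < l" using mod_less_divisor[OF l1, of "x - n"] by linarith
    have "d \<le> f (fst (es ! ?e))" "d \<le> f (snd (es ! ?e))"
      using neg False by (auto simp: support_def not_less)
    then have "(int l - int ?t) * d + int ?t * d \<le>
        (int l - int ?t) * f (fst (es ! ?e)) + int ?t * f (snd (es ! ?e))"
      using t by (intro add_mono mult_left_mono) linarith+
    then show ?thesis using False by (simp add: interp_def Let_def algebra_simps)
  qed
  then show False using assms(2) by simp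
qed

text \<open>The interpolated potential is 0 at \<open>p\<close> and grows by at most 1 per step, so
  it is below \<open>3 * l\<close> at \<open>x\<close>. As it is \<open>l\<close> times a weighted
  mean of the values on the support, one of these is below 3.\<close>

lemma gdist_less_support:
  fixes f :: "nat \<Rightarrow> int"
  assumes "\<And>u v. (u, v) \<in> set es \<Longrightarrow> \<bar>f u - f v\<bar> \<le> 1"
    and "x < n + (l - 1) * length es" "p < n" "f p = 0" "gdist E p x < enat (3 * l)"
  shows "\<exists>z\<in>support x. f z < 3"
proof (rule interp_less_support[OF assms(2)])
  have "\<bar>interp f p - interp f x\<bar> < int (3 * l)" by (rule interp_gdist[OF _ assms(5)]) (rule assms(1))
  moreover have "interp f p = 0" using assms(3,4) by (simp add: interp_def)
  ultimately show "interp f x < int l * 3" by linarith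
qed

end

section \<open>The graph of a CNF formula\<close>

lemma distinct_concat_map:
  assumes "distinct xs" "\<And>x. x \<in> set xs \<Longrightarrow> distinct (f x)"
    "\<And>x y. x \<in> set xs \<Longrightarrow> y \<in> set xs \<Longrightarrow> x \<noteq> y \<Longrightarrow> set (f x) \<inter> set (f y) = {}"
  shows "distinct (concat (map f xs))"
  using assms
proof (induction xs)
  case (Cons x xs)
  have "set (f x) \<inter> set (f y) = {}" if "y \<in> set xs" for y
    using Cons.prems(1,3) that by (metis distinct.simps(2) list.set_intros)
  moreover have "distinct (concat (map f xs))"
    using Cons.prems by (intro Cons.IH) auto
  ultimately show ?case using Cons.prems(2) by auto
qed simp

lemma length_concat_map_le:
  "(\<And>x. length (f x) \<le> b) \<Longrightarrow> length (concat (map f xs)) \<le> length xs * b"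
  by (induction xs) (auto intro: add_mono)

lemma length_concat_map_ge:
  "(\<And>x. a \<le> length (f x)) \<Longrightarrow> length xs * a \<le> length (concat (map f xs))"
  by (induction xs) (auto intro: add_mono)

text \<open>The variables are split into \<open>k\<close> blocks of \<open>s\<close>. The number \<open>y\<close> encodes an assignment to the
  block \<open>y div 2 ^ s\<close>, given by the bits of \<open>y mod 2 ^ s\<close>.\<close>

definition lit_sat :: "nat \<Rightarrow> nat \<Rightarrow> nat \<times> bool \<Rightarrow> bool" where
  "lit_sat s y = (\<lambda>(v, b). v div s = y div 2 ^ s \<and> bit (y mod 2 ^ s) (v mod s) = b)"

definition partial_sat :: "nat \<Rightarrow> nat \<Rightarrow> (nat \<times> bool) list \<Rightarrow> bool" where
  "partial_sat s y C \<longleftrightarrow> (\<exists>x\<in>set C. lit_sat s y x)"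

text \<open>The vertices are numbered in groups: assignments, hubs, pins, clause vertices, clause
  pins, dummies. In this order every edge of the graph points upwards.\<close>

definition clause_edges :: "nat \<Rightarrow> nat \<Rightarrow> cnf \<Rightarrow> nat \<Rightarrow> nat \<Rightarrow> (nat \<times> nat) list" where
  "clause_edges k s F y j = (y, k * 2 ^ s + 2 * k + 2 * length F + j) #
     (if partial_sat s y (F ! j) then [(y, k * 2 ^ s + 2 * k + j)] else [])"

definition vertex_edges :: "nat \<Rightarrow> nat \<Rightarrow> cnf \<Rightarrow> nat \<Rightarrow> (nat \<times> nat) list" where
  "vertex_edges k s F y = [(y, k * 2 ^ s + y div 2 ^ s), (y, k * 2 ^ s + 2 * k + 3 * length F)] @
     concat (map (clause_edges k s F y) [0..<length F])"

definition cnf_edges :: "nat \<Rightarrow> nat \<Rightarrow> cnf \<Rightarrow> (nat \<times> nat) list" where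
  "cnf_edges k s F =
     map (\<lambda>i. (k * 2 ^ s + i, k * 2 ^ s + k + i)) [0..<k] @
     map (\<lambda>j. (k * 2 ^ s + 2 * k + j, k * 2 ^ s + 2 * k + length F + j)) [0..<length F] @
     concat (map (vertex_edges k s F) [0..<k * 2 ^ s])"

definition cnf_vertices :: "nat \<Rightarrow> nat \<Rightarrow> cnf \<Rightarrow> nat" where
  "cnf_vertices k s F = k * 2 ^ s + 2 * k + 3 * length F + 1"

text \<open>Besides the \<open>k * 2 ^ s\<close> partial assignments, the graph has for every block a hub, adjacent to
  the assignments of the block, and a pin, adjacent to the hub only; for every clause \<open>C\<close> a vertex
  adjacent to the assignments satisfying \<open>C\<close>, and a pin adjacent to that vertex only. The remaining
  dummies are adjacent to all assignments: they do not affect the argument and only ensure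
  that there are at least as many edges as the input format requires.\<close>

locale cnf_graph =
  fixes k l s :: nat and F :: cnf
  assumes k: "2 \<le> k" and l1: "1 \<le> l" and s: "1 \<le> s"
    and vars: "\<And>C v b. C \<in> set F \<Longrightarrow> (v, b) \<in> set C \<Longrightarrow> v < k * s"
begin

abbreviation "K \<equiv> k * 2 ^ s"
abbreviation "M \<equiv> length F"
abbreviation "hub i \<equiv> K + i"
abbreviation "pin i \<equiv> K + k + i"
abbreviation "cl j \<equiv> K + 2 * k + j"
abbreviation "clpin j \<equiv> K + 2 * k + M + j"
abbreviation "dummy j \<equiv> K + 2 * k + 2 * M + j"
abbreviation "n \<equiv> cnf_vertices k s F"
abbreviation "es \<equiv> cnf_edges k s F"

lemma edge_cases:
  "(u, v) \<in> set es \<longleftrightarrow>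
     (\<exists>i<k. u = hub i \<and> v = pin i) \<or> (\<exists>j<M. u = cl j \<and> v = clpin j) \<or>
     (u < K \<and> (v = hub (u div 2 ^ s) \<or> (\<exists>j\<le>M. v = dummy j) \<or>
        (\<exists>j<M. v = cl j \<and> partial_sat s u (F ! j))))"
proof -
  have ce: "(u, v) \<in> set (clause_edges k s F y j) \<longleftrightarrow>
      u = y \<and> (v = dummy j \<or> v = cl j \<and> partial_sat s y (F ! j))" for y j
    by (auto simp: clause_edges_def)
  have "(u, v) \<in> set (vertex_edges k s F y) \<longleftrightarrow> u = y \<and> (v = hub (y div 2 ^ s) \<or> v = dummy M \<or>
      (\<exists>j<M. v = dummy j \<or> v = cl j \<and> partial_sat s y (F ! j)))" for y
    by (auto simp: vertex_edges_def ce)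
  then have "(u, v) \<in> set es \<longleftrightarrow>
     (\<exists>i<k. u = hub i \<and> v = pin i) \<or> (\<exists>j<M. u = cl j \<and> v = clpin j) \<or>
     (u < K \<and> (v = hub (u div 2 ^ s) \<or> v = dummy M \<or>
      (\<exists>j<M. v = dummy j \<or> v = cl j \<and> partial_sat s u (F ! j))))"
    by (auto simp: cnf_edges_def)
  also have "(v = hub (u div 2 ^ s) \<or> v = dummy M \<or>
      (\<exists>j<M. v = dummy j \<or> v = cl j \<and> partial_sat s u (F ! j))) \<longleftrightarrow>
      (v = hub (u div 2 ^ s) \<or> (\<exists>j\<le>M. v = dummy j) \<or> (\<exists>j<M. v = cl j \<and> partial_sat s u (F ! j)))"
    by (metis le_neq_implies_less less_imp_le order_refl)
  finally show ?thesis .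
qed

lemma edge_elim:
  assumes "(u, v) \<in> set es"
  obtains a where "a < k" "u = hub a" "v = pin a" | a where "a < M" "u = cl a" "v = clpin a"
    | "u < K" "v = hub (u div 2 ^ s)" | a where "u < K" "a \<le> M" "v = dummy a"
    | a where "u < K" "a < M" "v = cl a" "partial_sat s u (F ! a)"
  using assms unfolding edge_cases by blast

lemma block_less: "y < K \<Longrightarrow> y div 2 ^ s < k"
  by (simp add: less_mult_imp_div_less)

lemma distinct_es: "distinct es"
proof -
  have "distinct (vertex_edges k s F y)" if "y < K" for y
  proof -
    have "y div 2 ^ s < k" using that by (rule block_less)
    moreover have "distinct (concat (map (clause_edges k s F y) [0..<M]))"
      by (rule distinct_concat_map) (auto simp: clause_edges_def)
    ultimately show ?thesis
      by (auto simp: vertex_edges_def clause_edges_def split: if_splits)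
  qed
  then have "distinct (concat (map (vertex_edges k s F) [0..<K]))"
    by (intro distinct_concat_map) (auto simp: vertex_edges_def clause_edges_def split: if_splits)
  moreover have "u < K" if "(u, v) \<in> set (concat (map (vertex_edges k s F) [0..<K]))" for u v
    using that by (auto simp: vertex_edges_def clause_edges_def split: if_splits)
  ultimately show ?thesis
    unfolding cnf_edges_def by (fastforce simp: distinct_map inj_on_def)
qed

lemma length_es: "k + M + K * (2 + M) \<le> length es" "length es \<le> k + M + K * (2 + 2 * M)"
proof -
  have ce: "1 \<le> length (clause_edges k s F y j)" "length (clause_edges k s F y j) \<le> 2" for y j
    by (auto simp: clause_edges_def)
  have "2 + M \<le> length (vertex_edges k s F y)" "length (vertex_edges k s F y) \<le> 2 + 2 * M" for y
    using length_concat_map_ge[of 1 "clause_edges k s F y" "[0..<M]", OF ce(1)]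
      length_concat_map_le[of "clause_edges k s F y" 2 "[0..<M]", OF ce(2)]
    by (auto simp: vertex_edges_def)
  from length_concat_map_ge[of "2 + M" "vertex_edges k s F" "[0..<K]", OF this(1)]
    length_concat_map_le[of "vertex_edges k s F" "2 + 2 * M" "[0..<K]", OF this(2)]
  show "k + M + K * (2 + M) \<le> length es" "length es \<le> k + M + K * (2 + 2 * M)"
    by (auto simp: cnf_edges_def)
qed

sublocale subdivision l n es
proof
  show "1 \<le> l" by (rule l1)
  show "distinct es" by (rule distinct_es)
  show "u < v \<and> v < n" if "(u, v) \<in> set es" for u v
    using that block_less[of u] k unfolding edge_cases cnf_vertices_def by auto
qed

lemma K_ge: "k \<le> K" by simp

lemma input_graph: "input_graph (n + (l - 1) * length es) (subdivide l n es)"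
proof (rule input_graph_subdivide)
  have "K * (2 + M) = 2 * K + K * M" by (simp add: algebra_simps)
  \<comment> \<open>After cancellation the count requires \<open>k + 2 * M \<le> K + K * M\<close>,
    where the right side is the number of edges to dummies.\<close>
  moreover have "2 * M \<le> K * M" using K_ge k by (intro mult_le_mono1) linarith
  ultimately show "n \<le> length es + 1"
    using length_es(1) K_ge unfolding cnf_vertices_def by linarith
qed

section \<open>Centres from a satisfying assignment\<close>

lemma vertex_cases:
  assumes "z < n"
  obtains "z < K" | i where "i < k" "z = hub i" | i where "i < k" "z = pin i"
      | j where "j < M" "z = cl j" | j where "j < M" "z = clpin j" | j where "j \<le> M" "z = dummy j"
proof -
  consider "z < K" | "K \<le> z" "z < K + k" | "K + k \<le> z" "z < K + 2 * k"
    | "K + 2 * k \<le> z" "z < K + 2 * k + M" | "K + 2 * k + M \<le> z" "z < K + 2 * k + 2 * M"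
    | "K + 2 * k + 2 * M \<le> z" "z \<le> K + 2 * k + 3 * M"
    using assms unfolding cnf_vertices_def by linarith
  then show thesis
  proof cases
    case 1
    then show ?thesis by (rule that(1))
  next
    case 2
    then show ?thesis by (intro that(2)[of "z - K"]) auto
  next
    case 3
    then show ?thesis by (intro that(3)[of "z - (K + k)"]) auto
  next
    case 4
    then show ?thesis by (intro that(4)[of "z - (K + 2 * k)"]) auto
  next
    case 5
    then show ?thesis by (intro that(5)[of "z - (K + 2 * k + M)"]) auto
  next
    case 6
    then show ?thesis by (intro that(6)[of "z - (K + 2 * k + 2 * M)"]) auto
  qed
qed

text \<open>The centres are the restrictions of a satisfying assignment to the blocks. Every edge
  has an end adjacent to one of them: a hub, adjacent to the centre of its block; a clause vertex,
  by satisfaction; or a dummy, adjacent to all.\<close>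

lemma k_radius_le_if_satisfiable:
  assumes "satisfiable F"
  shows "k_radius k {..<n + (l - 1) * length es} E \<le> enat (2 * l)"
proof -
  obtain \<alpha> :: "nat \<Rightarrow> bool" where \<alpha>: "\<And>C. C \<in> set F \<Longrightarrow> \<exists>(v, b)\<in>set C. \<alpha> v = b"
    using assms by (auto simp: satisfiable_def)
  define x where "x i = (horner_sum of_bool 2 (map (\<lambda>t. \<alpha> (i * s + t)) [0..<s]) :: nat)" for i
  \<comment> \<open>The vertex for the restriction of \<open>\<alpha>\<close> to block
    \<open>i\<close>: the block in the high part, the truth values as bits of \<open>x i\<close> in
    the low part.\<close>
  define y where "y i = i * 2 ^ s + x i" for i
  have x: "x i < 2 ^ s" for i
    using horner_sum_of_bool_2_less[of "map (\<lambda>t. \<alpha> (i * s + t)) [0..<s]", where 'a = nat]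
    by (simp add: x_def)
  have bitx: "bit (x i) t \<longleftrightarrow> \<alpha> (i * s + t)" if "t < s" for i t
    using that by (simp add: x_def bit_horner_sum_bit_iff)
  have y: "y i div 2 ^ s = i" "y i mod 2 ^ s = x i" for i
    using x[of i] by (simp_all add: y_def)
  have yK: "y i < K" if "i < k" for i
  proof -
    have "y i < Suc i * 2 ^ s" using x[of i] by (simp add: y_def)
    also have "\<dots> \<le> K" using that by (intro mult_le_mono1) simp
    finally show ?thesis .
  qed
  let ?C = "y ` {..<k}"
  have "inj_on y {..<k}" using y(1) by (metis inj_onI)
  then have card: "card ?C = k" by (simp add: card_image)
  have sub: "?C \<subseteq> {..<n}" using yK by (fastforce simp: cnf_vertices_def)
  have sat: "\<exists>i<k. partial_sat s (y i) (F ! j)" if "j < M" for j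
  proof -
    obtain v b where vb: "(v, b) \<in> set (F ! j)" "\<alpha> v = b" using \<alpha>[OF nth_mem[OF \<open>j < M\<close>]] by blast
    have "v div s < k" using vars[of "F ! j" v b] vb(1) that by (simp add: less_mult_imp_div_less)
    moreover have "lit_sat s (y (v div s)) (v, b)"
      using vb(2) s bitx[of "v mod s" "v div s"] by (simp add: lit_sat_def y)
    ultimately show ?thesis using vb(1) unfolding partial_sat_def by blast
  qed
  show ?thesis
  proof (rule k_radius_subdivide_le[OF sub card])
    fix z assume "z < n"
    then consider "z < K" | i where "i < k" "z = hub i" | i where "i < k" "z = pin i"
      | j where "j < M" "z = cl j" | j where "j < M" "z = clpin j" | j where "j \<le> M" "z = dummy j"
      by (rule vertex_cases)
    then show "\<exists>u v. (u, v) \<in> set es \<and> z \<in> {u, v}"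
    proof cases
      case 1
      then have "(z, hub (z div 2 ^ s)) \<in> set es" by (simp add: edge_cases)
      then show ?thesis by blast
    next
      case (6 j)
      then have "(y 0, z) \<in> set es" using yK[of 0] k by (auto simp: edge_cases)
      then show ?thesis by blast
    qed (use edge_cases in blast)+
  next
    fix u v assume "(u, v) \<in> set es"
    then consider i where "i < k" "u = hub i \<or> v = hub i" | j where "j < M" "u = cl j \<or> v = cl j"
      | j where "j \<le> M" "v = dummy j"
      using block_less[of u] unfolding edge_cases by blast
    then show "\<exists>z\<in>{u, v}. \<exists>c\<in>?C. (c, z) \<in> set es"
    proof cases
      case (1 i)
      have "(y i, hub i) \<in> set es" using 1(1) yK[of i] y(1) by (simp add: edge_cases)
      then show ?thesis using 1 by blast
    next
      case (2 j)
      obtain i where "i < k" "partial_sat s (y i) (F ! j)" using sat[OF 2(1)] by blast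
      then have "(y i, cl j) \<in> set es" using 2(1) yK[of i] unfolding edge_cases by blast
      then show ?thesis using 2 \<open>i < k\<close> by blast
    next
      case (3 j)
      have "(y 0, dummy j) \<in> set es" using 3(1) yK[of 0] k unfolding edge_cases by auto
      then show ?thesis using 3 k by (metis gr0I image_eqI insert_iff lessThan_iff not_numeral_le_zero)
    qed
  qed
qed

section \<open>A satisfying assignment from close centres\<close>

text \<open>If all pins are at distance less than \<open>3 * l\<close> from \<open>k\<close> centres, then every block owns
  exactly one of the centres, and the assignment next to it satisfies all clauses whose pins it is
  responsible for.\<close>

definition pin_dist :: "nat \<Rightarrow> nat \<Rightarrow> int" where
  "pin_dist i z = (if z = pin i then 0 else if z = hub i then 1
     else if z < K \<and> z div 2 ^ s = i then 2 else 3)"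

text \<open>The distance to the clause pin before subdividing, truncated at 3. Truncation preserves
  the Lipschitz property and spares any knowledge of vertices farther away.\<close>

definition clpin_dist :: "nat \<Rightarrow> nat \<Rightarrow> int" where
  "clpin_dist j z = (if z = clpin j then 0 else if z = cl j then 1
     else if z < K \<and> partial_sat s z (F ! j) then 2 else 3)"

lemma pin_dist_less: "pin_dist i z < 3 \<longleftrightarrow> z = pin i \<or> z = hub i \<or> (z < K \<and> z div 2 ^ s = i)"
  by (simp add: pin_dist_def)

lemma clpin_dist_less:
  "clpin_dist j z < 3 \<longleftrightarrow> z = clpin j \<or> z = cl j \<or> (z < K \<and> partial_sat s z (F ! j))"
  by (simp add: clpin_dist_def)

lemma pin_dist_lipschitz:
  assumes "i < k" "(u, v) \<in> set es"
  shows "\<bar>pin_dist i u - pin_dist i v\<bar> \<le> 1"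
  using edge_elim[OF assms(2)]
proof cases
  case 3
  then show ?thesis using assms(1) block_less[OF 3(1)] by (simp add: pin_dist_def)
qed (use assms(1) in \<open>simp_all add: pin_dist_def\<close>)

lemma clpin_dist_lipschitz:
  assumes "j < M" "(u, v) \<in> set es"
  shows "\<bar>clpin_dist j u - clpin_dist j v\<bar> \<le> 1"
  using edge_elim[OF assms(2)]
proof cases
  case 3
  then show ?thesis using assms(1) block_less[OF 3(1)] by (simp add: clpin_dist_def)
qed (use assms(1) in \<open>auto simp: clpin_dist_def\<close>)

text \<open>The partial assignment a centre stands for. Assignments are pairwise nonadjacent, so a
  support contains at most one. If it contains none, the value is arbitrary, which is harmless: by
  \<open>clpin_support\<close>, such a centre, when close to the pin of a block, is close to no
  clause pin.\<close>

definition rep :: "nat \<Rightarrow> nat" where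
  "rep x = (THE y. y \<in> support x \<and> y < K)"

lemma rep_eq:
  assumes "x < n + (l - 1) * length es" "y \<in> support x" "y < K"
  shows "rep x = y"
proof -
  have "y' = y" if "y' \<in> support x" "y' < K" for y'
    using support_cases[OF assms(1)]
  proof
    assume "\<exists>u v. (u, v) \<in> set es \<and> support x = {u, v}"
    then obtain u v where "(u, v) \<in> set es" "support x = {u, v}" by blast
    then show ?thesis using that assms(2,3) unfolding edge_cases by auto
  qed (use that assms in auto)
  then show ?thesis unfolding rep_def using assms(2,3) by blast
qed

text \<open>No edge joins the vicinities of two blocks, each made up of pin, hub and assignments.
  Hence different blocks need different centres.\<close>

lemma pin_support_unique:
  assumes "x < n + (l - 1) * length es" "i < k" "i' < k"
    "\<exists>z\<in>support x. pin_dist i z < 3" "\<exists>z\<in>support x. pin_dist i' z < 3"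
  shows "i = i'"
  using support_cases[OF assms(1)]
proof
  assume "\<exists>u v. (u, v) \<in> set es \<and> support x = {u, v}"
  then obtain u v where "(u, v) \<in> set es" "support x = {u, v}" by blast
  then show ?thesis using assms(2-5) block_less[of u] unfolding edge_cases pin_dist_less by auto
qed (use assms(2-5) in \<open>auto simp: pin_dist_less\<close>)

text \<open>If an edge meets both vicinities, its lower end is an assignment of block
  \<open>i\<close>. This satisfies clause \<open>j\<close> itself, or the upper end is
  \<open>cl j\<close>; but being adjacent to \<open>cl j\<close> means satisfying the
  clause.\<close>

lemma clpin_support:
  assumes "x < n + (l - 1) * length es" "i < k" "j < M"
    "\<exists>z\<in>support x. pin_dist i z < 3" "\<exists>z\<in>support x. clpin_dist j z < 3"
  shows "\<exists>y\<in>support x. y < K \<and> y div 2 ^ s = i \<and> partial_sat s y (F ! j)"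
  using support_cases[OF assms(1)]
proof
  assume "\<exists>u v. (u, v) \<in> set es \<and> support x = {u, v}"
  then obtain u v where uv: "(u, v) \<in> set es" "support x = {u, v}" by blast
  have p: "pin_dist i u < 3 \<or> pin_dist i v < 3" and c: "clpin_dist j u < 3 \<or> clpin_dist j v < 3"
    using assms(4,5) unfolding uv(2) by auto
  from uv(1) have "u < K \<and> u div 2 ^ s = i \<and> partial_sat s u (F ! j)"
  proof (cases rule: edge_elim)
    case 1
    then show ?thesis using c by (simp add: clpin_dist_less)
  next
    case 2
    then show ?thesis using p assms(2) by (simp add: pin_dist_less)
  next
    case 3
    then show ?thesis using p c block_less[OF 3(1)] by (auto simp: pin_dist_less clpin_dist_less)
  next
    case 4
    then show ?thesis using p c assms(2,3) by (auto simp: pin_dist_less clpin_dist_less)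
  next
    case 5
    then show ?thesis using p c assms(2,3) by (auto simp: pin_dist_less clpin_dist_less)
  qed
  then show ?thesis using uv(2) by blast
qed (use assms(2-5) in \<open>auto simp: pin_dist_less clpin_dist_less\<close>)

lemma satisfiable_if_k_radius_less:
  assumes "k_radius k {..<n + (l - 1) * length es} E < enat (3 * l)"
  shows "satisfiable F"
proof -
  let ?n = "n + (l - 1) * length es"
  obtain C where C: "C \<subseteq> {..<?n}" "card C = k"
    and S: "(SUP v\<in>{..<?n}. INF c\<in>C. gdist E v c) < enat (3 * l)"
    using assms unfolding k_radius_def INF_less_iff by blast
  have near: "\<exists>c\<in>C. gdist E v c < enat (3 * l)" if "v < ?n" for v
  proof -
    have "(INF c\<in>C. gdist E v c) \<le> (SUP v\<in>{..<?n}. INF c\<in>C. gdist E v c)"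
      using that by (intro SUP_upper) simp
    then have "(INF c\<in>C. gdist E v c) < enat (3 * l)" using S by (rule le_less_trans)
    then show ?thesis by (simp add: INF_less_iff)
  qed
  have "\<exists>c\<in>C. \<exists>z\<in>support c. pin_dist i z < 3" if "i < k" for i
  proof -
    have p: "pin i < n" using that by (simp add: cnf_vertices_def)
    then obtain c where "c \<in> C" "gdist E (pin i) c < enat (3 * l)"
      using near[of "pin i"] by (meson trans_less_add1)
    moreover from this(1) have "c < ?n" using C(1) by auto
    moreover have "pin_dist i (pin i) = 0" by (simp add: pin_dist_def)
    ultimately show ?thesis
      using gdist_less_support[where f = "pin_dist i" and x = c and p = "pin i",
          OF pin_dist_lipschitz[OF that]] p by blast
  qed
  then obtain c where c: "\<And>i. i < k \<Longrightarrow> c i \<in> C" "\<And>i. i < k \<Longrightarrow> \<exists>z\<in>support (c i). pin_dist i z < 3"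
    by metis
  have cn: "c i < ?n" if "i < k" for i using c(1)[OF that] C(1) by auto
  have "inj_on c {..<k}"
  proof (rule inj_onI)
    fix i i' assume "i \<in> {..<k}" "i' \<in> {..<k}" "c i = c i'"
    then show "i = i'" using pin_support_unique[OF cn, of i i i'] c(2)[of i] c(2)[of i'] by auto
  qed
  \<comment> \<open>The \<open>k\<close> block pins use up all \<open>k\<close> centres, so a centre
    serving a clause pin belongs to some block.\<close>
  then have "card (c ` {..<k}) = card C" using C(2) by (simp add: card_image)
  moreover have "finite C" using C(1) finite_subset by blast
  ultimately have cC: "c ` {..<k} = C" using c(1) by (intro card_subset_eq) auto
  \<comment> \<open>Each variable is read off the centre that belongs to its block, so the choices
    for different blocks cannot conflict.\<close>
  define \<alpha> where "\<alpha> v = bit (rep (c (v div s)) mod 2 ^ s) (v mod s)" for v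
  have "\<exists>(v, b)\<in>set D. \<alpha> v = b" if D: "D \<in> set F" for D
  proof -
    obtain j where j: "j < M" "D = F ! j" using D by (metis in_set_conv_nth)
    have p: "clpin j < n" using j by (simp add: cnf_vertices_def)
    then obtain x where "x \<in> C" "gdist E (clpin j) x < enat (3 * l)"
      using near[of "clpin j"] by (meson trans_less_add1)
    moreover from this(1) obtain i where i: "i < k" "x = c i" using cC by auto
    moreover have "clpin_dist j (clpin j) = 0" by (simp add: clpin_dist_def)
    ultimately have "\<exists>z\<in>support (c i). clpin_dist j z < 3"
      using gdist_less_support[where f = "clpin_dist j" and x = "c i" and p = "clpin j",
          OF clpin_dist_lipschitz[OF j(1)]] cn[OF i(1)] p by blast
    from clpin_support[OF cn[OF i(1)] i(1) j(1) c(2)[OF i(1)] this]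
    obtain y where y: "y \<in> support (c i)" "y < K" "y div 2 ^ s = i" "partial_sat s y (F ! j)" by blast
    have "rep (c i) = y" by (rule rep_eq[OF cn[OF i(1)] y(1,2)])
    moreover obtain v b where "(v, b) \<in> set D" "lit_sat s y (v, b)"
      using y(4) j(2) unfolding partial_sat_def by auto
    ultimately show ?thesis using y(3) by (auto simp: lit_sat_def \<alpha>_def)
  qed
  then show ?thesis unfolding satisfiable_def by blast
qed

end

section \<open>A program constructing the graph\<close>

definition flat :: "(nat \<times> nat) list \<Rightarrow> nat list" where
  "flat es = concat (map (\<lambda>(u, v). [u, v]) es)"

lemma flat_simps [simp]: "flat [] = []" "flat ((u, v) # es) = u # v # flat es"
  "flat (es @ es') = flat es @ flat es'"
  by (auto simp: flat_def)

lemma length_flat [simp]: "length (flat es) = 2 * length es"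
  by (induction es) (auto simp: flat_def)

text \<open>Memory is described as the initial memory with one list written over it; storing into
  the next free cell appends to that list.\<close>

definition upd_list :: "(nat \<Rightarrow> nat) \<Rightarrow> nat \<Rightarrow> nat list \<Rightarrow> nat \<Rightarrow> nat" where
  "upd_list m p xs = (\<lambda>a. if p \<le> a \<and> a < p + length xs then xs ! (a - p) else m a)"

lemma upd_list_snoc: "a = p + length xs \<Longrightarrow> (upd_list m p xs)(a := x) = upd_list m p (xs @ [x])"
  by (auto simp: upd_list_def fun_eq_iff nth_append)

lemma blkpre_mono:
  assumes "blkpre w is Q g m" "\<And>g m. Q g m \<Longrightarrow> Q' g m"
  shows "blkpre w is Q' g m"
  using assms(1)
proof (induction "is" arbitrary: g m)
  case (Cons i "is")
  then show ?case by (cases i) auto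
qed (simp add: assms(2))

text \<open>Use of registers: 0 holds the length of the input, which is also the address of the graph, 3 the
  number of clauses, 4, 5, 6 the numbers \<open>s\<close>, \<open>2 ^ s\<close>, \<open>k * 2 ^ s\<close>, 7 the next free cell of the
  edge list, 8 the next unused vertex, 9 and 10 the ends of the edge to be subdivided, 11 the
  constant 1, 14 and 16 the current vertex and clause, 17 the reading position in the formula, 19 the
  number of satisfied literals, 20 and 21 the block and the bits of the current assignment, and 25
  to 29 the first vertices of the various kinds.\<close>

definition emit_step :: "instr list" where
  "emit_step = [Store 9 7, Op Add 7 7 11, Store 8 7, Op Add 7 7 11, Const 9 0, Op Add 9 9 8, Op Add 8 8 11]"

text \<open>As \<open>l\<close> is a constant of the program, the inner steps are unrolled. Each
  writes an edge from the current vertex to a fresh one, which becomes current. Adding to 0 serves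
  as a move instruction.\<close>

definition emit :: "nat \<Rightarrow> code" where
  "emit l = blk (concat (replicate (l - 1) emit_step) @
     [Store 9 7, Op Add 7 7 11, Store 10 7, Op Add 7 7 11])"

text \<open>Equality is tested by truncated subtraction: \<open>(x - y) + (y - x)\<close> is 0 iff
  \<open>x = y\<close>. Register 30 sums the discrepancies of the blocks and of the truth values,
  and 1 minus this sum is the indicator added to the count.\<close>

definition lit_code :: "instr list" where
  "lit_code = [Load 12 17, Op Add 17 17 11, Const 22 2, Op Div 23 12 22, Op Mod 12 12 22,
     Op Div 24 23 4, Op Mod 23 23 4, Op Shr 23 21 23, Op Mod 23 23 22,
     Op Sub 30 24 20, Op Sub 31 20 24, Op Add 30 30 31, Op Sub 31 23 12, Op Add 30 30 31,
     Op Sub 31 12 23, Op Add 30 30 31, Op Sub 30 11 30, Op Add 19 19 30]"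

definition dummy_args :: "instr list" where
  "dummy_args = [Const 12 0, Op Add 9 14 12, Op Add 10 27 16]"

definition clause_start :: "instr list" where
  "clause_start = [Const 19 0, Load 18 17, Op Add 17 17 11]"

definition clause_args :: "instr list" where
  "clause_args = [Const 12 0, Op Add 9 14 12, Op Add 10 25 16]"

definition clause_code :: "nat \<Rightarrow> code" where
  "clause_code l = blk dummy_args ;; emit l ;; blk clause_start ;; loop 18 (blk lit_code) ;;
     cond 19 (blk clause_args ;; emit l) ;; blk [Op Add 16 16 11]"

definition hub_args :: "instr list" where
  "hub_args = [Op Div 20 14 5, Op Mod 21 14 5, Const 12 0, Op Add 9 14 12, Op Add 10 6 20]"

definition last_dummy_args :: "instr list" where
  "last_dummy_args = [Const 12 0, Op Add 9 14 12, Op Add 10 28 12]"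

text \<open>The formula is read again for every vertex. Its clauses start in cell 2, behind
  \<open>N\<close> and the number of clauses.\<close>

definition vertex_start :: "instr list" where
  "vertex_start = [Const 16 0, Op Add 15 16 3, Const 17 2]"

definition vertex_code :: "nat \<Rightarrow> code" where
  "vertex_code l = blk hub_args ;; emit l ;; blk last_dummy_args ;; emit l ;; blk vertex_start ;;
     loop 15 (clause_code l) ;; blk [Op Add 14 14 11]"

definition pin_code :: "nat \<Rightarrow> code" where
  "pin_code l = blk [Op Add 9 6 14, Op Add 10 29 14] ;; emit l ;; blk [Op Add 14 14 11]"

definition clpin_code :: "nat \<Rightarrow> code" where
  "clpin_code l = blk [Op Add 9 25 14, Op Add 10 26 14] ;; emit l ;; blk [Op Add 14 14 11]"

definition start_code :: "nat \<Rightarrow> instr list" where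
  "start_code k = [Const 11 1, Const 1 0, Load 12 1, Load 3 11, Const 1 k, Op Div 4 12 1,
     Op Add 4 4 11, Op Shl 5 11 4, Op Mul 6 1 5, Op Add 29 6 1, Op Add 25 29 1, Op Add 26 25 3,
     Op Add 27 26 3, Op Add 28 27 3, Op Add 8 28 11, Op Add 7 0 11, Op Add 7 7 11,
     Const 14 0, Op Add 13 14 1]"

text \<open>The sizes are known only now; \<open>start_code\<close> left cells \<open>B\<close> and
  \<open>B + 1\<close> free for them. The graph occupies two cells plus two per edge, so half its
  length minus 1 is the number of edges. Register 50, as the simulated register 0, receives the
  length.\<close>

definition end_code :: "instr list" where
  "end_code = [Store 8 0, Op Add 12 0 11, Op Sub 50 7 0, Const 22 2, Op Div 30 50 22,
     Op Sub 30 30 11, Store 30 12]"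

definition build_code :: "nat \<Rightarrow> nat \<Rightarrow> code" where
  "build_code k l = blk (start_code k) ;; loop 13 (pin_code l) ;;
     blk [Const 14 0, Op Add 13 14 3] ;; loop 13 (clpin_code l) ;;
     blk [Const 14 0, Op Add 13 14 6] ;; loop 13 (vertex_code l) ;; blk end_code"

text \<open>\<open>big\<close> bounds all words at once. The number of original edges is at most the
  factor of \<open>3 * l\<close>; two thirds of that product cover the cells of the edge list, one
  third the inner vertices. The remaining terms cover the input, literal codes and literal
  counts.\<close>

locale builder = cnf_graph +
  fixes N q w :: nat
  assumes s_def: "s = N div k + 1"
    and clauses: "\<And>C. C \<in> set F \<Longrightarrow> length C \<le> q"
    and lits: "\<And>C v b. C \<in> set F \<Longrightarrow> (v, b) \<in> set C \<Longrightarrow> v < N"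
    and big: "length (encode_cnf N F) + n + 3 * l * (k + M + K * (2 + 2 * M)) + 2 * N + q + 10 < 2 ^ w"
begin

abbreviation "xs \<equiv> encode_cnf N F"
abbreviation "B \<equiv> length xs"
abbreviation "mx \<equiv> k + M + K * (2 + 2 * M)"

text \<open>\<open>us\<close> lists the original edges emitted so far. Registers from 50 on must
  stay 0, since the simulated program expects them so.\<close>

definition inv :: "(nat \<times> nat) list \<Rightarrow> (nat \<Rightarrow> nat) \<Rightarrow> (nat \<Rightarrow> nat) \<Rightarrow> bool" where
  "inv us g m \<longleftrightarrow> g 0 = B \<and> g 3 = M \<and> g 4 = s \<and> g 5 = 2 ^ s \<and> g 6 = K \<and> g 11 = 1 \<and>
     g 25 = K + 2 * k \<and> g 26 = K + 2 * k + M \<and> g 27 = K + 2 * k + 2 * M \<and>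
     g 28 = K + 2 * k + 3 * M \<and> g 29 = K + k \<and> (\<forall>r\<ge>50. g r = 0) \<and>
     g 7 = B + 2 + 2 * l * length us \<and> g 8 = n + (l - 1) * length us \<and>
     m = upd_list (mem (init_state xs)) (B + 2) (flat (subdivide l n us))"

lemma inv_upd [simp]:
  assumes "r \<notin> {0,3,4,5,6,7,8,11,25,26,27,28,29}" "r < 50"
  shows "inv us (g(r := x)) m = inv us g m"
  using assms by (auto simp: inv_def)

text \<open>Seven instructions per inner vertex and four for the last edge. Registers from 10 on are
  preserved, among them all loop counters; register 9 is consumed.\<close>

lemma wp_emit:
  assumes inv: "inv us g m" and g: "g 9 = u" "g 10 = v" and len: "length us < mx"
    and Q: "\<And>g' m'. inv (us @ [(u, v)]) g' m' \<Longrightarrow> (\<And>r. 10 \<le> r \<Longrightarrow> g' r = g r) \<Longrightarrow> Q g' m'"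
  shows "wp w (emit l) (7 * l) Q g m"
proof -
  let ?e = "length us"
  let ?us = "us @ [(u, v)]"
  let ?pos = "sub_pos l n ?us ?e"
  let ?path = "\<lambda>i. map (\<lambda>t. (?pos t, ?pos (Suc t))) [0..<i]"
  define J where "J i g' m' \<longleftrightarrow> g' 7 = B + 2 + 2 * l * ?e + 2 * i \<and> g' 8 = n + (l - 1) * ?e + i \<and>
    g' 9 = ?pos i \<and> (\<forall>r. r \<notin> {7, 8, 9} \<longrightarrow> g' r = g r) \<and>
    m' = upd_list (mem (init_state xs)) (B + 2) (flat (subdivide l n us @ ?path i))"
    for i and g' m' :: "nat \<Rightarrow> nat"
  have g11: "g 11 = 1" using inv by (simp add: inv_def)
  have B1: "B + 2 + 2 * l * ?e + 2 * l + n + (l - 1) * ?e + l + 5 < 2 ^ w"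
  proof -
    have "3 * l * Suc ?e \<le> 3 * l * mx" using len by (intro mult_le_mono2) simp
    moreover have "(l - 1) * ?e \<le> l * ?e" by simp
    moreover have "3 * l * Suc ?e = 2 * l * ?e + l * ?e + 3 * l" by (simp add: algebra_simps)
    ultimately have "2 * l * ?e + 2 * l + (l - 1) * ?e + l \<le> 3 * l * mx" by linarith
    then show ?thesis using big by linarith
  qed
  have J0: "J 0 g m" using inv g by (simp add: J_def inv_def sub_pos_def nth_append)
  have st: "blkpre w emit_step (J (Suc i)) g' m'" if J: "J i g' m'" and i: "i < l - 1" for i g' m'
  proof -
    \<comment> \<open>The counter in register 8 agrees with the numbering of inner vertices in
      \<open>sub_pos\<close>.\<close>
    have p: "?pos (Suc i) = n + (l - 1) * ?e + i" using i by (cases "Suc i = l") (simp_all add: sub_pos_def)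
    have "g' 11 = 1" using J g11 by (simp add: J_def)
    moreover have "2 * i < 2 * l" "i < l" using i by auto
    ultimately show ?thesis using J B1 unfolding J_def emit_step_def
      by (simp add: p length_subdivide upd_list_snoc)
  qed
  have loop: "blkpre w (concat (replicate c emit_step)) (J (l - 1)) g' m'"
    if "J i g' m'" "i + c = l - 1" for i c g' m'
    using that
  proof (induction c arbitrary: i g' m')
    case (Suc c)
    have "blkpre w emit_step (J (Suc i)) g' m'" using Suc.prems by (intro st) auto
    then have "blkpre w emit_step (blkpre w (concat (replicate c emit_step)) (J (l - 1))) g' m'"
      by (rule blkpre_mono) (use Suc in auto)
    then show ?case by (simp add: blkpre_append)
  qed simp
  have "blkpre w [Store 9 7, Op Add 7 7 11, Store 10 7, Op Add 7 7 11] Q g' m'" if J: "J (l - 1) g' m'" for g' m'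
  proof -
    obtain l' where l': "l = Suc l'" using l by (cases l) auto
    have sub: "subdivide l n ?us = subdivide l n us @ ?path l' @ [(?pos l', v)]"
      unfolding subdivide_append by (simp add: l' sub_pos_def nth_append)
    let ?g = "g'(7 := g' 7 + 1, 7 := g' 7 + 2)"
    let ?m = "m'(g' 7 := g' 9, g' 7 + 1 := g' 10)"
    have J': "g' 7 = B + 2 + 2 * l * ?e + 2 * l'" "g' 8 = n + l' * ?e + l'" "g' 9 = ?pos l'"
      "\<And>r. r \<notin> {7, 8, 9} \<Longrightarrow> g' r = g r"
      "m' = upd_list (mem (init_state xs)) (B + 2) (flat (subdivide l n us @ ?path l'))"
      using J unfolding J_def l' by simp_all
    have "?m = upd_list (mem (init_state xs)) (B + 2) (flat (subdivide l n ?us))"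
      unfolding sub J'(5) using J'(1,3,4) g
      by (simp add: upd_list_snoc length_subdivide)
    moreover have "g' 7 + 2 = B + 2 + 2 * l * length ?us" "g' 8 = n + (l - 1) * length ?us"
      using J'(1,2) by (simp_all add: l')
    ultimately have "inv ?us ?g ?m" using inv J'(4) by (simp add: inv_def)
    then have "Q ?g ?m" by (rule Q) (simp add: J'(4))
    moreover have "g' 7 + 2 < 2 ^ w" using J'(1) B1 l' by simp
    ultimately show ?thesis using J'(4)[of 11] g11 by (simp add: numeral_2_eq_2)
  qed
  then have "blkpre w (concat (replicate (l - 1) emit_step) @
     [Store 9 7, Op Add 7 7 11, Store 10 7, Op Add 7 7 11]) Q g m"
    unfolding blkpre_append using loop[OF J0, of "l - 1"] by (auto intro: blkpre_mono)
  moreover have "length (concat (replicate (l - 1) emit_step) @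
     [Store 9 7, Op Add 7 7 11, Store 10 7, Op Add 7 7 11]) \<le> 7 * l"
    using l by (simp add: length_concat sum_list_replicate emit_step_def)
  ultimately show ?thesis unfolding emit_def by (blast intro: wp_mono[OF wp_blk])
qed

lemma wp_emit_seq:
  assumes "inv us g m" "g 9 = u" "g 10 = v" "length us < mx"
    and "\<And>g' m'. inv (us @ [(u, v)]) g' m' \<Longrightarrow> (\<And>r. 10 \<le> r \<Longrightarrow> g' r = g r) \<Longrightarrow> wp w c t Q g' m'"
  shows "wp w (emit l ;; c) (7 * l + t) Q g m"
  by (rule wp_seq, rule wp_emit[OF assms(1-4)], rule assms(5))

section \<open>Reading the formula\<close>

lemma inv_mem:
  assumes "inv us g m" "a < B"
  shows "m a = xs ! a"
  using assms by (simp add: inv_def upd_list_def init_state_def)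

definition clause_addr :: "nat \<Rightarrow> nat" where
  "clause_addr j = 2 + length (concat (map (\<lambda>C. length C # map (\<lambda>(v, b). 2 * v + of_bool b) C) (take j F)))"

lemma clause_addr_0: "clause_addr 0 = 2"
  by (simp add: clause_addr_def)

lemma clause_addr_Suc: "j < M \<Longrightarrow> clause_addr (Suc j) = clause_addr j + 1 + length (F ! j)"
  by (simp add: clause_addr_def take_Suc_conv_app_nth)

lemma clause_addr_nth:
  assumes j: "j < M"
  shows "clause_addr j < B" "xs ! clause_addr j = length (F ! j)"
    "t < length (F ! j) \<Longrightarrow> clause_addr j + 1 + t < B"
    "t < length (F ! j) \<Longrightarrow> F ! j ! t = (v, b) \<Longrightarrow> xs ! (clause_addr j + 1 + t) = 2 * v + of_bool b"
proof -
  let ?enc = "\<lambda>C. length C # map (\<lambda>(v, b). 2 * v + of_bool b) C"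
  let ?pre = "N # M # concat (map ?enc (take j F))"
  let ?post = "concat (map ?enc (drop (Suc j) F))"
  have "F = take j F @ F ! j # drop (Suc j) F" using j by (rule id_take_nth_drop)
  then have "concat (map ?enc F) = concat (map ?enc (take j F @ F ! j # drop (Suc j) F))" by simp
  then have xs: "xs = ?pre @ ?enc (F ! j) @ ?post" by (simp add: encode_cnf_def)
  have len: "clause_addr j = length ?pre" by (simp add: clause_addr_def)
  show "clause_addr j < B" unfolding xs len by simp
  show "xs ! clause_addr j = length (F ! j)" unfolding xs len nth_append_length by (simp add: nth_append)
  show "clause_addr j + 1 + t < B" if "t < length (F ! j)" unfolding xs len using that by simp
  show "xs ! (clause_addr j + 1 + t) = 2 * v + of_bool b"
    if "t < length (F ! j)" "F ! j ! t = (v, b)"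
  proof -
    have "xs ! (length ?pre + Suc t) = (?enc (F ! j) @ ?post) ! Suc t"
      unfolding xs by (simp only: nth_append_length_plus)
    then show ?thesis using that len by (simp add: nth_append)
  qed
qed

lemma B_ge: "2 \<le> B" "xs ! 0 = N" "xs ! 1 = M"
  by (simp_all add: encode_cnf_def)

lemma wp_lit:
  assumes inv: "inv us g m" and j: "j < M" and t: "t < length (F ! j)"
    and g: "g 17 = clause_addr j + 1 + t" "g 20 = y div 2 ^ s" "g 21 = y mod 2 ^ s"
      "g 19 = length (filter (lit_sat s y) (take t (F ! j)))" and y: "y < K"
    and Q: "\<And>g'. inv us g' m \<Longrightarrow> g' 17 = clause_addr j + 1 + Suc t \<Longrightarrow>
      g' 19 = length (filter (lit_sat s y) (take (Suc t) (F ! j))) \<Longrightarrow>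
      (\<forall>r\<in>{13, 14, 15, 16, 18, 20, 21}. g' r = g r) \<Longrightarrow> Q g' m"
  shows "wp w (blk lit_code) (length lit_code) Q g m"
proof (rule wp_blk)
  obtain v b where vb: "F ! j ! t = (v, b)" by fastforce
  have a: "clause_addr j + 1 + t < B" using clause_addr_nth(3)[OF j t] .
  have mv: "m (clause_addr j + 1 + t) = 2 * v + of_bool b"
    using inv_mem[OF inv a] clause_addr_nth(4)[OF j t vb] by simp
  have vN: "v < N" using lits[of "F ! j" v b] j t vb by (metis nth_mem)
  have len: "length (filter (lit_sat s y) (take t (F ! j))) \<le> q"
    using length_filter_le[of "lit_sat s y" "take t (F ! j)"] clauses[of "F ! j"] j t by simp
  have yd: "y div 2 ^ s < k" by (rule block_less[OF y])
  have K: "K + k < 2 ^ w" "M < 2 ^ w" using big by (simp_all add: cnf_vertices_def)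
  define i where "i = y div 2 ^ s"
  define vi where "vi = v div s"
  define vj where "vj = v mod s"
  define bq where "bq = (of_bool b :: nat)"
  define bp where "bp = (of_bool (bit (y mod 2 ^ s) vj) :: nat)"
  \<comment> \<open>The shifted word is at most \<open>y\<close> and therefore fits;
    \<open>bp\<close> is its last bit.\<close>
  define z where "z = drop_bit vj (y mod 2 ^ s)"
  have z: "z \<le> y" unfolding z_def drop_bit_eq_div
    by (meson div_le_dividend mod_less_eq_dividend order_trans)
  have zm: "z mod 2 = bp" by (simp add: z_def bp_def bit_iff_odd_drop_bit mod_2_eq_odd)
  have le: "bp \<le> 1" "bq \<le> 1" "vi \<le> v" "vj \<le> v" by (simp_all add: bp_def bq_def vi_def vj_def)
  have dm: "(2 * v + bq) div 2 = v" "(2 * v + bq) mod 2 = bq" by (simp_all add: bq_def)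
  have test: "1 - (vi - i + (i - vi) + (bp - bq) + (bq - bp)) = of_bool (lit_sat s y (v, b))"
    unfolding bp_def bq_def by (auto simp: lit_sat_def i_def vi_def vj_def)
  have c: "g 11 = 1" "g 4 = s" using inv by (simp_all add: inv_def)
  have flt: "length (filter (lit_sat s y) (take (Suc t) (F ! j))) =
      length (filter (lit_sat s y) (take t (F ! j))) + of_bool (lit_sat s y (v, b))"
    using t vb by (simp add: take_Suc_conv_app_nth)
  have lt1: "of_bool (lit_sat s y (v, b)) \<le> (1::nat)" by simp
  have fin: "Q (g(17 := clause_addr j + 1 + t + 1, 22 := 2, 12 := bq, 24 := vi, 23 := bp,
      31 := bq - bp, 30 := of_bool (lit_sat s y (v, b)),
      19 := length (filter (lit_sat s y) (take t (F ! j))) + of_bool (lit_sat s y (v, b)))) m"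
    by (rule Q) (use inv in \<open>auto simp: flt\<close>)
  have H: "v + i + q + 5 < 2 ^ w" "clause_addr j + 1 + t + 1 < 2 ^ w" "z < 2 ^ w"
    using big a vN yd z K y unfolding cnf_vertices_def i_def by linarith+
  have bnds: "v < 2 ^ w" "vi < 2 ^ w" "vj < 2 ^ w" "bp < 2 ^ w" "bq < 2 ^ w" "2 < (2::nat) ^ w"
    "vi - i < 2 ^ w" "i - vi < 2 ^ w" "bp - bq < 2 ^ w" "bq - bp < 2 ^ w"
    "vi - i + (i - vi) < 2 ^ w" "vi - i + (i - vi) + (bp - bq) < 2 ^ w"
    "vi - i + (i - vi) + (bp - bq) + (bq - bp) < 2 ^ w"
    "of_bool (lit_sat s y (v, b)) < (2::nat) ^ w"
    "length (filter (lit_sat s y) (take t (F ! j))) + of_bool (lit_sat s y (v, b)) < 2 ^ w"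
    using H le lt1 len by linarith+
  have eqs: "m (clause_addr j + 1 + t) = 2 * v + bq" "v div s = vi" "v mod s = vj"
    "drop_bit vj (y mod 2 ^ s) = z" "y div 2 ^ s = i"
    using mv by (simp_all only: bq_def vi_def vj_def z_def i_def)
  show "blkpre w lit_code Q g m"
    unfolding lit_code_def using fin bnds H(2,3)
    by (simp only: blkpre.simps ipre.simps apply_binop.simps fun_upd_apply c g eqs dm zm test
        if_True if_False rel_simps num.distinct num.inject numeral_eq_iff fun_upd_twist)
      simp
qed

text \<open>Shorter clauses are charged as if they had \<open>q\<close> literals, so that each round
  of the enclosing loop has the same budget.\<close>

definition t_clause :: nat where
  "t_clause = length dummy_args + (7 * l + (length clause_start + ((q * (length lit_code + 5) + 1) +
     ((1 + (length clause_args + 7 * l)) + length [Op Add 16 16 11]))))"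

lemma word_gt: "10 < (2::nat) ^ w" "B + 5 < 2 ^ w" "n + 5 < 2 ^ w"
  using big by linarith+

lemma inv_regs:
  assumes "inv us g m"
  shows "g 0 = B" "g 3 = M" "g 4 = s" "g 5 = 2 ^ s" "g 6 = K" "g 11 = 1" "g 25 = K + 2 * k"
    "g 26 = K + 2 * k + M" "g 27 = K + 2 * k + 2 * M" "g 28 = K + 2 * k + 3 * M" "g 29 = K + k"
  using assms by (simp_all add: inv_def)

lemma wp_clause:
  assumes inv: "inv us g m" and j: "j < M" and y: "y < K"
    and g: "g 14 = y" "g 16 = j" "g 17 = clause_addr j" "g 20 = y div 2 ^ s" "g 21 = y mod 2 ^ s"
    and len: "length us + 2 \<le> mx"
    and Q: "\<And>g' m'. inv (us @ clause_edges k s F y j) g' m' \<Longrightarrow> g' 16 = Suc j \<Longrightarrow>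
      g' 17 = clause_addr (Suc j) \<Longrightarrow> (\<forall>r\<in>{13, 14, 15, 20, 21}. g' r = g r) \<Longrightarrow> Q g' m'"
  shows "wp w (clause_code l) t_clause Q g m"
proof -
  let ?u1 = "us @ [(y, dummy j)]"
  let ?cnt = "\<lambda>t. length (filter (lit_sat s y) (take t (F ! j)))"
  let ?n = "length (F ! j)"
  have nq: "?n \<le> q" using clauses j by simp
  have nw: "K + 2 * k + 3 * M + 5 < 2 ^ w" using word_gt(3) by (simp add: cnf_vertices_def)
  have 1: "wp w (blk [Op Add 16 16 11]) (length [Op Add 16 16 11]) Q g' m'"
    if "inv (us @ clause_edges k s F y j) g' m'" "g' 17 = clause_addr (Suc j)"
      "\<forall>r\<in>{13, 14, 15, 16, 20, 21}. g' r = g r" for g' m'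
  proof (rule wp_blk)
    have "Q (g'(16 := Suc j)) m'" by (rule Q) (use that in auto)
    then show "blkpre w [Op Add 16 16 11] Q g' m'"
      using inv_regs[OF that(1)] that(3) g(2) nw j by simp
  qed
  have 2: "wp w (cond 19 (blk clause_args ;; emit l) ;; blk [Op Add 16 16 11])
      ((1 + (length clause_args + 7 * l)) + length [Op Add 16 16 11]) Q g' m'"
    if i: "inv ?u1 g' m'" and "g' 17 = clause_addr (Suc j)" "g' 19 = ?cnt ?n"
      and fr: "\<forall>r\<in>{13, 14, 15, 16, 20, 21}. g' r = g r" for g' m'
  proof (rule wp_seq, rule wp_cond)
    \<comment> \<open>The count of satisfied literals is 0 iff the clause fails, so the conditional
      emits the second edge exactly when \<open>clause_edges\<close> has it.\<close>
    have "?cnt ?n = 0 \<longleftrightarrow> \<not> partial_sat s y (F ! j)"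
      by (auto simp: partial_sat_def filter_empty_conv)
    then have ce: "clause_edges k s F y j = (y, dummy j) # (if g' 19 = 0 then [] else [(y, cl j)])"
      using that(3) by (simp add: clause_edges_def)
    show "wp w (blk [Op Add 16 16 11]) (length [Op Add 16 16 11]) Q g' m'" if "g' 19 = 0"
      using i by (intro 1) (use ce that fr \<open>g' 17 = _\<close> in auto)
    show "wp w (blk clause_args ;; emit l) (length clause_args + 7 * l)
      (wp w (blk [Op Add 16 16 11]) (length [Op Add 16 16 11]) Q) g' m'" if ne: "g' 19 \<noteq> 0"
    proof (rule wp_blk_seq)
      let ?g = "g'(12 := 0, 9 := y, 10 := cl j)"
      have "wp w (emit l) (7 * l) (wp w (blk [Op Add 16 16 11]) (length [Op Add 16 16 11]) Q) ?g m'"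
      proof (rule wp_emit)
        show "inv ?u1 ?g m'" using i by simp
        show "?g 9 = y" "?g 10 = cl j" by auto
        show "length ?u1 < mx" using len by simp
        fix g2 m2 assume 3: "inv (?u1 @ [(y, cl j)]) g2 m2" "\<And>r. 10 \<le> r \<Longrightarrow> g2 r = ?g r"
        show "wp w (blk [Op Add 16 16 11]) (length [Op Add 16 16 11]) Q g2 m2"
        proof (rule 1)
          show "inv (us @ clause_edges k s F y j) g2 m2" using 3(1) ne by (simp add: ce)
          show "g2 17 = clause_addr (Suc j)" using 3(2)[of 17] \<open>g' 17 = _\<close> by simp
          show "\<forall>r\<in>{13, 14, 15, 16, 20, 21}. g2 r = g r" using fr by (simp add: 3(2))
        qed
      qed
      then show "blkpre w clause_args (wp w (emit l) (7 * l)
          (wp w (blk [Op Add 16 16 11]) (length [Op Add 16 16 11]) Q)) g' m'"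
        unfolding clause_args_def
        using inv_regs[OF i] fr g(1,2) nw j y word_gt(1) by simp
    qed
  qed
  have 3: "wp w (loop 18 (blk lit_code) ;; cond 19 (blk clause_args ;; emit l) ;; blk [Op Add 16 16 11])
      ((q * (length lit_code + 5) + 1) + ((1 + (length clause_args + 7 * l)) + length [Op Add 16 16 11])) Q g' m'"
    if i: "inv ?u1 g' m'" and g': "g' 17 = clause_addr j + 1" "g' 18 = ?n" "g' 19 = 0"
      and fr: "\<forall>r\<in>{13, 14, 15, 16, 20, 21}. g' r = g r" for g' m'
  proof (rule wp_seq)
    let ?I = "\<lambda>t g2 m2. inv ?u1 g2 m2 \<and> g2 17 = clause_addr j + 1 + t \<and> g2 19 = ?cnt t \<and>
        (\<forall>r\<in>{13, 14, 15, 16, 20, 21}. g2 r = g r)"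
    have "wp w (loop 18 (blk lit_code)) (?n * (length lit_code + 5) + 1)
        (\<lambda>g2 m2. ?I ?n g2 m2 \<and> g2 18 = 0) g' m'"
    proof (rule wp_loop[where I = ?I and n = "?n"])
      show "(18::nat) \<noteq> 2" "1 < (2::nat) ^ w" using word_gt(1) by simp_all
      show "?I 0 g' m'" "g' 18 = ?n" using that by auto
      fix t g2 m2 assume t: "t < ?n" and I: "?I t g2 m2" and "g2 18 = ?n - t"
      show "wp w (blk lit_code) (length lit_code)
          (\<lambda>g3 m3. g3 18 = ?n - t \<and> ?I (Suc t) (g3(18 := ?n - Suc t, 2 := 0)) m3) g2 m2"
      proof (rule wp_lit[OF conjunct1[OF I] j t])
        show "g2 17 = clause_addr j + 1 + t" "g2 19 = ?cnt t" using I by auto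
        show "g2 20 = y div 2 ^ s" "g2 21 = y mod 2 ^ s" using I g(4,5) by auto
        show "y < K" by (rule y)
        fix g3 assume "inv ?u1 g3 m2" "g3 17 = clause_addr j + 1 + Suc t" "g3 19 = ?cnt (Suc t)"
          and fr3: "\<forall>r\<in>{13, 14, 15, 16, 18, 20, 21}. g3 r = g2 r"
        then show "g3 18 = ?n - t \<and> ?I (Suc t) (g3(18 := ?n - Suc t, 2 := 0)) m2"
          using \<open>g2 18 = _\<close> I by simp
      qed
    qed
    then show "wp w (loop 18 (blk lit_code)) (q * (length lit_code + 5) + 1)
        (wp w (cond 19 (blk clause_args ;; emit l) ;; blk [Op Add 16 16 11])
         (1 + (length clause_args + 7 * l) + length [Op Add 16 16 11]) Q) g' m'"
    proof (rule wp_mono)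
      show "?n * (length lit_code + 5) + 1 \<le> q * (length lit_code + 5) + 1" using nq by simp
      fix g2 m2 assume "?I ?n g2 m2 \<and> g2 18 = 0"
      then show "wp w (cond 19 (blk clause_args ;; emit l) ;; blk [Op Add 16 16 11])
         (1 + (length clause_args + 7 * l) + length [Op Add 16 16 11]) Q g2 m2"
        by (intro 2) (use clause_addr_Suc[OF j] in auto)
    qed
  qed
  have 4: "wp w (blk clause_start ;; loop 18 (blk lit_code) ;; cond 19 (blk clause_args ;; emit l) ;; blk [Op Add 16 16 11])
      (length clause_start + ((q * (length lit_code + 5) + 1) +
        ((1 + (length clause_args + 7 * l)) + length [Op Add 16 16 11]))) Q g' m'"
    if i: "inv ?u1 g' m'" and g': "g' 17 = clause_addr j"
      and fr: "\<forall>r\<in>{13, 14, 15, 16, 20, 21}. g' r = g r" for g' m'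
  proof (rule wp_blk_seq)
    have a: "clause_addr j < B" and v: "m' (clause_addr j) = ?n"
      using clause_addr_nth(1,2)[OF j] inv_mem[OF i] by auto
    have "wp w (loop 18 (blk lit_code) ;; cond 19 (blk clause_args ;; emit l) ;; blk [Op Add 16 16 11])
      ((q * (length lit_code + 5) + 1) + ((1 + (length clause_args + 7 * l)) + length [Op Add 16 16 11])) Q
      (g'(19 := 0, 18 := ?n, 17 := clause_addr j + 1)) m'"
      by (rule 3) (use i fr in auto)
    then show "blkpre w clause_start (wp w (loop 18 (blk lit_code) ;;
        cond 19 (blk clause_args ;; emit l) ;; blk [Op Add 16 16 11])
      ((q * (length lit_code + 5) + 1) + ((1 + (length clause_args + 7 * l)) +
        length [Op Add 16 16 11])) Q) g' m'"
      unfolding clause_start_def using a v g' inv_regs[OF i] word_gt by simp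
  qed
  show ?thesis unfolding clause_code_def t_clause_def
  proof (rule wp_blk_seq)
    let ?g = "g(12 := 0, 9 := y, 10 := dummy j)"
    let ?c = "blk clause_start ;; loop 18 (blk lit_code) ;; cond 19 (blk clause_args ;; emit l) ;; blk [Op Add 16 16 11]"
    let ?t = "length clause_start + ((q * (length lit_code + 5) + 1) +
        ((1 + (length clause_args + 7 * l)) + length [Op Add 16 16 11]))"
    have "wp w (emit l ;; ?c) (7 * l + ?t) Q ?g m"
    proof (rule wp_emit_seq)
      show "inv us ?g m" using inv by simp
      show "?g 9 = y" "?g 10 = dummy j" by auto
      show "length us < mx" using len by simp
      fix g2 m2 assume 5: "inv ?u1 g2 m2" "\<And>r. 10 \<le> r \<Longrightarrow> g2 r = ?g r"
      show "wp w ?c ?t Q g2 m2"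
      proof (rule 4)
        show "inv ?u1 g2 m2" by (rule 5)
        show "g2 17 = clause_addr j" using 5(2)[of 17] g(3) by simp
        show "\<forall>r\<in>{13, 14, 15, 16, 20, 21}. g2 r = g r" by (simp add: 5(2))
      qed
    qed
    then show "blkpre w dummy_args (wp w (emit l ;; ?c) (7 * l + ?t) Q) g m"
      unfolding dummy_args_def using inv_regs[OF inv] g(1,2) nw j y word_gt(1) by simp
  qed
qed

definition t_vertex :: nat where
  "t_vertex = length hub_args + (7 * l + (length last_dummy_args + (7 * l + (length vertex_start +
     ((M * (t_clause + 5) + 1) + length [Op Add 14 14 11])))))"

lemma wp_vertex:
  assumes inv: "inv us g m" and y: "y < K" and g: "g 14 = y"
    and len: "length us + (2 + 2 * M) \<le> mx"
    and Q: "\<And>g' m'. inv (us @ vertex_edges k s F y) g' m' \<Longrightarrow> g' 14 = Suc y \<Longrightarrow> g' 13 = g 13 \<Longrightarrow> Q g' m'"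
  shows "wp w (vertex_code l) t_vertex Q g m"
proof -
  let ?u1 = "us @ [(y, hub (y div 2 ^ s))]"
  let ?u2 = "?u1 @ [(y, K + 2 * k + 3 * M)]"
  let ?ce = "clause_edges k s F y"
  have nw: "K + 2 * k + 3 * M + 5 < 2 ^ w" using word_gt(3) by (simp add: cnf_vertices_def)
  have yd: "y div 2 ^ s < k" by (rule block_less[OF y])
  have "y mod 2 ^ s \<le> y" by simp
  then have ym: "y mod 2 ^ s < 2 ^ w" using y nw by linarith
  have 1: "wp w (loop 15 (clause_code l) ;; blk [Op Add 14 14 11])
      ((M * (t_clause + 5) + 1) + length [Op Add 14 14 11]) Q g' m'"
    if i: "inv ?u2 g' m'" and g': "g' 14 = y" "g' 15 = M" "g' 16 = 0" "g' 17 = 2"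
      "g' 20 = y div 2 ^ s" "g' 21 = y mod 2 ^ s" "g' 13 = g 13" for g' m'
  proof (rule wp_seq)
    let ?I = "\<lambda>j g2 m2. inv (?u2 @ concat (map ?ce [0..<j])) g2 m2 \<and> g2 14 = y \<and> g2 16 = j \<and>
       g2 17 = clause_addr j \<and> g2 20 = y div 2 ^ s \<and> g2 21 = y mod 2 ^ s \<and> g2 13 = g 13"
    have "wp w (loop 15 (clause_code l)) (M * (t_clause + 5) + 1) (\<lambda>g2 m2. ?I M g2 m2 \<and> g2 15 = 0) g' m'"
    proof (rule wp_loop[where I = ?I and n = "M"])
      show "(15::nat) \<noteq> 2" "1 < (2::nat) ^ w" using word_gt(1) by simp_all
      show "?I 0 g' m'" "g' 15 = M" using that by (auto simp: clause_addr_0)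
      fix j g2 m2 assume j: "j < M" and I: "?I j g2 m2" and "g2 15 = M - j"
      have "length (concat (map ?ce [0..<j])) \<le> length [0..<j] * 2"
        by (rule length_concat_map_le) (simp add: clause_edges_def)
      then have len': "length (?u2 @ concat (map ?ce [0..<j])) + 2 \<le> mx"
        using len j unfolding length_append by simp
      show "wp w (clause_code l) t_clause
          (\<lambda>g3 m3. g3 15 = M - j \<and> ?I (Suc j) (g3(15 := M - Suc j, 2 := 0)) m3) g2 m2"
      proof (rule wp_clause[OF conjunct1[OF I] j y _ _ _ _ _ len'])
        fix g3 m3 assume "inv ((?u2 @ concat (map ?ce [0..<j])) @ ?ce j) g3 m3" "g3 16 = Suc j"
          "g3 17 = clause_addr (Suc j)" and fr: "\<forall>r\<in>{13, 14, 15, 20, 21}. g3 r = g2 r"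
        then show "g3 15 = M - j \<and> ?I (Suc j) (g3(15 := M - Suc j, 2 := 0)) m3"
          using I \<open>g2 15 = _\<close> by simp
      qed (use I in auto)
    qed
    then show "wp w (loop 15 (clause_code l)) (M * (t_clause + 5) + 1)
        (wp w (blk [Op Add 14 14 11]) (length [Op Add 14 14 11]) Q) g' m'"
    proof (rule wp_mono)
      fix g2 m2 assume *: "?I M g2 m2 \<and> g2 15 = 0"
      then have i2: "inv (us @ vertex_edges k s F y) g2 m2" by (simp add: vertex_edges_def)
      have "Q (g2(14 := Suc y)) m2" by (rule Q) (use * i2 in auto)
      then show "wp w (blk [Op Add 14 14 11]) (length [Op Add 14 14 11]) Q g2 m2"
        by (intro wp_blk) (use * inv_regs[OF i2] nw y in simp)
    qed simp
  qed
  show ?thesis unfolding vertex_code_def t_vertex_def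
  proof (rule wp_blk_seq)
    let ?l = "loop 15 (clause_code l) ;; blk [Op Add 14 14 11]"
    let ?tl = "(M * (t_clause + 5) + 1) + length [Op Add 14 14 11]"
    let ?c = "blk last_dummy_args ;; emit l ;; blk vertex_start ;; ?l"
    let ?t = "length last_dummy_args + (7 * l + (length vertex_start + ?tl))"
    let ?g = "g(20 := y div 2 ^ s, 21 := y mod 2 ^ s, 12 := 0, 9 := y, 10 := hub (y div 2 ^ s))"
    have "wp w (emit l ;; ?c) (7 * l + ?t) Q ?g m"
    proof (rule wp_emit_seq)
      show "inv us ?g m" using inv by simp
      show "?g 9 = y" "?g 10 = hub (y div 2 ^ s)" by auto
      show "length us < mx" using len by simp
      fix g2 m2 assume 2: "inv ?u1 g2 m2" "\<And>r. 10 \<le> r \<Longrightarrow> g2 r = ?g r"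
      have g2: "g2 14 = y" "g2 20 = y div 2 ^ s" "g2 21 = y mod 2 ^ s" "g2 13 = g 13"
        using 2(2)[of 14] 2(2)[of 20] 2(2)[of 21] 2(2)[of 13] g by auto
      show "wp w ?c ?t Q g2 m2"
      proof (rule wp_blk_seq)
        let ?g2 = "g2(12 := 0, 9 := y, 10 := K + 2 * k + 3 * M)"
        have "wp w (emit l ;; blk vertex_start ;; ?l) (7 * l + (length vertex_start + ?tl)) Q ?g2 m2"
        proof (rule wp_emit_seq)
          show "inv ?u1 ?g2 m2" using 2(1) by simp
          show "?g2 9 = y" "?g2 10 = K + 2 * k + 3 * M" by auto
          show "length ?u1 < mx" using len by simp
          fix g3 m3 assume 3: "inv ?u2 g3 m3" "\<And>r. 10 \<le> r \<Longrightarrow> g3 r = ?g2 r"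
          show "wp w (blk vertex_start ;; ?l) (length vertex_start + ?tl) Q g3 m3"
          proof (rule wp_blk_seq)
            have "wp w ?l ?tl Q (g3(16 := 0, 15 := M, 17 := 2)) m3"
              by (rule 1) (use 3(1) 3(2)[of 14] 3(2)[of 20] 3(2)[of 21] 3(2)[of 13] g2 in auto)
            then show "blkpre w vertex_start (wp w ?l ?tl Q) g3 m3"
              unfolding vertex_start_def using inv_regs[OF 3(1)] nw word_gt(1) by simp
          qed
        qed
        then show "blkpre w last_dummy_args (wp w (emit l ;; blk vertex_start ;; ?l)
            (7 * l + (length vertex_start + ?tl)) Q) g2 m2"
          unfolding last_dummy_args_def using inv_regs[OF 2(1)] g2 nw y word_gt(1) by simp
      qed
    qed
    then show "blkpre w hub_args (wp w (emit l ;; ?c) (7 * l + ?t) Q) g m"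
      unfolding hub_args_def
      using inv_regs[OF inv] g nw y word_gt(1) yd ym by simp
  qed
qed

lemma wp_pin:
  assumes inv: "inv us g m" and g: "g 14 = i" and i: "i < k" and len: "length us < mx"
    and Q: "\<And>g' m'. inv (us @ [(hub i, pin i)]) g' m' \<Longrightarrow> g' 14 = Suc i \<Longrightarrow> g' 13 = g 13 \<Longrightarrow> Q g' m'"
  shows "wp w (pin_code l) (2 + (7 * l + 1)) Q g m"
proof -
  let ?g = "g(9 := hub i, 10 := pin i)"
  have nw: "K + 2 * k + 3 * M + 5 < 2 ^ w" using word_gt(3) by (simp add: cnf_vertices_def)
  have "wp w (emit l ;; blk [Op Add 14 14 11]) (7 * l + length [Op Add 14 14 11]) Q ?g m"
  proof (rule wp_emit_seq)
    show "inv us ?g m" using inv by simp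
    show "?g 9 = hub i" "?g 10 = pin i" by auto
    fix g2 m2 assume 2: "inv (us @ [(hub i, pin i)]) g2 m2" "\<And>r. 10 \<le> r \<Longrightarrow> g2 r = ?g r"
    have "Q (g2(14 := Suc i)) m2" by (rule Q) (use 2(1) 2(2)[of 13] in auto)
    then show "wp w (blk [Op Add 14 14 11]) (length [Op Add 14 14 11]) Q g2 m2"
      by (intro wp_blk) (use 2(2)[of 14] g inv_regs[OF 2(1)] nw i in simp)
  qed (rule len)
  then have "blkpre w [Op Add 9 6 14, Op Add 10 29 14]
      (wp w (emit l ;; blk [Op Add 14 14 11]) (7 * l + length [Op Add 14 14 11]) Q) g m"
    using inv_regs[OF inv] g i nw by simp
  from wp_blk_seq[OF this] show ?thesis by (simp add: pin_code_def)
qed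

lemma wp_clpin:
  assumes inv: "inv us g m" and g: "g 14 = j" and j: "j < M" and len: "length us < mx"
    and Q: "\<And>g' m'. inv (us @ [(cl j, clpin j)]) g' m' \<Longrightarrow> g' 14 = Suc j \<Longrightarrow> g' 13 = g 13 \<Longrightarrow> Q g' m'"
  shows "wp w (clpin_code l) (2 + (7 * l + 1)) Q g m"
proof -
  let ?g = "g(9 := cl j, 10 := clpin j)"
  have nw: "K + 2 * k + 3 * M + 5 < 2 ^ w" using word_gt(3) by (simp add: cnf_vertices_def)
  have "wp w (emit l ;; blk [Op Add 14 14 11]) (7 * l + length [Op Add 14 14 11]) Q ?g m"
  proof (rule wp_emit_seq)
    show "inv us ?g m" using inv by simp
    show "?g 9 = cl j" "?g 10 = clpin j" by auto
    fix g2 m2 assume 2: "inv (us @ [(cl j, clpin j)]) g2 m2" "\<And>r. 10 \<le> r \<Longrightarrow> g2 r = ?g r"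
    have "Q (g2(14 := Suc j)) m2" by (rule Q) (use 2(1) 2(2)[of 13] in auto)
    then show "wp w (blk [Op Add 14 14 11]) (length [Op Add 14 14 11]) Q g2 m2"
      by (intro wp_blk) (use 2(2)[of 14] g inv_regs[OF 2(1)] nw j in simp)
  qed (rule len)
  then have "blkpre w [Op Add 9 25 14, Op Add 10 26 14]
      (wp w (emit l ;; blk [Op Add 14 14 11]) (7 * l + length [Op Add 14 14 11]) Q) g m"
    using inv_regs[OF inv] g j nw by simp
  from wp_blk_seq[OF this] show ?thesis by (simp add: clpin_code_def)
qed

section \<open>Assembling the construction\<close>

definition t_build :: nat where
  "t_build = length (start_code k) + ((k * (2 + (7 * l + 1) + 5) + 1) + (2 +
    ((M * (2 + (7 * l + 1) + 5) + 1) + (2 + ((K * (t_vertex + 5) + 1) + length end_code)))))"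

definition graph_code :: "nat list" where
  "graph_code = encode_graph (n + (l - 1) * length es) (subdivide l n es)"

text \<open>The hand-over condition of \<open>runs_simulation\<close>, including zeros in the cells
  behind the graph.\<close>

definition built :: "(nat \<Rightarrow> nat) \<Rightarrow> (nat \<Rightarrow> nat) \<Rightarrow> bool" where
  "built g m \<longleftrightarrow> g 0 = B \<and> g 50 = length graph_code \<and> (\<forall>r>50. g r = 0) \<and>
     (\<forall>a. m (B + a) = (if a < length graph_code then graph_code ! a else 0))"

lemma length_graph_code: "length graph_code = 2 + 2 * (l * length es)"
  using length_flat[of "subdivide l n es"]
  by (simp add: graph_code_def encode_graph_def length_subdivide flip: flat_def)

lemma graph_code_nth:
  "graph_code ! 0 = n + (l - 1) * length es" "graph_code ! 1 = l * length es"
  "graph_code ! (2 + a) = flat (subdivide l n es) ! a"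
  by (simp_all add: graph_code_def encode_graph_def length_subdivide flip: flat_def)

lemma wp_end:
  assumes inv: "inv es g m"
  shows "wp w (blk end_code) (length end_code) built g m"
proof (rule wp_blk)
  let ?fl = "flat (subdivide l n es)"
  let ?g = "g(12 := B + 1, 50 := 2 + 2 * (l * length es), 22 := 2, 30 := l * length es)"
  let ?m = "m(B := n + (l - 1) * length es, B + 1 := l * length es)"
  have m: "m = upd_list (mem (init_state xs)) (B + 2) ?fl" using inv by (simp add: inv_def)
  have lfl: "length ?fl = 2 * (l * length es)" by (simp add: length_subdivide)
  have "?m (B + a) = (if a < length graph_code then graph_code ! a else 0)" for a
  proof -
    consider "a = 0" | "a = 1" | b where "a = 2 + b" by (metis One_nat_def Suc_1 add_2_eq_Suc not0_implies_Suc)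
    then show ?thesis
    proof cases
      case 3
      have "m (B + a) = (if b < length ?fl then ?fl ! b else 0)"
        unfolding m 3 by (simp add: upd_list_def init_state_def del: length_flat)
      then show ?thesis using 3 graph_code_nth(3)[of b] lfl by (simp add: length_graph_code)
    qed (use graph_code_nth(1,2) length_graph_code in simp_all)
  qed
  moreover have "\<forall>r\<ge>50. g r = 0" using inv by (simp add: inv_def)
  ultimately have "built ?g ?m" using inv_regs[OF inv] by (simp add: built_def length_graph_code)
  moreover have "3 * (l * length es) \<le> 3 * l * mx" using length_es(2) by simp
  then have "2 + 2 * (l * length es) < 2 ^ w" "B + 1 < 2 ^ w" "2 < (2::nat) ^ w" "l * length es < 2 ^ w"
    "1 + l * length es < 2 ^ w"
    using big by linarith+
  moreover have "g 7 = B + 2 + 2 * (l * length es)" "g 8 = n + (l - 1) * length es"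
    using inv by (simp_all add: inv_def)
  ultimately show "blkpre w end_code built g m"
    unfolding end_code_def using inv_regs[OF inv] by (simp add: fun_upd_twist)
qed

lemma wp_build:
  "wp w (build_code k l) t_build built (reg (init_state xs)) (mem (init_state xs))"
proof -
  \<comment> \<open>The prefixes of \<open>es\<close> present after some rounds of the three loops.
    The loops are verified from the last one backwards, each with the remaining code as its
    continuation.\<close>
  let ?E1 = "\<lambda>i. map (\<lambda>i. (hub i, pin i)) [0..<i]"
  let ?E2 = "\<lambda>j. ?E1 k @ map (\<lambda>j. (cl j, clpin j)) [0..<j]"
  let ?E3 = "\<lambda>y. ?E2 M @ concat (map (vertex_edges k s F) [0..<y])"
  have es: "es = ?E3 K" by (simp add: cnf_edges_def)
  have nw: "K + 2 * k + 3 * M + 5 < 2 ^ w" using word_gt(3) by (simp add: cnf_vertices_def)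
  let ?c3 = "loop 13 (vertex_code l) ;; blk end_code"
  let ?t3 = "(K * (t_vertex + 5) + 1) + length end_code"
  have 3: "wp w ?c3 ?t3 built g m" if "inv (?E2 M) g m" "g 13 = K" "g 14 = 0" for g m
  proof (rule wp_seq)
    let ?I = "\<lambda>y g m. inv (?E3 y) g m \<and> g 14 = y"
    have "wp w (loop 13 (vertex_code l)) (K * (t_vertex + 5) + 1) (\<lambda>g m. ?I K g m \<and> g 13 = 0) g m"
    proof (rule wp_loop[where I = ?I and n = "K"])
      show "(13::nat) \<noteq> 2" "1 < (2::nat) ^ w" using word_gt(1) by simp_all
      show "?I 0 g m" "g 13 = K" using that by simp_all
      fix y g m assume y: "y < K" and I: "?I y g m" and "g 13 = K - y"
      have "length (concat (map (clause_edges k s F z) [0..<M])) \<le> length [0..<M] * 2" for z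
        by (rule length_concat_map_le) (simp add: clause_edges_def)
      then have "length (vertex_edges k s F z) \<le> 2 + 2 * M" for z
        by (simp add: vertex_edges_def mult.commute)
      from length_concat_map_le[of "vertex_edges k s F", OF this, of "[0..<y]"]
      have "length (?E3 y) + (2 + 2 * M) \<le> k + M + Suc y * (2 + 2 * M)" by simp
      also have "\<dots> \<le> mx" using y by (intro add_left_mono mult_le_mono1) simp
      finally have len: "length (?E3 y) + (2 + 2 * M) \<le> mx" .
      show "wp w (vertex_code l) t_vertex
          (\<lambda>g' m'. g' 13 = K - y \<and> ?I (Suc y) (g'(13 := K - Suc y, 2 := 0)) m') g m"
        by (rule wp_vertex[OF conjunct1[OF I] y conjunct2[OF I] len]) (use \<open>g 13 = _\<close> in simp)
    qed
    then show "wp w (loop 13 (vertex_code l)) (K * (t_vertex + 5) + 1)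
        (wp w (blk end_code) (length end_code) built) g m"
      by (rule wp_mono) (use wp_end es in auto)
  qed
  let ?b2 = "blk [Const 14 0, Op Add 13 14 6]"
  let ?c2 = "loop 13 (clpin_code l) ;; ?b2 ;; ?c3"
  let ?t2 = "(M * (2 + (7 * l + 1) + 5) + 1) + (2 + ?t3)"
  have 2: "wp w ?c2 ?t2 built g m" if "inv (?E1 k) g m" "g 13 = M" "g 14 = 0" for g m
  proof (rule wp_seq)
    let ?I = "\<lambda>j g m. inv (?E2 j) g m \<and> g 14 = j"
    have "wp w (loop 13 (clpin_code l)) (M * (2 + (7 * l + 1) + 5) + 1) (\<lambda>g m. ?I M g m \<and> g 13 = 0) g m"
    proof (rule wp_loop[where I = ?I and n = "M"])
      show "(13::nat) \<noteq> 2" "1 < (2::nat) ^ w" using word_gt(1) by simp_all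
      show "?I 0 g m" "g 13 = M" using that by simp_all
      fix j g m assume j: "j < M" and I: "?I j g m" and "g 13 = M - j"
      have len: "length (?E2 j) < mx" using j by simp
      show "wp w (clpin_code l) (2 + (7 * l + 1))
          (\<lambda>g' m'. g' 13 = M - j \<and> ?I (Suc j) (g'(13 := M - Suc j, 2 := 0)) m') g m"
        by (rule wp_clpin[OF conjunct1[OF I] conjunct2[OF I] j len]) (use \<open>g 13 = _\<close> in simp)
    qed
    then show "wp w (loop 13 (clpin_code l)) (M * (2 + (7 * l + 1) + 5) + 1)
        (wp w (?b2 ;; ?c3) (2 + ?t3) built) g m"
    proof (rule wp_mono)
      fix g m assume I: "?I M g m \<and> g 13 = 0"
      have "wp w ?c3 ?t3 built (g(14 := 0, 13 := K)) m" by (rule 3) (use I in simp_all)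
      then have "blkpre w [Const 14 0, Op Add 13 14 6] (wp w ?c3 ?t3 built) g m"
        using inv_regs[OF conjunct1[OF conjunct1[OF I]]] nw by simp
      from wp_blk_seq[OF this] show "wp w (?b2 ;; ?c3) (2 + ?t3) built g m"
        by (simp add: numeral_2_eq_2)
    qed simp
  qed
  let ?b1 = "blk [Const 14 0, Op Add 13 14 3]"
  let ?c1 = "loop 13 (pin_code l) ;; ?b1 ;; ?c2"
  let ?t1 = "(k * (2 + (7 * l + 1) + 5) + 1) + (2 + ?t2)"
  have 1: "wp w ?c1 ?t1 built g m" if "inv [] g m" "g 13 = k" "g 14 = 0" for g m
  proof (rule wp_seq)
    let ?I = "\<lambda>j g m. inv (?E1 j) g m \<and> g 14 = j"
    have "wp w (loop 13 (pin_code l)) (k * (2 + (7 * l + 1) + 5) + 1) (\<lambda>g m. ?I k g m \<and> g 13 = 0) g m"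
    proof (rule wp_loop[where I = ?I and n = "k"])
      show "(13::nat) \<noteq> 2" "1 < (2::nat) ^ w" using word_gt(1) by simp_all
      show "?I 0 g m" "g 13 = k" using that by simp_all
      fix j g m assume j: "j < k" and I: "?I j g m" and "g 13 = k - j"
      have len: "length (?E1 j) < mx" using j by simp
      show "wp w (pin_code l) (2 + (7 * l + 1))
          (\<lambda>g' m'. g' 13 = k - j \<and> ?I (Suc j) (g'(13 := k - Suc j, 2 := 0)) m') g m"
        by (rule wp_pin[OF conjunct1[OF I] conjunct2[OF I] j len]) (use \<open>g 13 = _\<close> in simp)
    qed
    then show "wp w (loop 13 (pin_code l)) (k * (2 + (7 * l + 1) + 5) + 1)
        (wp w (?b1 ;; ?c2) (2 + ?t2) built) g m"
    proof (rule wp_mono)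
      fix g m assume I: "?I k g m \<and> g 13 = 0"
      have "wp w ?c2 ?t2 built (g(14 := 0, 13 := M)) m" by (rule 2) (use I in simp_all)
      then have "blkpre w [Const 14 0, Op Add 13 14 3] (wp w ?c2 ?t2 built) g m"
        using inv_regs[OF conjunct1[OF conjunct1[OF I]]] nw by simp
      from wp_blk_seq[OF this] show "wp w (?b1 ;; ?c2) (2 + ?t2) built g m"
        by (simp add: numeral_2_eq_2)
    qed simp
  qed
  show ?thesis unfolding build_code_def t_build_def
  proof (rule wp_blk_seq)
    let ?ini = "reg (init_state xs)" let ?m = "mem (init_state xs)"
    let ?g = "?ini(11 := 1, 12 := N, 3 := M, 1 := k, 4 := s, 5 := 2 ^ s, 6 := K, 29 := K + k,
      25 := K + 2 * k, 26 := K + 2 * k + M, 27 := K + 2 * k + 2 * M, 28 := K + 2 * k + 3 * M,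
      8 := n, 7 := B + 2, 14 := 0, 13 := k)"
    have m01: "?m 0 = N" "?m 1 = M" using B_ge by (auto simp: init_state_def)
    have g0: "?ini 0 = B" "\<And>r. 0 < r \<Longrightarrow> ?ini r = 0" by (auto simp: init_state_def)
    have "inv [] ?g ?m" using g0 by (auto simp: inv_def subdivide_def upd_list_def fun_eq_iff)
    then have fin: "wp w ?c1 ?t1 built ?g ?m" by (rule 1) simp_all
    have eqs: "N div k + 1 = s" "push_bit s (1::nat) = 2 ^ s" "K + k + k = K + 2 * k"
      "K + 2 * k + M + M = K + 2 * k + 2 * M" "K + 2 * k + 2 * M + M = K + 2 * k + 3 * M"
      "K + 2 * k + 3 * M + 1 = n" "B + 1 + 1 = B + 2" "0 + k = k"
      by (simp_all add: s_def push_bit_eq_mult cnf_vertices_def)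
    have "(2::nat) ^ s \<le> K" using k by simp
    moreover have "N div k \<le> N" by simp
    moreover have "s \<le> N + 1" by (simp add: s_def)
    ultimately have bnds: "1 < (2::nat) ^ w" "0 < (2::nat) ^ w" "k < 2 ^ w" "N div k < 2 ^ w" "s < 2 ^ w"
      "2 ^ s < (2::nat) ^ w" "K < 2 ^ w" "K + k < 2 ^ w" "K + 2 * k < 2 ^ w" "K + 2 * k + M < 2 ^ w"
      "K + 2 * k + 2 * M < 2 ^ w" "K + 2 * k + 3 * M < 2 ^ w" "n < 2 ^ w" "B + 1 < 2 ^ w" "B + 2 < 2 ^ w"
      using nw word_gt big by linarith+
    show "blkpre w (start_code k) (wp w ?c1 ?t1 built) ?ini ?m"
      unfolding start_code_def using fin bnds
      by (simp only: blkpre.simps ipre.simps apply_binop.simps fun_upd_apply eqs g0(1) m01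
        if_True if_False rel_simps num.distinct num.inject numeral_eq_iff one_eq_numeral_iff
        numeral_eq_one_iff zero_neq_numeral numeral_neq_zero zero_neq_one one_neq_zero simp_thms)
        (simp add: fun_upd_twist)
  qed
qed

end

section \<open>The reduction\<close>

text \<open>As the logarithm is at least 1, raising the constant factor by \<open>d\<close> gains
  \<open>d\<close> bits. A simulation that needs a constant number of extra bits thus stays within
  the model.\<close>

lemma word_size_add:
  assumes "2 \<le> n"
  shows "word_size c n + d \<le> word_size (c + d) n"
proof -
  have "1 \<le> log 2 (real n)" using assms by (simp add: le_log_iff)
  then have "real d * 1 \<le> real d * log 2 (real n)" by (intro mult_left_mono) auto
  then have "real c * log 2 (real n) + real d \<le> real (c + d) * log 2 (real n)"
    by (simp add: algebra_simps)
  then have "\<lceil>real c * log 2 (real n) + real d\<rceil> \<le> \<lceil>real (c + d) * log 2 (real n)\<rceil>"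
    by (rule ceiling_mono)
  moreover have "\<lceil>real c * log 2 (real n) + real d\<rceil> = \<lceil>real c * log 2 (real n)\<rceil> + int d"
    by (metis ceiling_add_of_int of_int_of_nat_eq)
  moreover have "0 \<le> real c * log 2 (real n)" using \<open>1 \<le> log 2 (real n)\<close> by simp
  then have "0 \<le> \<lceil>real c * log 2 (real n)\<rceil>" using ceiling_mono by fastforce
  ultimately show ?thesis unfolding word_size_def by linarith
qed

lemma word_size_le:
  assumes "1 \<le> n" "n \<le> 2 ^ e"
  shows "word_size c n \<le> c * e"
proof -
  have "log 2 (real n) \<le> real e"
    using assms by (simp add: log_le_iff powr_realpow flip: of_nat_power)
  then have "real c * log 2 (real n) \<le> real (c * e)" by (simp add: mult_left_mono)
  then have "\<lceil>real c * log 2 (real n)\<rceil> \<le> int (c * e)" by (metis ceiling_le_iff of_int_of_nat_eq)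
  then show ?thesis unfolding word_size_def by linarith
qed

section \<open>Distinguishing by rounding an approximation\<close>

text \<open>Since \<open>1 - (1 - (3 * l * d - x))\<close> (with truncated subtraction) decides \<open>x / d < 3 * l\<close>, and
  is 0 if \<open>d = 0\<close>, rounding the approximation takes a constant number of instructions.\<close>

lemma approximation_distinguishes:
  assumes appr: "approximates_in_time k \<alpha> \<beta> T" and k: "2 \<le> k" and l: "1 \<le> l"
    and \<alpha>: "0 \<le> \<alpha>" and gap: "\<alpha> * real (2 * l) + \<beta> < real (3 * l)"
  shows "distinguishes_in_time k (2 * l) (3 * l) (\<lambda>m. 2 * T m + 9)"
proof -
  obtain P c where P: "\<And>n es. input_graph n es \<Longrightarrow> k \<le> n \<Longrightarrow>
      runs P (word_size c n) (encode_graph n es) (T (length es))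
        (\<lambda>s. is_approx \<alpha> \<beta> (k_radius k {..<n} (edge_set es)) (output_value s))"
    using appr unfolding approximates_in_time_def by blast
  \<comment> \<open>The graph is already in place, so the simulation runs at base address 0 and only
    the length of the input has to be moved.\<close>
  let ?pre = "blk [Const 1 0, Op Add 50 0 1, Const 0 0]"
  let ?post = "blk [Const 1 (3 * l), Op Mul 2 1 51, Op Sub 2 2 50, Const 1 1, Op Sub 2 1 2, Op Sub 0 1 2]"
  \<comment> \<open>Since \<open>3 * l < 2 ^ (3 * l)\<close>, this many extra bits make room for the
    product of \<open>3 * l\<close> and the denominator.\<close>
  let ?d = "3 * l"
  \<comment> \<open>\<open>R\<close> is the answer demanded by the promise: all admissible outputs
    lie on the same side of \<open>3 * l\<close>.\<close>
  have *: "runs ((?pre ;; simcode P ;; ?post) 0) (word_size (c + ?d) n) (encode_graph n es)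
      (2 * T (length es) + 9) (\<lambda>s. reg s 0 = of_bool R)"
    if g: "input_graph n es" "k \<le> n"
      and R: "\<And>x. is_approx \<alpha> \<beta> (k_radius k {..<n} (edge_set es)) x \<Longrightarrow> R \<longleftrightarrow> x < ereal (real (3 * l))"
    for n es R
  proof -
    let ?w = "word_size c n" let ?w' = "word_size (c + ?d) n"
    let ?ys = "encode_graph n es"
    have w: "?w + ?d \<le> ?w'" using word_size_add[of n c ?d] g(2) k by simp
    have w2: "(2::nat) ^ ?w \<le> 2 ^ ?w'" "3 * l * 2 ^ ?w \<le> (2::nat) ^ ?w'" "3 * l < (2::nat) ^ ?w'"
    proof -
      have "3 * l < (2::nat) ^ ?d" by (rule less_exp)
      then have "3 * l * 2 ^ ?w \<le> (2::nat) ^ ?d * 2 ^ ?w" by (intro mult_le_mono1) simp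
      also have "\<dots> = 2 ^ (?w + ?d)" by (simp add: power_add)
      also have "\<dots> \<le> 2 ^ ?w'" using w by (intro power_increasing) auto
      finally show "3 * l * 2 ^ ?w \<le> (2::nat) ^ ?w'" .
      show "(2::nat) ^ ?w \<le> 2 ^ ?w'" using w by (intro power_increasing) auto
      have "(2::nat) ^ ?d \<le> 2 ^ ?w'" using w by (intro power_increasing) auto
      then show "3 * l < (2::nat) ^ ?w'" using \<open>3 * l < 2 ^ ?d\<close> by linarith
    qed
    note run = P[OF g]
    have f: "fits ?w (init_state ?ys)" using run unfolding runs_def by fastforce
    then have f': "fits ?w' (init_state ?ys)" using w2(1) unfolding fits_def by (meson less_le_trans)
    have "runs ((?pre ;; simcode P ;; ?post) 0) ?w' ?ys (3 + 2 * T (length es) + 6)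
        (\<lambda>s. reg s 0 = of_bool R)"
    proof (rule runs_simulation[where Q' = "\<lambda>x. x = of_bool R" and B = 0, OF _ f' run])
      have "wp ?w' ?pre (length [Const 1 0, Op Add 50 0 1, Const 0 0])
          (\<lambda>g m. g 0 = 0 \<and> g 50 = length ?ys \<and> (\<forall>r>50. g r = 0) \<and>
          (\<forall>a. m (0 + a) = (if a < length ?ys then ?ys ! a else 0)))
          (reg (init_state ?ys)) (mem (init_state ?ys))"
        using f' by (intro wp_blk) (auto simp: fits_def init_state_def split: if_splits)
      then show "wp ?w' ?pre 3
          (\<lambda>g m. g 0 = 0 \<and> g 50 = length ?ys \<and> (\<forall>r>50. g r = 0) \<and>
          (\<forall>a. m (0 + a) = (if a < length ?ys then ?ys ! a else 0)))
          (reg (init_state ?ys)) (mem (init_state ?ys))" by (rule wp_mono) simp_all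
      show "2 ^ ?w + 0 \<le> (2::nat) ^ ?w'" using w2(1) by simp
      fix s g m
      assume ap: "is_approx \<alpha> \<beta> (k_radius k {..<n} (edge_set es)) (output_value s)"
        and fs: "fits ?w s" and gr: "\<And>r. g (r + 50) = reg s r"
      have g: "g 50 = reg s 0" "g 51 = reg s 1" using gr[of 0] gr[of 1] by simp_all
      have lt: "reg s 0 < 2 ^ ?w" "reg s 1 < 2 ^ ?w" using fs by (auto simp: fits_def)
      have mul: "3 * l * reg s 1 < 2 ^ ?w'"
      proof -
        have "3 * l * reg s 1 < 3 * l * 2 ^ ?w" using lt(2) l by simp
        then show ?thesis using w2(2) by linarith
      qed
      have "R \<longleftrightarrow> output_value s < ereal (real (3 * l))" by (rule R[OF ap])
      also have "\<dots> \<longleftrightarrow> 0 < 3 * l * reg s 1 - reg s 0"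
      proof (cases "reg s 1 = 0")
        case False
        then have "output_value s < ereal (real (3 * l)) \<longleftrightarrow> real (reg s 0) < real (3 * l) * real (reg s 1)"
          by (simp add: output_value_def divide_less_eq)
        also have "\<dots> \<longleftrightarrow> reg s 0 < 3 * l * reg s 1" by (metis of_nat_less_iff of_nat_mult)
        finally show ?thesis by simp
      qed (simp add: output_value_def)
      finally have "Suc 0 - (Suc 0 - (3 * l * reg s 1 - reg s 0)) = of_bool R" by auto
      moreover have "Suc 0 < 2 ^ ?w'" using w2(3) l by linarith
      ultimately have "wp ?w' ?post (length [Const 1 (3 * l), Op Mul 2 1 51, Op Sub 2 2 50, Const 1 1,
          Op Sub 2 1 2, Op Sub 0 1 2]) (\<lambda>g m. g 0 = of_bool R) g m"
        using w2(3) mul by (intro wp_blk) (auto simp: g)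
      then show "wp ?w' ?post 6 (\<lambda>g m. g 0 = of_bool R) g m" by (rule wp_mono) simp_all
    qed
    then show ?thesis by (rule runs_mono) simp
  qed
  show ?thesis unfolding distinguishes_in_time_def
  proof (intro exI[of _ "(?pre ;; simcode P ;; ?post) 0"] exI[of _ "c + ?d"] allI impI conjI; elim conjE)
    fix n es
    assume g: "input_graph n es" "k \<le> n"
    let ?R = "k_radius k {..<n} (edge_set es)"
    {
      assume "?R \<le> enat (2 * l)"
      then obtain r where r: "?R = enat r" "r \<le> 2 * l" by (cases ?R) auto
      have "x < ereal (real (3 * l))" if "is_approx \<alpha> \<beta> ?R x" for x
      proof -
        have "\<alpha> * real r \<le> \<alpha> * real (2 * l)" using r(2) \<alpha> by (intro mult_left_mono) auto
        then have "ereal (\<alpha> * real r + \<beta>) < ereal (real (3 * l))" using gap by simp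
        moreover have "x \<le> ereal (\<alpha> * real r + \<beta>)" using that r(1) by (simp add: is_approx_def)
        ultimately show ?thesis by (rule le_less_trans[rotated])
      qed
      then show "runs ((?pre ;; simcode P ;; ?post) 0) (word_size (c + ?d) n) (encode_graph n es)
        (2 * T (length es) + 9) (\<lambda>s. reg s 0 = 1)" using *[OF g, of True] by simp
    next
      assume "enat (3 * l) \<le> ?R"
      then have "ereal_of_enat (enat (3 * l)) \<le> ereal_of_enat ?R" by (simp only: ereal_of_enat_le_iff)
      then have "\<not> x < ereal (real (3 * l))" if "is_approx \<alpha> \<beta> ?R x" for x
        using that by (auto simp: is_approx_def)
      then show "runs ((?pre ;; simcode P ;; ?post) 0) (word_size (c + ?d) n) (encode_graph n es)
        (2 * T (length es) + 9) (\<lambda>s. reg s 0 = 0)" using *[OF g, of False] by simp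
    }
  qed
qed

section \<open>Size bounds in the number of variables\<close>

definition exp_bounded :: "(nat \<Rightarrow> nat) \<Rightarrow> bool" where
  "exp_bounded f \<longleftrightarrow> (\<exists>C. \<forall>N. f N \<le> 2 ^ (C * (N + 1)))"

lemma exp_bounded_const: "exp_bounded (\<lambda>_. c)"
proof -
  have "c \<le> 2 ^ (c * (N + 1))" for N
  proof -
    have "(2::nat) ^ c \<le> 2 ^ (c * (N + 1))" by (intro power_increasing) auto
    then show ?thesis using less_exp[of c] by linarith
  qed
  then show ?thesis unfolding exp_bounded_def by blast
qed

lemma exp_bounded_id: "exp_bounded (\<lambda>N. N)"
proof -
  have "N \<le> 2 ^ (1 * (N + 1))" for N using less_exp[of "N + 1"] by simp
  then show ?thesis unfolding exp_bounded_def by blast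
qed

lemma exp_bounded_mult:
  assumes "exp_bounded f" "exp_bounded g"
  shows "exp_bounded (\<lambda>N. f N * g N)"
proof -
  obtain a b where "\<And>N. f N \<le> 2 ^ (a * (N + 1))" "\<And>N. g N \<le> 2 ^ (b * (N + 1))"
    using assms unfolding exp_bounded_def by blast
  then have "f N * g N \<le> 2 ^ ((a + b) * (N + 1))" for N
    unfolding add_mult_distrib power_add by (intro mult_le_mono)
  then show ?thesis unfolding exp_bounded_def by blast
qed

text \<open>Reduced to products by \<open>f N + g N \<le> (f N + 1) * (g N + 1)\<close>; adding 1
  costs at most a doubling.\<close>

lemma exp_bounded_add:
  assumes "exp_bounded f" "exp_bounded g"
  shows "exp_bounded (\<lambda>N. f N + g N)"
proof -
  have "exp_bounded (\<lambda>N. (f N + 1) * (g N + 1))"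
  proof -
    have "exp_bounded (\<lambda>N. h N + 1)" if h: "exp_bounded h" for h
    proof -
      obtain a where a: "\<And>N. h N \<le> 2 ^ (a * (N + 1))" using h unfolding exp_bounded_def by blast
      have "h N + 1 \<le> 2 ^ ((a + 1) * (N + 1))" for N
      proof -
        have "h N + 1 \<le> 2 ^ (a * (N + 1)) + 2 ^ (a * (N + 1))" using a[of N] by (intro add_mono) auto
        also have "\<dots> = 2 ^ (a * (N + 1) + 1)" by simp
        also have "\<dots> \<le> 2 ^ ((a + 1) * (N + 1))" by (intro power_increasing) auto
        finally show ?thesis .
      qed
      then show ?thesis unfolding exp_bounded_def by blast
    qed
    then show ?thesis using assms exp_bounded_mult by blast
  qed
  moreover have "f N + g N \<le> (f N + 1) * (g N + 1)" for N by (simp add: algebra_simps)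
  ultimately show ?thesis unfolding exp_bounded_def by (meson order_trans)
qed

lemma exp_bounded_power:
  assumes "exp_bounded f"
  shows "exp_bounded (\<lambda>N. f N ^ q)"
  using assms by (induction q) (auto intro: exp_bounded_const[of 1, simplified] exp_bounded_mult)

lemma exp_bounded_block: "exp_bounded (\<lambda>N. 2 ^ (N div k + 1))"
proof -
  have "2 ^ (N div k + 1) \<le> (2::nat) ^ (1 * (N + 1))" for N by (intro power_increasing) auto
  then show ?thesis unfolding exp_bounded_def by blast
qed

definition clause_bound :: "nat \<Rightarrow> nat \<Rightarrow> nat" where
  "clause_bound q N = (q + 1) * (2 * N + 1) ^ q"

lemma length_cnf:
  assumes "is_cnf q N F"
  shows "length F \<le> clause_bound q N"
proof -
  let ?A = "{..<N} \<times> (UNIV :: bool set)"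
  have A: "finite ?A" "card ?A = 2 * N" by (simp_all add: card_cartesian_product)
  have "set F \<subseteq> {C. set C \<subseteq> ?A \<and> length C \<le> q}" using assms by (fastforce simp: is_cnf_def)
  then have "card (set F) \<le> card {C. set C \<subseteq> ?A \<and> length C \<le> q}"
    using finite_lists_length_le[OF A(1)] by (intro card_mono)
  also have "\<dots> = (\<Sum>i\<le>q. (2 * N) ^ i)" using card_lists_length_le[OF A(1)] A(2) by simp
  \<comment> \<open>The base is raised to \<open>2 * N + 1\<close> because powers of
    \<open>2 * N\<close> need not increase with the exponent when \<open>N = 0\<close>.\<close>
  also have "\<dots> \<le> (\<Sum>i\<le>q. (2 * N + 1) ^ q)"
  proof (rule sum_mono)
    fix i assume "i \<in> {..q}"
    then have "(2 * N + 1) ^ i \<le> (2 * N + 1) ^ q" by (intro power_increasing) auto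
    moreover have "(2 * N) ^ i \<le> (2 * N + 1) ^ i" by (intro power_mono) auto
    ultimately show "(2 * N) ^ i \<le> (2 * N + 1) ^ q" by linarith
  qed
  finally show ?thesis using assms by (simp add: clause_bound_def is_cnf_def distinct_card)
qed

lemma length_encode_cnf:
  assumes "\<And>C. C \<in> set F \<Longrightarrow> length C \<le> q"
  shows "length (encode_cnf N F) \<le> 2 + length F * (q + 1)"
  using assms unfolding encode_cnf_def by (induction F) fastforce+

lemma encode_cnf_less:
  assumes "is_cnf q N F" "x \<in> set (encode_cnf N F)"
  shows "x \<le> 2 * N + length F + q"
proof -
  have "x \<le> q \<or> x \<le> 2 * N" if C: "C \<in> set F" and x: "x \<in> set (length C # map (\<lambda>(v, b). 2 * v + of_bool b) C)" for C
  proof (cases "x = length C")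
    case False
    then obtain v b where "(v, b) \<in> set C" "x = 2 * v + of_bool b" using x by auto
    moreover have "v < N" using assms(1) C \<open>(v, b) \<in> set C\<close> by (fastforce simp: is_cnf_def)
    ultimately show ?thesis by (cases b) auto
  qed (use assms(1) C in \<open>auto simp: is_cnf_def\<close>)
  then show ?thesis using assms(2) unfolding encode_cnf_def by fastforce
qed

text \<open>The number of assignments times the number of clauses plus 1, in terms of
  \<open>N\<close> alone. Up to constant factors it dominates the numbers of vertices and edges
  before subdividing.\<close>

definition graph_bound :: "nat \<Rightarrow> nat \<Rightarrow> nat \<Rightarrow> nat" where
  "graph_bound k q N = k * 2 ^ (N div k + 1) * (clause_bound q N + 1)"

text \<open>Shaped after the assumption \<open>big\<close>: 12 is its 10 plus the header of the
  input, \<open>9 * l\<close> comes from at most \<open>3 * graph_bound k q N\<close> edges, and 6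
  from the vertices.\<close>

definition word_bound :: "nat \<Rightarrow> nat \<Rightarrow> nat \<Rightarrow> nat \<Rightarrow> nat" where
  "word_bound k l q N = 12 + clause_bound q N * (q + 1) + (9 * l + 6) * graph_bound k q N + 2 * N + q"

text \<open>This is why words of \<open>O(N)\<close> bits suffice for the construction.\<close>

lemma exp_bounded_word_bound: "exp_bounded (word_bound k l q)"
  unfolding word_bound_def graph_bound_def clause_bound_def
  by (intro exp_bounded_add exp_bounded_mult exp_bounded_const exp_bounded_power exp_bounded_id
      exp_bounded_block)

lemma builder_bounds:
  assumes k: "2 \<le> k" and l: "1 \<le> l" and F: "is_cnf q N F" and big: "word_bound k l q N < 2 ^ w"
  shows "builder k l (N div k + 1) F N q w"
    and "length (cnf_edges k (N div k + 1) F) \<le> 3 * graph_bound k q N"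
    and "cnf_vertices k (N div k + 1) F + (l - 1) * length (cnf_edges k (N div k + 1) F) \<le> word_bound k l q N"
    and "length (encode_cnf N F) \<le> word_bound k l q N"
    and "builder.t_build k l (N div k + 1) F q \<le> (33 + 3 * (50 + 50 * l + 50 * q)) * graph_bound k q N"
proof -
  let ?s = "N div k + 1" let ?K = "k * 2 ^ (N div k + 1)" let ?M = "length F"
  let ?X = "graph_bound k q N"
  \<comment> \<open>The same product as in \<open>graph_bound\<close>, but with the true number of
    clauses; it equals \<open>?K * ?M + ?K\<close>, and the other counts are compared with these two
    terms.\<close>
  let ?Y = "?K * (?M + 1)"
  have M: "?M \<le> clause_bound q N" by (rule length_cnf[OF F])
  have YX: "?Y \<le> ?X" unfolding graph_bound_def using M by (intro mult_le_mono2) simp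
  have kK: "k \<le> ?K" by simp
  have "1 \<le> ?K" using kK k by linarith
  then have MKM: "?M \<le> ?K * ?M" by simp
  have Y: "?Y = ?K * ?M + ?K" by (simp add: algebra_simps)
  have mx: "k + ?M + ?K * (2 + 2 * ?M) \<le> 3 * ?X"
  proof -
    have "?K * (2 + 2 * ?M) = 2 * ?K + 2 * (?K * ?M)" by (simp add: algebra_simps)
    then show ?thesis using kK MKM YX unfolding Y by linarith
  qed
  have nX: "cnf_vertices k ?s F \<le> 6 * ?X"
    using kK MKM YX k unfolding Y cnf_vertices_def by linarith
  have Cq: "\<And>C. C \<in> set F \<Longrightarrow> length C \<le> q" using F by (simp add: is_cnf_def)
  have vN: "v < N" if "C \<in> set F" "(v, b) \<in> set C" for C v b
    using F that by (fastforce simp: is_cnf_def)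
  have "N < k * ?s" using k by (simp add: dividend_less_times_div algebra_simps)
  have B: "length (encode_cnf N F) \<le> 2 + clause_bound q N * (q + 1)"
    using length_encode_cnf[OF Cq, of F N] mult_le_mono1[OF M, of "q + 1"] by linarith
  have lmx: "3 * l * (k + ?M + ?K * (2 + 2 * ?M)) \<le> 9 * l * ?X"
    using mult_le_mono2[OF mx, of "3 * l"] by simp
  interpret cnf_graph k l ?s F
    using k l vN \<open>N < k * ?s\<close> by unfold_locales (auto intro: less_trans)
  have *: "length (encode_cnf N F) + cnf_vertices k ?s F + 3 * l * (k + ?M + ?K * (2 + 2 * ?M)) + 2 * N + q + 10
      \<le> word_bound k l q N"
    using B nX lmx unfolding word_bound_def by (simp add: algebra_simps)
  show b: "builder k l ?s F N q w"
    using * big Cq vN by unfold_locales auto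
  show le: "length (cnf_edges k ?s F) \<le> 3 * ?X" using length_es(2) mx by linarith
  have "(l - 1) * length (cnf_edges k ?s F) \<le> l * (3 * ?X)" using le by (intro mult_le_mono) auto
  then show "cnf_vertices k ?s F + (l - 1) * length (cnf_edges k ?s F) \<le> word_bound k l q N"
    using nX unfolding word_bound_def by (simp add: algebra_simps)
  show "length (encode_cnf N F) \<le> word_bound k l q N" using * by linarith
  interpret builder k l ?s F N q w by (rule b)
  \<comment> \<open>A generous bound: a round for one clause takes at most
    \<open>14 * l + 23 * q + 17\<close> instructions, and the fixed part of a vertex takes fewer
    than \<open>?A\<close> as well.\<close>
  let ?A = "50 + 50 * l + 50 * q"
  have tc: "t_clause + 5 \<le> ?A"
    by (simp add: t_clause_def dummy_args_def clause_start_def lit_code_def clause_args_def)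
  have "?M * (t_clause + 5) \<le> ?M * ?A" using tc by (rule mult_le_mono2)
  then have tv: "t_vertex + 5 \<le> (?M + 1) * ?A"
    by (simp add: t_vertex_def hub_args_def last_dummy_args_def vertex_start_def algebra_simps)
  have "?K * (t_vertex + 5) \<le> ?K * ((?M + 1) * ?A)" using tv by (rule mult_le_mono2)
  also have "\<dots> = ?Y * ?A" by (simp only: mult.assoc)
  also have "\<dots> \<le> ?X * ?A" using YX by (rule mult_le_mono1)
  finally have 1: "?K * (t_vertex + 5) \<le> ?X * ?A" .
  have "k \<le> ?X" "?M \<le> ?X" "1 \<le> ?X" using kK MKM YX k unfolding Y by linarith+
  then have "k * (2 + (7 * l + 1) + 5) \<le> ?X * ?A" "?M * (2 + (7 * l + 1) + 5) \<le> ?X * ?A" "33 \<le> 33 * ?X"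
    by (auto intro!: mult_le_mono simp del: mult_Suc_right)
  \<comment> \<open>The 33 instructions outside the loop rounds are 19 at the start, 7 at the end,
    two between successive loops and one exit test for each of the three loops.\<close>
  moreover have "t_build = 33 + k * (2 + (7 * l + 1) + 5) + ?M * (2 + (7 * l + 1) + 5) + ?K * (t_vertex + 5)"
    unfolding t_build_def start_code_def end_code_def by simp
  moreover have "(33 + 3 * ?A) * ?X = 33 * ?X + 3 * (?X * ?A)" by (simp add: algebra_simps)
  ultimately show "t_build \<le> (33 + 3 * ?A) * ?X" using 1 by linarith
qed

text \<open>The constant \<open>C\<close> turns sizes into bits: the graph has at most
  \<open>2 ^ (C * (N + 1))\<close> vertices, so the simulated words have at most
  \<open>c * C * (N + 1)\<close> bits. The offset \<open>B\<close> accounts for the summand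
  \<open>C\<close>, and adding it for one more bit, covered by the summand 1.\<close>

lemma sat_by_distinguisher:
  assumes k: "2 \<le> k" and l: "1 \<le> l" and F: "is_cnf q N F"
    and dis: "\<And>n es. input_graph n es \<Longrightarrow> k \<le> n \<Longrightarrow>
        (k_radius k {..<n} (edge_set es) \<le> enat (2 * l) \<longrightarrow>
           runs P (word_size c n) (encode_graph n es) (T (length es)) (\<lambda>s. reg s 0 = 1)) \<and>
        (k_radius k {..<n} (edge_set es) \<ge> enat (3 * l) \<longrightarrow>
           runs P (word_size c n) (encode_graph n es) (T (length es)) (\<lambda>s. reg s 0 = 0))"
    and C: "\<And>N. word_bound k l q N \<le> 2 ^ (C * (N + 1))"
    and T: "\<And>m. m \<le> l * (3 * graph_bound k q N) \<Longrightarrow> T m \<le> t"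
  shows "runs ((build_code k l ;; simcode P ;; blk [Const 1 0, Op Add 0 50 1]) 0)
    ((c * C + C + 1) * (N + 1)) (encode_cnf N F)
    ((33 + 3 * (50 + 50 * l + 50 * q)) * graph_bound k q N + 2 * t + 2)
    (\<lambda>s. reg s 0 = of_bool (satisfiable F))"
proof -
  let ?w' = "(c * C + C + 1) * (N + 1)"
  let ?s = "N div k + 1"
  have "?w' = c * C * (N + 1) + C * (N + 1) + (N + 1)" by (simp add: algebra_simps)
  then have CN: "(2::nat) ^ (C * (N + 1)) < 2 ^ ?w'" by (intro power_strict_increasing) linarith+
  have wb: "word_bound k l q N < 2 ^ ?w'" using C[of N] CN by linarith
  note bounds = builder_bounds[OF k l F wb]
  interpret builder k l ?s F N q ?w' by (rule bounds(1))
  let ?n = "n + (l - 1) * length es"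
  let ?es = "subdivide l n es"
  let ?w = "word_size c ?n"
  have kn: "k \<le> ?n" by (simp add: cnf_vertices_def)
  have n: "?n \<le> 2 ^ (C * (N + 1))" using bounds(3) C[of N] by linarith
  have w: "?w \<le> c * (C * (N + 1))" using kn k by (intro word_size_le[OF _ n]) linarith
  have "length ?es \<le> l * (3 * graph_bound k q N)"
    unfolding length_subdivide using bounds(2) by (rule mult_le_mono2)
  then have Tt: "T (length ?es) \<le> t" by (rule T)
  have run: "runs P ?w graph_code t (\<lambda>s. reg s 0 = of_bool (satisfiable F))"
  proof (cases "satisfiable F")
    case True
    have "runs P ?w graph_code (T (length ?es)) (\<lambda>s. reg s 0 = 1)"
      unfolding graph_code_def using dis[OF input_graph kn] k_radius_le_if_satisfiable[OF True] by blast
    moreover have "of_bool (satisfiable F) = (1::nat)" using True by simp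
    ultimately show ?thesis using runs_mono[OF _ Tt] by metis
  next
    case False
    then have "enat (3 * l) \<le> k_radius k {..<?n} E" using satisfiable_if_k_radius_less by (meson not_le)
    then have "runs P ?w graph_code (T (length ?es)) (\<lambda>s. reg s 0 = 0)"
      unfolding graph_code_def using dis[OF input_graph kn] by blast
    moreover have "of_bool (satisfiable F) = (0::nat)" using False by simp
    ultimately show ?thesis using runs_mono[OF _ Tt] by metis
  qed
  have "clause_bound q N \<le> clause_bound q N * (q + 1)" by simp
  then have "x < 2 ^ ?w'" if "x \<in> set xs" for x
    using encode_cnf_less[OF F that] length_cnf[OF F] wb unfolding word_bound_def by linarith
  moreover have "B < 2 ^ ?w'" using bounds(4) wb by linarith
  ultimately have f: "fits ?w' (init_state xs)" by (auto simp: fits_def init_state_def)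
  have "(2::nat) ^ ?w + B \<le> 2 ^ ((c * C + C) * (N + 1)) + 2 ^ ((c * C + C) * (N + 1))"
  proof (rule add_mono)
    have "?w \<le> (c * C + C) * (N + 1)" using w by (simp add: algebra_simps)
    then show "(2::nat) ^ ?w \<le> 2 ^ ((c * C + C) * (N + 1))" by (intro power_increasing) auto
    have "(2::nat) ^ (C * (N + 1)) \<le> 2 ^ ((c * C + C) * (N + 1))"
      by (intro power_increasing mult_le_mono1) auto
    then show "B \<le> 2 ^ ((c * C + C) * (N + 1))" using bounds(4) C[of N] by linarith
  qed
  also have "\<dots> = 2 ^ ((c * C + C) * (N + 1) + 1)" by simp
  also have "\<dots> \<le> 2 ^ ?w'" by (intro power_increasing) auto
  finally have ww: "2 ^ ?w + B \<le> 2 ^ ?w'" .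
  have "runs ((build_code k l ;; simcode P ;; blk [Const 1 0, Op Add 0 50 1]) 0) ?w' xs (t_build + 2 * t + 2)
    (\<lambda>s. reg s 0 = of_bool (satisfiable F))"
  proof (rule runs_simulation[where Q' = "\<lambda>x. x = of_bool (satisfiable F)", OF _ f run ww])
    show "wp ?w' (build_code k l) t_build (\<lambda>g m. g 0 = B \<and> g 50 = length graph_code \<and> (\<forall>r>50. g r = 0) \<and>
      (\<forall>a. m (B + a) = (if a < length graph_code then graph_code ! a else 0)))
      (reg (init_state xs)) (mem (init_state xs))"
      using wp_build unfolding built_def .
    fix s g and m :: "nat \<Rightarrow> nat"
    assume "reg s 0 = of_bool (satisfiable F)" "\<And>r. g (r + 50) = reg s r"
    then have "g 50 = of_bool (satisfiable F)" by (metis add_0)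
    then have "wp ?w' (blk [Const 1 0, Op Add 0 50 1]) (length [Const 1 0, Op Add 0 50 1])
        (\<lambda>g m. g 0 = of_bool (satisfiable F)) g m"
      using word_gt(1) by (intro wp_blk) auto
    then show "wp ?w' (blk [Const 1 0, Op Add 0 50 1]) 2 (\<lambda>g m. g 0 = of_bool (satisfiable F)) g m"
      by (rule wp_mono) simp_all
  qed
  then show ?thesis by (rule runs_mono) (use bounds(5) in simp)
qed

section \<open>Asymptotic running times\<close>

lemma bigo_powr_bound:
  fixes T :: "nat \<Rightarrow> nat"
  assumes "(\<lambda>m. real (T m)) \<in> O(\<lambda>m. real m powr \<theta>)"
  obtains c where "0 \<le> c" "\<And>m. real (T m) \<le> c * (1 + real m powr \<theta>)"
proof -
  obtain c where c: "0 < c" "eventually (\<lambda>m. norm (real (T m)) \<le> c * norm (real m powr \<theta>)) at_top"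
    using assms by (rule landau_o.bigE)
  then obtain m0 where m0: "\<And>m. m0 \<le> m \<Longrightarrow> real (T m) \<le> c * real m powr \<theta>"
    by (auto simp: eventually_at_top_linorder)
  \<comment> \<open>The finitely many exceptions are absorbed by their sum. They include
    \<open>m = 0\<close>, where the power vanishes, hence the summand 1 in the bound.\<close>
  define c' where "c' = c + (\<Sum>m<m0. real (T m))"
  have S: "0 \<le> (\<Sum>m<m0. real (T m))" by (simp add: sum_nonneg)
  have "real (T m) \<le> c' * (1 + real m powr \<theta>)" for m
  proof (cases "m < m0")
    case True
    then have "real (T m) \<le> (\<Sum>m<m0. real (T m))" by (intro member_le_sum) auto
    also have "\<dots> \<le> c' * 1" using c(1) by (simp add: c'_def)
    also have "\<dots> \<le> c' * (1 + real m powr \<theta>)" using c(1) S by (intro mult_left_mono) (auto simp: c'_def)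
    finally show ?thesis .
  next
    case False
    then have "real (T m) \<le> c * real m powr \<theta>" by (intro m0) simp
    also have "\<dots> \<le> c' * (1 + real m powr \<theta>)" using c(1) S by (intro mult_mono) (auto simp: c'_def)
    finally show ?thesis .
  qed
  then show thesis using that[of c'] c(1) S by (simp add: c'_def)
qed

text \<open>The power is polynomial in \<open>N\<close> times
  \<open>2 powr (N * \<theta> / k)\<close>. Moving the exponent halfway from
  \<open>\<theta> / k\<close> to 1 absorbs the polynomial and still leaves a base below 2.\<close>

lemma graph_bound_powr:
  fixes \<theta> :: real
  assumes k: "2 \<le> k" and \<theta>: "0 < \<theta>" "\<theta> < k"
  shows "(\<lambda>N. real (graph_bound k q N) powr \<theta>) \<in> O(\<lambda>N. (2 powr ((1 + \<theta> / k) / 2)) ^ N)"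
proof -
  define A where "A = 2 * real k * (real (q + 1) * 2 ^ q + 1)"
  define a where "a = real q * \<theta>"
  \<comment> \<open>Half the distance from \<open>\<theta> / k\<close> to 1, so that
    \<open>\<theta> / k + b = (1 + \<theta> / k) / 2\<close>.\<close>
  define b where "b = (1 - \<theta> / k) / 2"
  have b: "0 < b" using \<theta> k by (simp add: b_def)
  have bound: "real (graph_bound k q N) \<le> A * ((real N + 1) ^ q * 2 powr (real N / real k))" for N
  proof -
    have "real (N div k) \<le> real N / real k" by (rule of_nat_div_le_of_nat)
    then have "(2::real) powr real (N div k) \<le> 2 powr (real N / real k)" by (intro powr_mono) auto
    then have 1: "real (k * 2 ^ (N div k + 1)) \<le> 2 * real k * 2 powr (real N / real k)"
      by (simp add: powr_realpow mult_left_mono)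
    have "real (2 * N + 1) ^ q \<le> (2 * (real N + 1)) ^ q" by (intro power_mono) auto
    also have "\<dots> = 2 ^ q * (real N + 1) ^ q" by (rule power_mult_distrib)
    finally have "real (clause_bound q N) \<le> real (q + 1) * (2 ^ q * (real N + 1) ^ q)"
      unfolding clause_bound_def of_nat_mult of_nat_power by (intro mult_left_mono) auto
    moreover have "1 \<le> (real N + 1) ^ q" by simp
    moreover have "(real (q + 1) * 2 ^ q + 1) * (real N + 1) ^ q =
        real (q + 1) * (2 ^ q * (real N + 1) ^ q) + (real N + 1) ^ q"
      by (simp add: algebra_simps)
    ultimately have 2: "real (clause_bound q N + 1) \<le> (real (q + 1) * 2 ^ q + 1) * (real N + 1) ^ q"
      by linarith
    have "real (graph_bound k q N) \<le>
        (2 * real k * 2 powr (real N / real k)) * ((real (q + 1) * 2 ^ q + 1) * (real N + 1) ^ q)"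
      unfolding graph_bound_def of_nat_mult[of _ "clause_bound q N + 1"] by (rule mult_mono[OF 1 2]) auto
    also have "\<dots> = A * ((real N + 1) ^ q * 2 powr (real N / real k))"
      by (simp add: A_def algebra_simps)
    finally show ?thesis .
  qed
  have A: "0 \<le> A" by (simp add: A_def)
  have "real (graph_bound k q N) powr \<theta> \<le> A powr \<theta> * ((real N + 1) powr a * 2 powr (real N * (\<theta> / k)))" for N
  proof -
    have "real (graph_bound k q N) powr \<theta> \<le> (A * ((real N + 1) ^ q * 2 powr (real N / real k))) powr \<theta>"
      using bound \<theta> by (intro powr_mono2) auto
    also have "\<dots> = A powr \<theta> * (((real N + 1) powr real q) powr \<theta> * (2 powr (real N / real k)) powr \<theta>)"
      using A by (simp add: powr_mult powr_realpow)
    finally show ?thesis by (simp add: powr_powr a_def)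
  qed
  then have "(\<lambda>N. real (graph_bound k q N) powr \<theta>) \<in>
      O(\<lambda>N. (real N + 1) powr a * 2 powr (real N * (\<theta> / k)))"
    by (intro bigoI[of _ "A powr \<theta>"] always_eventually allI) (simp add: abs_mult)
  also have "(\<lambda>N. (real N + 1) powr a * 2 powr (real N * (\<theta> / k))) \<in>
      O(\<lambda>N. 2 powr (real N * b) * 2 powr (real N * (\<theta> / k)))"
  proof (rule landau_o.big.mult_right)
    show "(\<lambda>N. (real N + 1) powr a) \<in> O(\<lambda>N. 2 powr (real N * b))" using b by real_asymp
  qed
  also have "(\<lambda>N. 2 powr (real N * b) * 2 powr (real N * (\<theta> / k))) = (\<lambda>N. (2 powr ((1 + \<theta> / k) / 2)) ^ N)"
  proof
    fix N
    have "real N * b + real N * (\<theta> / k) = (1 + \<theta> / k) / 2 * real N" by (simp add: b_def field_simps)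
    then have "2 powr (real N * b) * 2 powr (real N * (\<theta> / k)) = (2::real) powr ((1 + \<theta> / k) / 2 * real N)"
      by (metis powr_add)
    also have "\<dots> = (2 powr ((1 + \<theta> / k) / 2)) powr real N" by (rule powr_powr[symmetric])
    also have "\<dots> = (2 powr ((1 + \<theta> / k) / 2)) ^ N" by (rule powr_realpow) simp
    finally show "2 powr (real N * b) * 2 powr (real N * (\<theta> / k)) = (2 powr ((1 + \<theta> / k) / 2)) ^ N" .
  qed
  finally show ?thesis .
qed

lemma qsat_by_distinguisher:
  assumes k: "2 \<le> k" and l: "1 \<le> l" and dis: "distinguishes_in_time k (2 * l) (3 * l) T"
    and T: "(\<lambda>m. real (T m)) \<in> O(\<lambda>m. real m powr \<theta>)" and \<theta>: "1 \<le> \<theta>" "\<theta> < k"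
  shows "\<exists>T'. qsat_in_time q T' \<and> (\<lambda>N. real (T' N)) \<in> O(\<lambda>N. (2 powr ((1 + \<theta> / k) / 2)) ^ N)"
proof -
  obtain P c where P: "\<And>n es. input_graph n es \<Longrightarrow> k \<le> n \<Longrightarrow>
        (k_radius k {..<n} (edge_set es) \<le> enat (2 * l) \<longrightarrow>
           runs P (word_size c n) (encode_graph n es) (T (length es)) (\<lambda>s. reg s 0 = 1)) \<and>
        (k_radius k {..<n} (edge_set es) \<ge> enat (3 * l) \<longrightarrow>
           runs P (word_size c n) (encode_graph n es) (T (length es)) (\<lambda>s. reg s 0 = 0))"
    using dis unfolding distinguishes_in_time_def by blast
  obtain C where C: "\<And>N. word_bound k l q N \<le> 2 ^ (C * (N + 1))"
    using exp_bounded_word_bound unfolding exp_bounded_def by blast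
  obtain a where a: "0 \<le> a" "\<And>m. real (T m) \<le> a * (1 + real m powr \<theta>)"
    using bigo_powr_bound[OF T] by blast
  let ?X = "graph_bound k q"
  \<comment> \<open>Formulas on \<open>N\<close> variables lead to graphs of various sizes, and
    \<open>T\<close> need not be monotone; \<open>t N\<close> bounds \<open>T\<close> on all these
    sizes.\<close>
  define t where "t N = nat \<lceil>a * (1 + real (l * (3 * ?X N)) powr \<theta>)\<rceil>" for N
  define D where "D = 33 + 3 * (50 + 50 * l + 50 * q)"
  define T' where "T' N = D * ?X N + 2 * t N + 2" for N
  have Tt: "T m \<le> t N" if "m \<le> l * (3 * ?X N)" for m N
  proof -
    have "real m powr \<theta> \<le> real (l * (3 * ?X N)) powr \<theta>" using that \<theta> by (intro powr_mono2) (auto simp flip: of_nat_mult)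
    then have "real (T m) \<le> a * (1 + real (l * (3 * ?X N)) powr \<theta>)"
      using a(2)[of m] mult_left_mono[OF _ a(1)] by (meson add_left_mono order_trans)
    then show ?thesis unfolding t_def by linarith
  qed
  have "qsat_in_time q T'" unfolding qsat_in_time_def
  proof (intro exI allI impI)
    fix N F assume "is_cnf q N F"
    from sat_by_distinguisher[OF k l this P C Tt]
    show "runs ((build_code k l ;; simcode P ;; blk [Const 1 0, Op Add 0 50 1]) 0)
        ((c * C + C + 1) * (N + 1)) (encode_cnf N F) (T' N) (\<lambda>s. reg s 0 = of_bool (satisfiable F))"
      unfolding T'_def D_def .
  qed
  moreover have "(\<lambda>N. real (T' N)) \<in> O(\<lambda>N. real (?X N) powr \<theta>)"
  proof -
    define c' where "c' = real D + 2 * a * (1 + real (l * 3) powr \<theta>) + 4"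
    have "real (T' N) \<le> c' * real (?X N) powr \<theta>" for N
    proof -
      let ?x = "real (?X N)"
      have "0 < ?X N" using k by (simp add: graph_bound_def)
      then have x1: "1 \<le> ?x" by linarith
      \<comment> \<open>Building the graph costs a multiple of \<open>?x\<close>; it is dominated by
        the simulation because \<open>\<theta> \<ge> 1\<close>.\<close>
      have x: "?x \<le> ?x powr \<theta>" using powr_mono[OF \<theta>(1) x1] x1 by simp
      have "real (t N) \<le> a * (1 + real (l * (3 * ?X N)) powr \<theta>) + 1"
        unfolding t_def using a(1) by (simp add: of_nat_nat)
      also have "real (l * (3 * ?X N)) powr \<theta> = real (l * 3) powr \<theta> * ?x powr \<theta>"
        by (simp add: powr_mult mult_ac)
      finally have "real (T' N) \<le> real D * ?x + 2 * (a * (1 + real (l * 3) powr \<theta> * ?x powr \<theta>) + 1) + 2"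
        by (simp add: T'_def)
      also have "\<dots> \<le> real D * ?x powr \<theta> +
          2 * (a * (?x powr \<theta> + real (l * 3) powr \<theta> * ?x powr \<theta>) + ?x powr \<theta>) + 2 * ?x powr \<theta>"
        using x x1 a(1) by (intro add_mono mult_left_mono) auto
      also have "\<dots> = c' * ?x powr \<theta>" by (simp add: c'_def algebra_simps)
      finally show ?thesis .
    qed
    then show ?thesis by (intro bigoI[of _ c'] always_eventually allI) simp
  qed
  then have "(\<lambda>N. real (T' N)) \<in> O(\<lambda>N. (2 powr ((1 + \<theta> / k) / 2)) ^ N)"
    by (rule landau_o.big_trans) (use \<theta> in \<open>intro graph_bound_powr[OF k]; simp\<close>)
  ultimately show ?thesis by blast
qed

lemma no_fast_distinguisher:
  assumes k: "2 \<le> k" and l: "1 \<le> l" and SETH and \<theta>: "1 \<le> \<theta>" "\<theta> < k"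
    and T: "(\<lambda>m. real (T m)) \<in> O(\<lambda>m. real m powr \<theta>)"
  shows "\<not> distinguishes_in_time k (2 * l) (3 * l) T"
proof
  assume dis: "distinguishes_in_time k (2 * l) (3 * l) T"
  let ?u = "(1 + \<theta> / k) / 2"
  have "(2::real) powr ?u < 2 powr 1" using \<theta> k by (intro powr_less_mono) auto
  moreover have "0 < (2::real) powr ?u" by simp
  \<comment> \<open>The \<open>\<epsilon>\<close> of \<open>SETH\<close> is
    \<open>2 - 2 powr ?u\<close>. It does not depend on \<open>q\<close>, as the order of
    quantifiers in \<open>SETH\<close> demands.\<close>
  ultimately have "0 < 2 - (2::real) powr ?u \<and> 2 - (2::real) powr ?u < 2" by simp
  then obtain q where "\<not> (\<exists>T. qsat_in_time q T \<and>
      (\<lambda>N. real (T N)) \<in> O(\<lambda>N. (2 - (2 - (2::real) powr ?u)) ^ N))"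
    using \<open>SETH\<close> unfolding SETH_def by blast
  then show False using qsat_by_distinguisher[OF k l dis T \<theta>, of q] by simp
qed

lemma powr_bigo_mono:
  "a \<le> b \<Longrightarrow> (\<lambda>m. real m powr a) \<in> O(\<lambda>m. real m powr b)"
  by (intro landau_o.bigI[of 1])
    (auto intro!: eventually_sequentiallyI[of 1] powr_mono)

theorem mainTheorem2:
  fixes k l :: nat
  assumes "k \<ge> 2" and "l \<ge> 1" and SETH
  shows "(\<forall>\<delta>::real. \<delta> > 0 \<longrightarrow>
            \<not> (\<exists>T. distinguishes_in_time k (2 * l) (3 * l) T \<and>
                   (\<lambda>m. real (T m)) \<in> O(\<lambda>m. real m powr (real k - \<delta>)))) \<and>
         (\<forall>\<epsilon> \<beta> \<delta> :: real. 0 < \<epsilon> \<and> \<epsilon> < 1 \<and> \<beta> \<ge> 0 \<and> \<delta> > 0 \<longrightarrow>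
            \<not> (\<exists>T. approximates_in_time k (3 / 2 - \<epsilon>) \<beta> T \<and>
                   (\<lambda>m. real (T m)) \<in> O(\<lambda>m. real m powr (real k - \<delta>))))"
proof (intro conjI allI impI notI; elim conjE exE)
  \<comment> \<open>Replacing \<open>\<delta>\<close> by \<open>min \<delta> 1\<close> only weakens
    the assumed time bound and keeps the exponent at least \<open>k - 1 \<ge> 1\<close>, as the cost
    of the construction requires.\<close>
  have \<theta>: "1 \<le> real k - min \<delta> 1" "real k - min \<delta> 1 < real k"
    "(\<lambda>m. real m powr (real k - \<delta>)) \<in> O(\<lambda>m. real m powr (real k - min \<delta> 1))" if "\<delta> > 0" for \<delta>
    using that \<open>k \<ge> 2\<close> by (auto intro: powr_bigo_mono)
  fix \<delta> :: real and T
  assume \<delta>: "\<delta> > 0" and T: "(\<lambda>m. real (T m)) \<in> O(\<lambda>m. real m powr (real k - \<delta>))"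
  have T': "(\<lambda>m. real (T m)) \<in> O(\<lambda>m. real m powr (real k - min \<delta> 1))"
    using T \<theta>(3)[OF \<delta>] by (rule landau_o.big_trans)
  {
    assume "distinguishes_in_time k (2 * l) (3 * l) T"
    then show False using no_fast_distinguisher[OF assms \<theta>(1,2)[OF \<delta>] T'] by blast
  next
    fix \<epsilon> \<beta> :: real
    assume \<epsilon>: "0 < \<epsilon>" "\<epsilon> < 1" "0 \<le> \<beta>" and appr: "approximates_in_time k (3 / 2 - \<epsilon>) \<beta> T"
    \<comment> \<open>The gap condition reads
      \<open>3 * l' - 2 * \<epsilon> * l' + \<beta> < 3 * l'\<close>, that is
      \<open>\<beta> < 2 * \<epsilon> * l'\<close>.\<close>
    obtain l' where l': "\<beta> / (2 * \<epsilon>) < real l'" using reals_Archimedean2 by blast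
    moreover have "0 \<le> \<beta> / (2 * \<epsilon>)" using \<epsilon> by simp
    ultimately have "1 \<le> l'" by (cases l') auto
    have "\<beta> < real l' * (2 * \<epsilon>)" using l' \<epsilon> by (simp add: divide_less_eq)
    then have "(3 / 2 - \<epsilon>) * real (2 * l') + \<beta> < real (3 * l')" by (simp add: algebra_simps)
    then have "distinguishes_in_time k (2 * l') (3 * l') (\<lambda>m. 2 * T m + 9)"
      using \<epsilon> by (intro approximation_distinguishes[OF appr \<open>k \<ge> 2\<close> \<open>1 \<le> l'\<close>]) auto
    moreover have "(\<lambda>m. real (2 * T m + 9)) \<in> O(\<lambda>m. real m powr (real k - min \<delta> 1))"
    proof -
      have "(\<lambda>m. 2 * real (T m)) \<in> O(\<lambda>m. real m powr (real k - min \<delta> 1))" using T' by simp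
      moreover have "(\<lambda>m. 9 :: real) \<in> O(\<lambda>m. real m powr (real k - min \<delta> 1))"
        using \<theta>(1)[OF \<delta>] by (intro landau_o.bigI[of 9])
          (auto intro!: eventually_sequentiallyI[of 1] ge_one_powr_ge_zero)
      ultimately show ?thesis by (simp add: sum_in_bigo)
    qed
    ultimately show False
      using no_fast_distinguisher[OF \<open>k \<ge> 2\<close> \<open>1 \<le> l'\<close> \<open>SETH\<close> \<theta>(1,2)[OF \<delta>], of "\<lambda>m. 2 * T m + 9"]
      by blast
  }
qed

end
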